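(* Let $p_1,p_2\in L^1_{even}(\mathbb T)$ be real (where $p_2=p$) and let $T_0=-\frac{d^2}{dx^2}+q_0$ in $L^2(\mathbb R)$, where $q_0(x)=p_1(x)$ for $x<0$ and $q_0(x)=p_2(x)$ for $x>0$. Assume that some gap of $T_0$ is given by $\widetilde\gamma(T_0)=\widetilde\gamma_1\cap\widetilde\gamma_2\ne\emptyset$, where $\widetilde\gamma_j$ is a gap of $H_j=-\frac{d^2}{dx^2}+p_j$, $j=1,2$. When $\widetilde\gamma_j$ is a bounded gap, let $\widetilde\mu_j,\widetilde\nu_j\in\overline{\widetilde\gamma_j}$ be the corresponding Dirichlet and Neumann eigenvalues (so that $|\widetilde\gamma_j|=|\widetilde\mu_j-\widetilde\nu_j|$). Then: (a) if $|\widetilde\gamma_1|,|\widetilde\gamma_2|<\infty$, then $$\#(T_0,\widetilde\gamma(T_0))=\begin{cases}0 & \text{if } (\widetilde\mu_1-\widetilde\nu_1)(\widetilde\mu_2-\widetilde\nu_2)>0,\\ 1 & \text{if } (\widetilde\mu_1-\widetilde\nu_1)(\widetilde\mu_2-\widetilde\nu_2)<0;\end{cases}$$ (b) if $|\widetilde\gamma_2|<\infty=|\widetilde\gamma_1|$, with $\widetilde\gamma_1=(-\infty,0)$, then $$\#(T_0,\widetilde\gamma(T_0))=\begin{cases}0 & \text{if } \widetilde\mu_2<\widetilde\nu_2,\\ 1 & \text{if } \widetilde\nu_2<\widetilde\mu_2\le 0;\end{cases}$$ (c) if $\widetilde\gamma(T_0)=(-\infty,0)$ (both gaps $\widetilde\gamma_1,\widetilde\gamma_2$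 being the unbounded ones), then $\#(T_0,\widetilde\gamma(T_0))=0$.
   Context: $\mathbb T=\mathbb R/\mathbb Z$; $L^r_{even}(\mathbb T)=\{p\in L^r(\mathbb T): p(x)=p(1-x),\ 0<x<1\}$. The spectrum of a Hill operator $H=-\frac{d^2}{dx^2}+p$ in $L^2(\mathbb R)$ is the union of bands $[\alpha_{n-1}^+,\alpha_n^-]$, $n\ge1$, $\alpha_{n-1}^+<\alpha_n^-\le\alpha_n^+$; its gaps are $\gamma_n(H)=(\alpha_n^-,\alpha_n^+)$, $n\ge1$, and the unbounded gap $\gamma_0(H)=(-\infty,\alpha_0^+)$. $\mu_n(p)$, $n\ge1$, are the eigenvalues of $-y''+py=\lambda y$ on $[0,1]$ with $y(0)=y(1)=0$, and $\nu_n(p)$, $n\ge0$, those with $y'(0)=y'(1)=0$; $\mu_n,\nu_n\in[\alpha_n^-,\alpha_n^+]$ for $n\ge1$, and for even $p$ one has $|\gamma_n(H)|=|\mu_n(p)-\nu_n(p)|$. The Dirichlet/Neumann eigenvalues corresponding to the gap $\gamma_n(H)$ are $\mu_n,\nu_n$. The absolutely continuous spectrum of $T_0$ is $\sigma(H_1)\cup\sigma(H_2)$, and a gap of $T_0$ is a component of its complement in $\mathbb R$. $\#(T_0,\omega)$ is the number of eigenvalues of $T_0$ in the interval $\omega$. *)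

theory Defs
  imports "HOL-Analysis.Analysis" "HOL-Library.Extended_Nat"
begin

text \<open>Functions on the circle \<open>\<real>/\<int>\<close> are represented by 1-periodic functions on \<open>\<real>\<close>.
  Evenness is required almost everywhere, since members of \<open>L\<^sup>1\<close> are classes modulo null sets.\<close>

definition L1_even :: "(real \<Rightarrow> real) set" where
  "L1_even = {p. (\<forall>x. p (x + 1) = p x) \<and> p absolutely_integrable_on {0..1} \<and>
                 (AE x in lebesgue. 0 < x \<and> x < 1 \<longrightarrow> p x = p (1 - x))}"

definition L2 :: "(real \<Rightarrow> complex) set" where
  "L2 = {f. f \<in> borel_measurable lebesgue \<and> integrable lebesgue (\<lambda>x. (cmod (f x))\<^sup>2)}"

definition L2_nrm :: "(real \<Rightarrow> complex) \<Rightarrow> real" where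
  "L2_nrm f = sqrt (integral\<^sup>L lebesgue (\<lambda>x. (cmod (f x))\<^sup>2))"

text \<open>\<open>f\<close> is locally absolutely continuous on the interval \<open>S\<close> and \<open>f'\<close> is (a version of) its
  derivative, i.e. \<open>f\<close> is an indefinite Lebesgue integral of the locally integrable \<open>f'\<close>.\<close>

definition AC_deriv_on :: "real set \<Rightarrow> (real \<Rightarrow> complex) \<Rightarrow> (real \<Rightarrow> complex) \<Rightarrow> bool" where
  "AC_deriv_on S f f' \<longleftrightarrow>
     (\<forall>a\<in>S. \<forall>b\<in>S. a \<le> b \<longrightarrow>
        f' absolutely_integrable_on {a..b} \<and> f b - f a = integral {a..b} f')"

text \<open>The graph of \<open>T = -d\<^sup>2/dx\<^sup>2 + q\<close> in \<open>L\<^sup>2(\<real>)\<close> on its maximal domain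
  \<open>{f \<in> L\<^sup>2. f, f' \<in> AC\<^sub>l\<^sub>o\<^sub>c, -f'' + q f \<in> L\<^sup>2}\<close>.  For the (uniformly locally integrable, real)
  potentials used here both endpoints are in the limit point case, so this operator is the
  self-adjoint realisation.  Elements of the domain are given by their continuous
  representative, while \<open>g = T f\<close> is determined almost everywhere.\<close>

definition schrodinger_op :: "(real \<Rightarrow> real) \<Rightarrow> (real \<Rightarrow> complex) \<Rightarrow> (real \<Rightarrow> complex) \<Rightarrow> bool" where
  "schrodinger_op q f g \<longleftrightarrow> f \<in> L2 \<and> g \<in> L2 \<and>
     (\<exists>f' f''. AC_deriv_on UNIV f f' \<and> AC_deriv_on UNIV f' f'' \<and>
        (AE x in lebesgue. g x = - f'' x + complex_of_real (q x) * f x))"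

text \<open>\<open>T - z\<close> maps the domain onto \<open>L\<^sup>2\<close> and is bounded below (which entails injectivity
  modulo null functions), that is, it has a bounded everywhere defined inverse.\<close>

definition resolvent_set :: "(real \<Rightarrow> real) \<Rightarrow> complex set" where
  "resolvent_set q = {z.
     (\<forall>h\<in>L2. \<exists>f g. schrodinger_op q f g \<and> (AE x in lebesgue. g x - z * f x = h x)) \<and>
     (\<exists>C. \<forall>f g. schrodinger_op q f g \<longrightarrow> L2_nrm f \<le> C * L2_nrm (\<lambda>x. g x - z * f x))}"

definition op_spectrum :: "(real \<Rightarrow> real) \<Rightarrow> complex set" where
  "op_spectrum q = - resolvent_set q"

definition eigenvalue :: "(real \<Rightarrow> real) \<Rightarrow> real \<Rightarrow> bool" where
  "eigenvalue q E \<longleftrightarrow> (\<exists>f g. schrodinger_op q f g \<and> \<not> (AE x in lebesgue. f x = 0) \<and>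
     (AE x in lebesgue. g x = complex_of_real E * f x))"

text \<open>Eigenvalues are counted without multiplicity; on the line every eigenvalue is simple
  because of the limit point property.\<close>

definition num_eigenvalues :: "(real \<Rightarrow> real) \<Rightarrow> real set \<Rightarrow> enat" where
  "num_eigenvalues q \<omega> =
     (if finite {E\<in>\<omega>. eigenvalue q E} then enat (card {E\<in>\<omega>. eigenvalue q E}) else \<infinity>)"

text \<open>The nonempty gaps of the Hill operator with potential \<open>p\<close>, including the unbounded one.\<close>

definition hill_gaps :: "(real \<Rightarrow> real) \<Rightarrow> real set set" where
  "hill_gaps p = components {E. complex_of_real E \<notin> op_spectrum p}"

definition junction :: "(real \<Rightarrow> real) \<Rightarrow> (real \<Rightarrow> real) \<Rightarrow> real \<Rightarrow> real" where
  "junction p1 p2 = (\<lambda>x. if x < 0 then p1 x else p2 x)"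

text \<open>Gaps of the junction operator are components of the complement of its absolutely
  continuous spectrum, which is the union of the spectra of the two Hill operators.\<close>

definition junction_gaps :: "(real \<Rightarrow> real) \<Rightarrow> (real \<Rightarrow> real) \<Rightarrow> real set set" where
  "junction_gaps p1 p2 =
     components {E. complex_of_real E \<notin> op_spectrum p1 \<union> op_spectrum p2}"

text \<open>\<open>y\<close>, with derivative \<open>y'\<close>, is a nontrivial solution of \<open>-y'' + p y = E y\<close> on \<open>[0,1]\<close>.\<close>

definition solution_on_period ::
    "(real \<Rightarrow> real) \<Rightarrow> real \<Rightarrow> (real \<Rightarrow> complex) \<Rightarrow> (real \<Rightarrow> complex) \<Rightarrow> bool" where
  "solution_on_period p E y y' \<longleftrightarrow> AC_deriv_on {0..1} y y' \<and> (\<exists>x\<in>{0..1}. y x \<noteq> 0) \<and>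
     (\<exists>y''. AC_deriv_on {0..1} y' y'' \<and>
        (AE x in lebesgue_on {0..1}.
           - y'' x + complex_of_real (p x) * y x = complex_of_real E * y x))"

definition dirichlet_eigenvalue :: "(real \<Rightarrow> real) \<Rightarrow> real \<Rightarrow> bool" where
  "dirichlet_eigenvalue p \<mu> \<longleftrightarrow> (\<exists>y y'. solution_on_period p \<mu> y y' \<and> y 0 = 0 \<and> y 1 = 0)"

text \<open>The integral identity in \<^const>\<open>AC_deriv_on\<close> fixes \<open>y'\<close> only up to null sets, but \<open>y'\<close> is
  itself continuous in \<^const>\<open>solution_on_period\<close>, so its boundary values are meaningful.\<close>

definition neumann_eigenvalue :: "(real \<Rightarrow> real) \<Rightarrow> real \<Rightarrow> bool" where
  "neumann_eigenvalue p \<nu> \<longleftrightarrow> (\<exists>y y'. solution_on_period p \<nu> y y' \<and> y' 0 = 0 \<and> y' 1 = 0)"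

text \<open>The Dirichlet and Neumann eigenvalues corresponding to a bounded gap are those in its
  closure: \<open>\<mu>\<^sub>n, \<nu>\<^sub>n \<in> [\<alpha>\<^sub>n\<^sup>-, \<alpha>\<^sub>n\<^sup>+]\<close>, and these closed intervals are pairwise disjoint.\<close>

definition gap_eigenvalues :: "(real \<Rightarrow> real) \<Rightarrow> real set \<Rightarrow> real \<Rightarrow> real \<Rightarrow> bool" where
  "gap_eigenvalues p \<gamma> \<mu> \<nu> \<longleftrightarrow> \<mu> \<in> closure \<gamma> \<and> dirichlet_eigenvalue p \<mu> \<and>
     \<nu> \<in> closure \<gamma> \<and> neumann_eigenvalue p \<nu>"

end

theory Submission
  imports Defs
begin

text \<open>Write \<open>m11, m12, m21, m22\<close> for the entries of the monodromy matrix of \<open>-y'' + p y = E y\<close> over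
  one period. For even \<open>p\<close> the diagonal entries agree, so \<open>m12 * m21 = m11\<^sup>2 - 1\<close>, which is positive in a
  gap, while Dirichlet and Neumann eigenvalues are the zeros of \<open>m12\<close> and \<open>m21\<close>. Wronskian identities
  show that in \<open>E\<close> the ratio \<open>u = m12 / m11\<close> is strictly increasing and \<open>v = m21 / m11\<close> strictly
  decreasing wherever \<open>m11 \<noteq> 0\<close>, in particular on the closure of a gap. Hence \<open>u\<close> and \<open>v\<close> are positive
  in the gap if \<open>\<mu> < \<nu>\<close> and negative if \<open>\<nu> < \<mu>\<close>; in the unbounded gap they are positive, by an energy
  estimate for \<open>E \<rightarrow> -\<infinity>\<close>.

  A solution is square integrable on a half line iff its initial values span the contracting eigenspace
  of the monodromy matrix. Matching both half lines at 0, using evenness on the left one, shows that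
  \<open>E\<close> is an eigenvalue of the junction iff \<open>u\<^sub>1 u\<^sub>2 < 0\<close> and \<open>v\<^sub>1 u\<^sub>2 = v\<^sub>2 u\<^sub>1\<close>. If \<open>u\<^sub>1 > 0 > u\<^sub>2\<close>, then
  \<open>v\<^sub>1 u\<^sub>2 - v\<^sub>2 u\<^sub>1\<close> is strictly increasing, negative at the left end and positive at the right end.

  About the gaps only one fact is needed: \<open>\<bar>m11\<bar> > 1\<close> outside the spectrum, as otherwise truncations of a
  bounded Bloch solution form a Weyl sequence. The end points of a bounded gap are then \<open>\<mu>\<close> and \<open>\<nu>\<close>.\<close>

section \<open>Locally absolutely continuous functions\<close>

text \<open>The potentials are merely integrable over a period, so y'' exists only almost
  everywhere. Everything is therefore phrased through integrals: a solution is a pair (y, y') of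
  indefinite integrals, and the product rule in this sense carries all Wronskian identities. If y_E
  and y_F solve the equation at energies E and F with the same initial values, their Wronskian at 1
  is (E - F) times the integral of y_E * y_F; dividing by E - F and letting F tend to E gives u' and
  v' as plus or minus the integral of a square over a squared denominator. No solution has to be
  differentiated in E. The matching at 0 compares slopes: a solution decaying to the right has y'/y
  = - sqrt (u2 v2) / u2 at 0, one decaying to the left has y'/y = sqrt (u1 v1) / u1. Equality forces
  opposite signs of u1 and u2 and, after squaring, v1 / u1 = v2 / u2. Dividing by m11 removes the
  sign of the discriminant, which may differ between the two gaps. The function v1 u2 - v2 u1 is
  monotone because each product consists, up to sign, of two positive factors moving in the same
  direction.\<close>

definition ac_deriv :: "real set \<Rightarrow> (real \<Rightarrow> 'a::euclidean_space) \<Rightarrow> (real \<Rightarrow> 'a) \<Rightarrow> bool" where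
  "ac_deriv S f f' \<longleftrightarrow> (\<forall>a\<in>S. \<forall>b\<in>S. a \<le> b \<longrightarrow>
     f' absolutely_integrable_on {a..b} \<and> f b - f a = integral {a..b} f')"

text \<open>The notion is restated for an arbitrary Euclidean codomain: solutions are mostly treated
  as real functions, while complex values enter with the operator, the boundary value problems and
  the Bloch solutions.\<close>

lemma AC_deriv_on_iff: "AC_deriv_on S f f' \<longleftrightarrow> ac_deriv S f f'"
  by (simp add: AC_deriv_on_def ac_deriv_def)

lemma ac_derivI:
  assumes "\<And>a b. a \<in> S \<Longrightarrow> b \<in> S \<Longrightarrow> a \<le> b \<Longrightarrow> f' absolutely_integrable_on {a..b}"
    and "\<And>a b. a \<in> S \<Longrightarrow> b \<in> S \<Longrightarrow> a \<le> b \<Longrightarrow> f b - f a = integral {a..b} f'"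
  shows "ac_deriv S f f'"
  using assms by (simp add: ac_deriv_def)

lemma ac_derivD:
  assumes "ac_deriv S f f'" "a \<in> S" "b \<in> S" "a \<le> b"
  shows "f' absolutely_integrable_on {a..b}" "f' integrable_on {a..b}"
    "integral {a..b} f' = f b - f a" "(f' has_integral (f b - f a)) {a..b}"
proof -
  show 1: "f' absolutely_integrable_on {a..b}" and 2: "integral {a..b} f' = f b - f a"
    using assms by (auto simp: ac_deriv_def)
  show 3: "f' integrable_on {a..b}"
    using 1 by (simp add: absolutely_integrable_on_def)
  show "(f' has_integral (f b - f a)) {a..b}"
    using 2 3 by (simp add: has_integral_iff)
qed

lemma ac_deriv_subset: "ac_deriv S f f' \<Longrightarrow> T \<subseteq> S \<Longrightarrow> ac_deriv T f f'"
  unfolding ac_deriv_def by blast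

lemma is_interval_Icc_subset: "is_interval S \<Longrightarrow> a \<in> S \<Longrightarrow> b \<in> S \<Longrightarrow> {a..b} \<subseteq> (S::real set)"
  by (meson atLeastAtMost_iff mem_is_interval_1_I subsetI)

lemma ac_deriv_continuous_Icc:
  assumes "ac_deriv {a..b} f f'"
  shows "continuous_on {a..b} f"
proof (cases "a \<le> b")
  case True
  have eq: "f x = f a + integral {a..x} f'" if "x \<in> {a..b}" for x
    using ac_derivD(3)[OF assms, of a x] that True by simp
  have "continuous_on {a..b} (\<lambda>x. f a + integral {a..x} f')"
    by (rule continuous_on_add[OF continuous_on_const indefinite_integral_continuous_1])
       (use ac_derivD(2)[OF assms, of a b] True in simp)
  then show ?thesis
    by (rule continuous_on_eq) (rule eq[symmetric])
qed auto

lemma ac_deriv_continuous_UNIV: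
  assumes "ac_deriv UNIV f f'"
  shows "continuous_on A f"
proof -
  have "isCont f x" for x
  proof -
    have "continuous_on {x - 1..x + 1} f"
        by (rule ac_deriv_continuous_Icc[OF ac_deriv_subset[OF assms subset_UNIV]])
    then show ?thesis
      by (rule continuous_on_interior) auto
  qed
  then show ?thesis
    by (simp add: continuous_at_imp_continuous_on)
qed

lemma ac_deriv_cong:
  assumes "ac_deriv S f f'" "is_interval S"
    and "\<And>x. x \<in> S \<Longrightarrow> g x = f x" "\<And>x. x \<in> S \<Longrightarrow> g' x = f' x"
  shows "ac_deriv S g g'"
proof (rule ac_derivI)
  fix a b assume ab: "a \<in> S" "b \<in> S" "a \<le> b"
  have eq: "g' x = f' x" if "x \<in> {a..b}" for x
    using subsetD[OF is_interval_Icc_subset[OF assms(2) ab(1,2)] that] assms(4) by simp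
  show "g' absolutely_integrable_on {a..b}"
    by (rule absolutely_integrable_spike[OF ac_derivD(1)[OF assms(1) ab] negligible_empty]) (simp add: eq)
  have "integral {a..b} g' = integral {a..b} f'"
    using eq by (intro integral_cong) auto
  then show "g b - g a = integral {a..b} g'"
    using ac_derivD(3)[OF assms(1) ab] assms(3) ab by simp
qed

text \<open>The integral identity does not see null sets. This is how data known almost everywhere
  (evenness, the operator equation) enter an ODE statement.\<close>

lemma ac_deriv_AE_cong:
  assumes "ac_deriv S f f'" and N: "negligible N" "\<And>x. x \<in> S - N \<Longrightarrow> g' x = f' x" and S: "is_interval S"
  shows "ac_deriv S f g'"
proof (rule ac_derivI)
  fix a b assume ab: "a \<in> S" "b \<in> S" "a \<le> b"
  have eq: "g' x = f' x" if "x \<in> {a..b} - N" for x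
    using is_interval_Icc_subset[OF S ab(1,2)] that N(2) by auto
  show "g' absolutely_integrable_on {a..b}"
    using ac_derivD(1)[OF assms(1) ab] N(1) eq by (rule absolutely_integrable_spike)
  have "integral {a..b} g' = integral {a..b} f'"
    by (rule integral_spike[OF N(1)]) (use eq in auto)
  then show "f b - f a = integral {a..b} g'"
    using ac_derivD(3)[OF assms(1) ab] by simp
qed

lemma ac_deriv_const: "ac_deriv S (\<lambda>x. c) (\<lambda>x. 0)"
  by (rule ac_derivI) auto

lemma ac_deriv_add:
  assumes "ac_deriv S f f'" "ac_deriv S g g'"
  shows "ac_deriv S (\<lambda>x. f x + g x) (\<lambda>x. f' x + g' x)"
proof (rule ac_derivI)
  fix a b assume "a \<in> S" "b \<in> S" "a \<le> b"
  note f = ac_derivD[OF assms(1) this] and g = ac_derivD[OF assms(2) this]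
  show "(\<lambda>x. f' x + g' x) absolutely_integrable_on {a..b}"
    using f(1) g(1) by (rule set_integral_add)
  show "f b + g b - (f a + g a) = integral {a..b} (\<lambda>x. f' x + g' x)"
    using f(2,3) g(2,3) by (simp add: integral_add)
qed

lemma ac_deriv_linear:
  fixes f :: "real \<Rightarrow> 'a::euclidean_space" and L :: "'a \<Rightarrow> 'b::euclidean_space"
  assumes "ac_deriv S f f'" "bounded_linear L"
  shows "ac_deriv S (\<lambda>x. L (f x)) (\<lambda>x. L (f' x))"
proof (rule ac_derivI)
  fix a b assume "a \<in> S" "b \<in> S" "a \<le> b"
  note f = ac_derivD[OF assms(1) this]
  show "(\<lambda>x. L (f' x)) absolutely_integrable_on {a..b}"
    using absolutely_integrable_linear[OF f(1) assms(2)] by (simp add: o_def)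
  show "L (f b) - L (f a) = integral {a..b} (\<lambda>x. L (f' x))"
    using integral_linear[OF f(2) assms(2)] f(3)
    by (simp add: o_def linear_diff[OF bounded_linear.linear[OF assms(2)]])
qed

lemma ac_deriv_cmult:
  fixes f :: "real \<Rightarrow> 'a::{euclidean_space,real_normed_field}"
  shows "ac_deriv S f f' \<Longrightarrow> ac_deriv S (\<lambda>x. c * f x) (\<lambda>x. c * f' x)"
  by (rule ac_deriv_linear[OF _ bounded_linear_mult_right])

lemma ac_deriv_minus: "ac_deriv S f f' \<Longrightarrow> ac_deriv S (\<lambda>x. - f x) (\<lambda>x. - f' x)"
  by (rule ac_deriv_linear[OF _ bounded_linear_minus[OF bounded_linear_ident]])

lemma ac_deriv_diff:
  assumes "ac_deriv S f f'" "ac_deriv S g g'"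
  shows "ac_deriv S (\<lambda>x. f x - g x) (\<lambda>x. f' x - g' x)"
  using ac_deriv_add[OF assms(1) ac_deriv_minus[OF assms(2)]] by simp

lemma ac_deriv_reflect:
  fixes f f' :: "real \<Rightarrow> 'a::euclidean_space"
  assumes "ac_deriv S f f'"
  shows "ac_deriv (uminus ` S) (\<lambda>x. f (- x)) (\<lambda>x. - f' (- x))"
proof (rule ac_derivI)
  fix a b assume "a \<in> uminus ` S" "b \<in> uminus ` S" and ab: "a \<le> b"
  then have "- b \<in> S" "- a \<in> S" "- b \<le> - a" by auto
  note f = ac_derivD[OF assms this]
  have "(\<lambda>x. f' (- x)) absolutely_integrable_on {a..b}"
    using absolutely_integrable_reflect_real[where f = f' and a = "- b" and b = "- a"] f(1) by simp
  then show "(\<lambda>x. - f' (- x)) absolutely_integrable_on {a..b}"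
    unfolding absolutely_integrable_on_def using integrable_neg by fastforce
  have "((\<lambda>x. f' (- x)) has_integral (f (- a) - f (- b))) {a..b}"
    using has_integral_reflect_lemma_real[OF f(4)] by simp
  then have "integral {a..b} (\<lambda>x. f' (- x)) = f (- a) - f (- b)"
    by (rule integral_unique)
  then show "f (- b) - f (- a) = integral {a..b} (\<lambda>x. - f' (- x))"
    by simp
qed

lemma absolutely_integrable_shift_Icc:
  fixes f :: "real \<Rightarrow> 'a::euclidean_space"
  shows "(\<lambda>x. f (x + c)) absolutely_integrable_on {a - c..b - c} \<longleftrightarrow> f absolutely_integrable_on {a..b}"
  using integrable_shift_real_ivl_iff[where f = f] integrable_shift_real_ivl_iff[where f = "\<lambda>x. norm (f x)"]
  by (simp add: absolutely_integrable_on_def)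

lemma ac_deriv_shift:
  fixes f f' :: "real \<Rightarrow> 'a::euclidean_space"
  assumes "ac_deriv S f f'"
  shows "ac_deriv {x. x + c \<in> S} (\<lambda>x. f (x + c)) (\<lambda>x. f' (x + c))"
proof (rule ac_derivI)
  fix a b assume "a \<in> {x. x + c \<in> S}" "b \<in> {x. x + c \<in> S}" and ab: "a \<le> b"
  then have "a + c \<in> S" "b + c \<in> S" "a + c \<le> b + c" by auto
  note f = ac_derivD[OF assms this]
  show "(\<lambda>x. f' (x + c)) absolutely_integrable_on {a..b}"
    using absolutely_integrable_shift_Icc[where f = f' and c = c and a = "a + c" and b = "b + c"] f(1) by simp
  show "f (b + c) - f (a + c) = integral {a..b} (\<lambda>x. f' (x + c))"
    using integral_shift_real_ivl[where a = "a + c" and b = "b + c" and c = c and f = f'] f(3) by simp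
qed

lemma ac_deriv_glue:
  fixes f f' :: "real \<Rightarrow> 'a::euclidean_space"
  assumes "ac_deriv {..0} f f'" "ac_deriv {0..} f f'"
  shows "ac_deriv UNIV f f'"
proof -
  have *: "f' absolutely_integrable_on {a..b} \<and> f b - f a = integral {a..b} f'" if ab: "a \<le> b" for a b
  proof -
    consider "b \<le> 0" | "a \<ge> 0" | "a \<le> 0" "0 \<le> b" by linarith
    then show ?thesis
    proof cases
      case 1 then show ?thesis
        using ac_derivD(1,3)[OF assms(1), of a b] ab by auto
    next
      case 2 then show ?thesis
        using ac_derivD(1,3)[OF assms(2), of a b] ab by auto
    next
      case 3
      have "a \<in> {..0}" "0 \<in> {..(0::real)}" "0 \<in> {(0::real)..}" "b \<in> {0..}" using 3 by auto
      note l = ac_derivD[OF assms(1) this(1,2) 3(1)] and r = ac_derivD[OF assms(2) this(3,4) 3(2)]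
      have ai: "f' absolutely_integrable_on {a..b}"
        by (rule absolutely_integrable_on_combine[OF l(1) r(1) 3])
      then have "f' integrable_on {a..b}"
        by (simp add: absolutely_integrable_on_def)
      then have "integral {a..0} f' + integral {0..b} f' = integral {a..b} f'"
        by (rule Henstock_Kurzweil_Integration.integral_combine[OF 3])
      with ai show ?thesis unfolding l(3) r(3) by simp
    qed
  qed
  show ?thesis
    by (rule ac_derivI) (use * in auto)
qed

text \<open>A substitute for "zero derivative implies constant" that avoids pointwise derivatives.
  The bound \<open>e * (K y - K x)\<close> adds up over adjacent intervals, so bisection carries the
  local estimate to all of \<open>{a..b}\<close>; then \<open>e\<close> tends to 0.\<close>

lemma eq_of_small_oscillation:
  fixes H :: "real \<Rightarrow> 'a::real_normed_vector" and K :: "real \<Rightarrow> real"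
  assumes ab: "a \<le> b"
    and osc: "\<And>e. e > 0 \<Longrightarrow> \<exists>d>0. \<forall>x y. a \<le> x \<longrightarrow> x \<le> y \<longrightarrow> y \<le> b \<longrightarrow> y - x < d \<longrightarrow>
                norm (H y - H x) \<le> e * (K y - K x)"
  shows "H a = H b"
proof -
  have le: "norm (H b - H a) \<le> e * (K b - K a)" if e: "e > 0" for e
  proof -
    obtain d where d: "d > 0" "\<And>x y. a \<le> x \<Longrightarrow> x \<le> y \<Longrightarrow> y \<le> b \<Longrightarrow> y - x < d \<Longrightarrow>
                norm (H y - H x) \<le> e * (K y - K x)"
      using osc[OF e] by blast
    have "a \<le> a \<longrightarrow> b \<le> b \<longrightarrow> norm (H b - H a) \<le> e * (K b - K a)"
      using ab
    proof (induction rule: Bolzano[where P = "\<lambda>x y. a \<le> x \<longrightarrow> y \<le> b \<longrightarrow> norm (H y - H x) \<le> e * (K y - K x)"])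
      case (trans x y z)
      show ?case
      proof (intro impI)
        assume "a \<le> x" "z \<le> b"
        then have 1: "norm (H y - H x) \<le> e * (K y - K x)" "norm (H z - H y) \<le> e * (K z - K y)"
          using trans by auto
        have "norm (H z - H x) \<le> norm (H z - H y) + norm (H y - H x)"
          using norm_triangle_ineq[of "H z - H y" "H y - H x"] by simp
        also have "\<dots> \<le> e * (K z - K x)"
          using 1 by (simp add: algebra_simps)
        finally show "norm (H z - H x) \<le> e * (K z - K x)" .
      qed
    next
      case (local x)
      then show ?case using d by (intro exI[of _ d]) auto
    qed
    then show ?thesis by simp
  qed
  have "norm (H b - H a) \<le> 0"
  proof (rule field_le_epsilon)
    fix e :: real assume e: "e > 0"
    \<comment> \<open>The summand 1 keeps the divisor positive, and the absolute value covers every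
      sign of the increment of \<open>K\<close>.\<close>
    define k where "k = \<bar>K b - K a\<bar> + 1"
    have k: "k > 0" "K b - K a \<le> k" by (auto simp: k_def)
    have "norm (H b - H a) \<le> (e / k) * (K b - K a)"
      using le[of "e / k"] e k by simp
    also have "\<dots> \<le> (e / k) * k"
      using e k by (intro mult_left_mono) auto
    finally show "norm (H b - H a) \<le> 0 + e" using k by simp
  qed
  then show ?thesis by simp
qed

lemma absolutely_integrable_mult_continuous:
  fixes f g :: "real \<Rightarrow> 'a::{euclidean_space,real_normed_field}"
  assumes "f absolutely_integrable_on {a..b}" "continuous_on {a..b} g"
  shows "(\<lambda>x. g x * f x) absolutely_integrable_on {a..b}" "(\<lambda>x. f x * g x) absolutely_integrable_on {a..b}"
proof -
  show "(\<lambda>x. g x * f x) absolutely_integrable_on {a..b}"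
    using assms
    by (intro absolutely_integrable_bounded_measurable_product[OF bilinear_times])
       (auto intro!: compact_imp_bounded compact_continuous_image continuous_imp_measurable_on_sets_lebesgue)
  then show "(\<lambda>x. f x * g x) absolutely_integrable_on {a..b}"
    by (simp add: mult.commute)
qed

text \<open>On a short interval freeze \<open>g\<close> at the right end and \<open>f\<close> at the
  left end. The integral of f' * g y + f x * g' is then exactly the increment of f * g, and by
  uniform continuity the error is at most e times the integral of |f'| + |g'|, which is the setting
  of \<open>eq_of_small_oscillation\<close>.\<close>

lemma ac_deriv_mult:
  fixes f g :: "real \<Rightarrow> 'a::{euclidean_space,real_normed_field}"
  assumes f: "ac_deriv S f f'" and g: "ac_deriv S g g'" and S: "is_interval S"
  shows "ac_deriv S (\<lambda>x. f x * g x) (\<lambda>x. f' x * g x + f x * g' x)"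
proof (rule ac_derivI)
  fix a b assume ab: "a \<in> S" "b \<in> S" "a \<le> b"
  have sub: "{a..b} \<subseteq> S" using is_interval_Icc_subset[OF S] ab by blast
  note f = ac_deriv_subset[OF f sub] and g = ac_deriv_subset[OF g sub]
  have cf: "continuous_on {a..b} f" and cg: "continuous_on {a..b} g"
    using f g by (auto intro: ac_deriv_continuous_Icc)
  have fi: "f' absolutely_integrable_on {a..b}" and gi: "g' absolutely_integrable_on {a..b}"
    using ac_derivD(1)[OF f, of a b] ac_derivD(1)[OF g, of a b] ab(3) by auto
  have nfi: "(\<lambda>x. norm (f' x)) integrable_on {a..b}" "(\<lambda>x. norm (g' x)) integrable_on {a..b}"
    using fi gi by (auto simp: absolutely_integrable_on_def)
  define r where "r = (\<lambda>x. f' x * g x + f x * g' x)"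
  show ri: "(\<lambda>x. f' x * g x + f x * g' x) absolutely_integrable_on {a..b}"
    using absolutely_integrable_mult_continuous[OF fi cg] absolutely_integrable_mult_continuous[OF gi cf]
    by (intro set_integral_add)
  then have ri': "r integrable_on {a..b}"
    by (simp add: absolutely_integrable_on_def r_def)
  define k where "k = (\<lambda>x. norm (f' x) + norm (g' x))"
  have ki: "k integrable_on {a..b}" unfolding k_def using nfi by (rule integrable_add)
  define H where "H = (\<lambda>x. f x * g x - integral {a..x} r)"
  define K where "K = (\<lambda>x. integral {a..x} k)"
  have "H a = H b"
  proof (rule eq_of_small_oscillation[OF ab(3), where K = K])
    fix e :: real assume e: "e > 0"
    have "uniformly_continuous_on {a..b} f" "uniformly_continuous_on {a..b} g"
      using cf cg by (auto intro: compact_uniformly_continuous)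
    then obtain d1 d2 where d1: "d1 > 0" "\<And>x y. x \<in> {a..b} \<Longrightarrow> y \<in> {a..b} \<Longrightarrow> dist y x < d1 \<Longrightarrow> dist (f y) (f x) < e"
      and d2: "d2 > 0" "\<And>x y. x \<in> {a..b} \<Longrightarrow> y \<in> {a..b} \<Longrightarrow> dist y x < d2 \<Longrightarrow> dist (g y) (g x) < e"
      using e unfolding uniformly_continuous_on_def by metis
    have "norm (H y - H x) \<le> e * (K y - K x)" if xy: "a \<le> x" "x \<le> y" "y \<le> b" "y - x < min d1 d2" for x y
    proof -
      have sub: "{x..y} \<subseteq> {a..b}" using xy by auto
      note int = integrable_on_subinterval[OF _ sub]
      have fd: "f' integrable_on {x..y}" "integral {x..y} f' = f y - f x"
        and gd: "g' integrable_on {x..y}" "integral {x..y} g' = g y - g x"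
        using ac_derivD(2,3)[OF f, of x y] ac_derivD(2,3)[OF g, of x y] xy by auto
      have rI: "integral {a..y} r = integral {a..x} r + integral {x..y} r"
        using xy integrable_on_subinterval[OF ri', of a y]
        by (subst Henstock_Kurzweil_Integration.integral_combine) auto
      have kI: "integral {a..y} k = integral {a..x} k + integral {x..y} k"
        using xy integrable_on_subinterval[OF ki, of a y]
        by (subst Henstock_Kurzweil_Integration.integral_combine) auto
      have "((\<lambda>s. f' s * g y + f x * g' s - r s) has_integral
              ((f y - f x) * g y + f x * (g y - g x) - integral {x..y} r)) {x..y}"
        using fd gd int[OF ri']
        by (intro has_integral_diff has_integral_add has_integral_mult_left has_integral_mult_right)
           (auto simp: has_integral_iff)
      also have "(f y - f x) * g y + f x * (g y - g x) - integral {x..y} r = H y - H x"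
        using rI by (simp add: H_def algebra_simps)
      finally have hi: "((\<lambda>s. f' s * g y + f x * g' s - r s) has_integral (H y - H x)) {x..y}" .
      have "norm (integral {x..y} (\<lambda>s. f' s * g y + f x * g' s - r s)) \<le> integral {x..y} (\<lambda>s. e * k s)"
      proof (rule integral_norm_bound_integral)
        show "(\<lambda>s. f' s * g y + f x * g' s - r s) integrable_on {x..y}" using hi by blast
        show "(\<lambda>s. e * k s) integrable_on {x..y}" using int[OF ki] by (intro integrable_on_mult_right)
        fix s assume s: "s \<in> {x..y}"
        have "norm (f' s * g y + f x * g' s - r s) = norm (f' s * (g y - g s) + (f x - f s) * g' s)"
          by (simp add: r_def algebra_simps)
        also have "\<dots> \<le> norm (f' s) * norm (g y - g s) + norm (f x - f s) * norm (g' s)"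
          by (metis norm_mult norm_triangle_ineq)
        also have "\<dots> \<le> norm (f' s) * e + e * norm (g' s)"
        proof (intro add_mono mult_left_mono mult_right_mono)
          show "norm (g y - g s) \<le> e"
            using d2(2)[of s y] s xy by (simp add: dist_norm dist_real_def)
          show "norm (f x - f s) \<le> e"
            using d1(2)[of s x] s xy by (simp add: dist_norm dist_real_def)
        qed auto
        finally show "norm (f' s * g y + f x * g' s - r s) \<le> e * k s"
          by (simp add: k_def algebra_simps)
      qed
      then show ?thesis
        using hi kI by (simp add: integral_unique K_def)
    qed
    then show "\<exists>d>0. \<forall>x y. a \<le> x \<longrightarrow> x \<le> y \<longrightarrow> y \<le> b \<longrightarrow> y - x < d \<longrightarrow> norm (H y - H x) \<le> e * (K y - K x)"
      using d1(1) d2(1) by (intro exI[of _ "min d1 d2"]) auto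
  qed
  then show "f b * g b - f a * g a = integral {a..b} (\<lambda>x. f' x * g x + f x * g' x)"
    by (simp add: H_def r_def)
qed

text \<open>For n = 0 the truncated exponent n - 1 does no harm, as the factor
  \<open>of_nat n\<close> vanishes.\<close>

lemma ac_deriv_power:
  fixes f :: "real \<Rightarrow> 'a::{euclidean_space,real_normed_field}"
  assumes f: "ac_deriv S f f'" and S: "is_interval S"
  shows "ac_deriv S (\<lambda>x. f x ^ n) (\<lambda>x. of_nat n * f x ^ (n - 1) * f' x)"
proof (induction n)
  case 0
  then show ?case using ac_deriv_const[of S 1] by simp
next
  case (Suc n)
  show ?case
  proof (rule ac_deriv_cong[OF ac_deriv_mult[OF f Suc S] S])
    show "of_nat (Suc n) * f x ^ (Suc n - 1) * f' x = f' x * f x ^ n + f x * (of_nat n * f x ^ (n - 1) * f' x)" for x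
      by (cases n) (auto simp: algebra_simps)
  qed auto
qed

lemma ac_deriv_zero_imp_const:
  assumes "ac_deriv S f f'" "is_interval S" "\<And>x. x \<in> S \<Longrightarrow> f' x = 0" "x \<in> S" "y \<in> S"
  shows "f x = f y"
proof -
  have "f a = f b" if "a \<in> S" "b \<in> S" "a \<le> b" for a b
  proof -
    have "integral {a..b} f' = integral {a..b} (\<lambda>x. 0)"
      using is_interval_Icc_subset[OF assms(2) that(1,2)] assms(3) by (intro integral_cong) auto
    then show ?thesis using ac_derivD(3)[OF assms(1) that] by simp
  qed
  then show ?thesis using assms(4,5) by (metis linear)
qed

section \<open>The initial value problem for a locally integrable potential\<close>

definition locally_integrable :: "(real \<Rightarrow> real) \<Rightarrow> bool" where
  "locally_integrable h \<longleftrightarrow> (\<forall>a b. h absolutely_integrable_on {a..b})"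

text \<open>The equation y'' = h y as a first order system, later with h = p - E. Carrying
  \<open>z\<close> explicitly fixes the continuous version of y', so that slopes at single points
  make sense.\<close>

definition ode_sol :: "(real \<Rightarrow> real) \<Rightarrow> real set \<Rightarrow> (real \<Rightarrow> real) \<Rightarrow> (real \<Rightarrow> real) \<Rightarrow> bool" where
  "ode_sol h S y z \<longleftrightarrow> ac_deriv S y z \<and> ac_deriv S z (\<lambda>x. h x * y x)"

lemma ac_deriv_indefinite_integral:
  fixes f g :: "real \<Rightarrow> 'a::euclidean_space"
  assumes g: "\<And>x. x \<ge> 0 \<Longrightarrow> g absolutely_integrable_on {0..x}"
    and f: "\<And>x. x \<ge> 0 \<Longrightarrow> f x = c + integral {0..x} g"
  shows "ac_deriv {0..} f g"
proof (rule ac_derivI)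
  fix a b :: real assume ab: "a \<in> {0..}" "b \<in> {0..}" "a \<le> b"
  have sub: "{a..b} \<subseteq> {0..b}" using ab by auto
  show "g absolutely_integrable_on {a..b}"
    by (rule absolutely_integrable_on_subinterval[OF g sub]) (use ab in auto)
  have "g integrable_on {0..b}" using g[of b] ab by (simp add: absolutely_integrable_on_def)
  then have "integral {0..a} g + integral {a..b} g = integral {0..b} g"
    using ab by (intro Henstock_Kurzweil_Integration.integral_combine) auto
  then show "f b - f a = integral {a..b} g"
    using f[of a] f[of b] ab by (simp add: algebra_simps)
qed

text \<open>These are the terms of the Picard series, not its partial sums: each is the integral
  operator applied to the previous one, and the solution is their sum.\<close>

primrec picard :: "(real \<Rightarrow> real) \<Rightarrow> real \<Rightarrow> real \<Rightarrow> nat \<Rightarrow> (real \<Rightarrow> real) \<times> (real \<Rightarrow> real)" where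
  "picard h a b 0 = ((\<lambda>x. a), (\<lambda>x. b))"
| "picard h a b (Suc n) =
     ((\<lambda>x. integral {0..x} (snd (picard h a b n))),
      (\<lambda>x. integral {0..x} (\<lambda>s. h s * fst (picard h a b n) s)))"

text \<open>With \<open>K\<close> the antiderivative of 1 + |h|, the n-th Picard term is bounded by
  C * K^n / n!, because integrating K^n * K' raises the power and the factorial together. The series
  is dominated by C * exp K, and dominated convergence carries the integral equations over to the
  sum.\<close>

lemma half_line_solution_exists:
  assumes h: "locally_integrable h"
  shows "\<exists>y z. ode_sol h {0..} y z \<and> y 0 = a \<and> z 0 = b"
proof -
  define Y where "Y n = fst (picard h a b n)" for n
  define Z where "Z n = snd (picard h a b n)" for n
  have Y0: "Y 0 = (\<lambda>x. a)" and Z0: "Z 0 = (\<lambda>x. b)"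
    and YS: "Y (Suc n) = (\<lambda>x. integral {0..x} (Z n))"
    and ZS: "Z (Suc n) = (\<lambda>x. integral {0..x} (\<lambda>s. h s * Y n s))" for n
    by (simp_all add: Y_def Z_def)
  have hi: "h absolutely_integrable_on {c..d}" for c d
    using h by (simp add: locally_integrable_def)
  \<comment> \<open>One weight for both equations of the system: it dominates the coefficient 1 in
    y' = z and the coefficient \<open>h\<close> in z' = h y.\<close>
  define k where "k = (\<lambda>x. 1 + \<bar>h x\<bar>)"
  have ki: "k absolutely_integrable_on {c..d}" for c d
    unfolding k_def using absolutely_integrable_norm[OF hi]
    by (intro set_integral_add) (auto simp: o_def)
  have ki': "k integrable_on {c..d}" for c d
    using ki by (simp add: absolutely_integrable_on_def)
  have k0: "k x \<ge> 0" "k x \<ge> 1" "\<bar>h x\<bar> \<le> k x" for x by (auto simp: k_def)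
  define K where "K = (\<lambda>x. integral {0..x} k)"
  have K: "ac_deriv {0..} K k"
    by (rule ac_deriv_indefinite_integral[where c = 0]) (auto simp: K_def ki)
  have K0: "K x \<ge> 0" for x
    unfolding K_def by (rule integral_nonneg[OF ki']) (use k0 in auto)
  have Kmono: "K s \<le> K x" if "s \<le> x" for s x
    unfolding K_def using that by (intro integral_subset_le ki') (auto simp: k0)
  define C where "C = \<bar>a\<bar> + \<bar>b\<bar>"
  have Kpow: "((\<lambda>s. K s ^ n * k s) has_integral K x ^ Suc n / Suc n) {0..x}" if "x \<ge> 0" for n x
  proof -
    have "((\<lambda>x. real (Suc n) * K x ^ (Suc n - 1) * k x) has_integral (K x ^ Suc n - K 0 ^ Suc n)) {0..x}"
      by (rule ac_derivD(4)[OF ac_deriv_power[OF K]]) (use that in \<open>auto simp: is_interval_ci\<close>)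
    then have "((\<lambda>x. real (Suc n) * (K x ^ n * k x)) has_integral K x ^ Suc n) {0..x}"
      by (simp add: K_def mult.assoc)
    from has_integral_divide[OF this, of "real (Suc n)"] show ?thesis
      by (simp del: of_nat_Suc)
  qed
  have main: "continuous_on {0..R} (Y n) \<and> continuous_on {0..R} (Z n) \<and>
      (\<forall>x\<in>{0..R}. \<bar>Y n x\<bar> + \<bar>Z n x\<bar> \<le> C * (K x ^ n / fact n))" for n R
  proof (induction n)
    case 0
    then show ?case by (auto simp: Y0 Z0 C_def)
  next
    case (Suc n)
    have hY: "(\<lambda>s. h s * Y n s) absolutely_integrable_on {0..R}"
      using absolutely_integrable_mult_continuous(2)[OF hi] Suc by blast
    then have hY': "(\<lambda>s. h s * Y n s) integrable_on {0..R}"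
      by (simp add: absolutely_integrable_on_def)
    have Zi: "Z n integrable_on {0..R}" using Suc integrable_continuous_real by blast
    have Za: "Z n absolutely_integrable_on {0..R}"
      using Suc absolutely_integrable_continuous_real by blast
    have cont: "continuous_on {0..R} (Y (Suc n))" "continuous_on {0..R} (Z (Suc n))"
      unfolding YS ZS by (rule indefinite_integral_continuous_1[OF Zi], rule indefinite_integral_continuous_1[OF hY'])
    have "\<bar>Y (Suc n) x\<bar> + \<bar>Z (Suc n) x\<bar> \<le> C * (K x ^ Suc n / fact (Suc n))" if x: "x \<in> {0..R}" for x
    proof -
      have sub: "{0..x} \<subseteq> {0..R}" using x by auto
      have ai: "(\<lambda>s. \<bar>Z n s\<bar>) integrable_on {0..x}" "(\<lambda>s. \<bar>h s * Y n s\<bar>) integrable_on {0..x}"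
        using absolutely_integrable_on_subinterval[OF hY sub] absolutely_integrable_on_subinterval[OF Za sub]
        by (auto simp: absolutely_integrable_on_def)
      have "\<bar>Y (Suc n) x\<bar> \<le> integral {0..x} (\<lambda>s. \<bar>Z n s\<bar>)"
        unfolding YS using integral_norm_bound_integral[OF integrable_on_subinterval[OF Zi sub] ai(1)] by simp
      moreover have "\<bar>Z (Suc n) x\<bar> \<le> integral {0..x} (\<lambda>s. \<bar>h s * Y n s\<bar>)"
        unfolding ZS using integral_norm_bound_integral[OF integrable_on_subinterval[OF hY' sub] ai(2)] by simp
      ultimately have "\<bar>Y (Suc n) x\<bar> + \<bar>Z (Suc n) x\<bar> \<le> integral {0..x} (\<lambda>s. \<bar>Z n s\<bar> + \<bar>h s * Y n s\<bar>)"
        using ai by (simp add: integral_add)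
      also have "\<dots> \<le> integral {0..x} (\<lambda>s. C / fact n * (K s ^ n * k s))"
      proof (rule integral_le)
        show "(\<lambda>s. \<bar>Z n s\<bar> + \<bar>h s * Y n s\<bar>) integrable_on {0..x}" using ai by (rule integrable_add)
        show "(\<lambda>s. C / fact n * (K s ^ n * k s)) integrable_on {0..x}"
          using Kpow[of x n] x by (intro integrable_on_mult_right) (auto simp: has_integral_iff)
        fix s assume s: "s \<in> {0..x}"
        have "\<bar>Z n s\<bar> + \<bar>h s * Y n s\<bar> \<le> k s * \<bar>Z n s\<bar> + k s * \<bar>Y n s\<bar>"
          using k0[of s] mult_right_mono[of 1 "k s" "\<bar>Z n s\<bar>"] mult_right_mono[of "\<bar>h s\<bar>" "k s" "\<bar>Y n s\<bar>"]
          by (simp add: abs_mult)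
        also have "\<dots> = k s * (\<bar>Y n s\<bar> + \<bar>Z n s\<bar>)" by (simp add: algebra_simps)
        also have "\<dots> \<le> k s * (C * (K s ^ n / fact n))"
          using Suc s x k0[of s] by (intro mult_left_mono) auto
        finally show "\<bar>Z n s\<bar> + \<bar>h s * Y n s\<bar> \<le> C / fact n * (K s ^ n * k s)"
          by (simp add: algebra_simps)
      qed
      also have "\<dots> = C / fact n * (K x ^ Suc n / Suc n)"
        using Kpow[of x n] x has_integral_mult_right[OF Kpow, of x "C / fact n" n]
        by (intro integral_unique) auto
      also have "\<dots> = C * (K x ^ Suc n / fact (Suc n))" by (simp add: divide_simps)
      finally show ?thesis .
    qed
    then show ?case using cont by blast
  qed
  have contY: "continuous_on {0..R} (Y n)" and contZ: "continuous_on {0..R} (Z n)" for n R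
    using main by blast+
  have YZ: "\<bar>Y n x\<bar> \<le> C * (K x ^ n / fact n)" "\<bar>Z n x\<bar> \<le> C * (K x ^ n / fact n)" if "x \<ge> 0" for n x
  proof -
    have "\<bar>Y n x\<bar> + \<bar>Z n x\<bar> \<le> C * (K x ^ n / fact n)" using main[of x n] that by simp
    then show "\<bar>Y n x\<bar> \<le> C * (K x ^ n / fact n)" "\<bar>Z n x\<bar> \<le> C * (K x ^ n / fact n)" by linarith+
  qed
  have Ksums: "(\<lambda>n. C * (K x ^ n / fact n)) sums (C * exp (K x))" for x
    using exp_converges[of "K x"] by (intro sums_mult) (simp add: divide_inverse mult.commute)
  define y where "y = (\<lambda>x. \<Sum>n. Y n x)"
  define z where "z = (\<lambda>x. \<Sum>n. Z n x)"
  have sumY: "summable (\<lambda>n. \<bar>Y n x\<bar>)" and sumZ: "summable (\<lambda>n. \<bar>Z n x\<bar>)" if "x \<ge> 0" for x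
    using YZ[OF that] by (auto intro!: summable_comparison_test'[OF sums_summable[OF Ksums[of x]], of 0])
  have limY: "(\<lambda>N. \<Sum>n<N. Y n x) \<longlonglongrightarrow> y x" and limZ: "(\<lambda>N. \<Sum>n<N. Z n x) \<longlonglongrightarrow> z x" if "x \<ge> 0" for x
    unfolding y_def z_def using sumY[OF that] sumZ[OF that]
    by (auto intro!: summable_LIMSEQ summable_rabs_cancel)
  have bound: "\<bar>\<Sum>n<N. f n\<bar> \<le> C * exp (K R)"
    if "\<And>n. \<bar>f n\<bar> \<le> C * (K x ^ n / fact n)" "x \<le> R" for f N x R
  proof -
    have "\<bar>\<Sum>n<N. f n\<bar> \<le> (\<Sum>n<N. C * (K x ^ n / fact n))"
      using that by (intro order_trans[OF sum_abs] sum_mono) auto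
    also have "\<dots> \<le> C * exp (K x)"
      using sum_le_suminf[OF sums_summable[OF Ksums[of x]], of "{..<N}"] sums_unique[OF Ksums[of x]] K0[of x]
      by (auto simp: C_def)
    also have "\<dots> \<le> C * exp (K R)"
      using Kmono[OF that(2)] by (intro mult_left_mono) (auto simp: C_def)
    finally show ?thesis .
  qed
  have intZ: "z absolutely_integrable_on {0..x}" "y x = a + integral {0..x} z" if x: "x \<ge> 0" for x
  proof -
    define f where "f = (\<lambda>N s. \<Sum>n<N. Z n s)"
    have fi: "f N integrable_on {0..x}" for N
      unfolding f_def by (intro integrable_sum) (auto intro: integrable_continuous_real contZ)
    have fb: "norm (f N s) \<le> C * exp (K x)" if "s \<in> {0..x}" for N s
      using bound[of "\<lambda>n. Z n s" s x N] YZ(2)[of s] that by (simp add: f_def)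
    have lim: "(\<lambda>N. f N s) \<longlonglongrightarrow> z s" if "s \<in> {0..x}" for s
      using limZ[of s] that by (simp add: f_def)
    note dc = dominated_convergence[OF fi integrable_const_ivl fb lim]
    have zb: "norm (z s) \<le> C * exp (K x)" if "s \<in> {0..x}" for s
      by (rule LIMSEQ_le_const2[OF tendsto_norm[OF lim[OF that]]]) (use fb that in auto)
    show "z absolutely_integrable_on {0..x}"
      by (rule absolutely_integrable_integrable_bound[OF zb dc(1) integrable_const_ivl])
    \<comment> \<open>Integrating the first N terms of \<open>Z\<close> gives the terms 1 to N of
      \<open>Y\<close>, that is, N + 1 terms minus \<open>Y 0 = a\<close>; in the limit this shift
      becomes the integral equation.\<close>
    have "integral {0..x} (f N) = (\<Sum>n<N. Y (Suc n) x)" for N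
      unfolding f_def YS by (intro integral_sum) (auto intro: integrable_continuous_real contZ)
    also have "(\<Sum>n<N. Y (Suc n) x) = (\<Sum>n<Suc N. Y n x) - a" for N
      by (subst sum.lessThan_Suc_shift) (simp add: Y0)
    finally have eq: "integral {0..x} (f N) = (\<Sum>n<Suc N. Y n x) - a" for N .
    have "(\<lambda>N. (\<Sum>n<Suc N. Y n x) - a) \<longlonglongrightarrow> y x - a"
      using limY[OF x, THEN LIMSEQ_Suc] by (intro tendsto_intros)
    with dc(2) have "integral {0..x} z = y x - a"
      unfolding eq by (rule LIMSEQ_unique)
    then show "y x = a + integral {0..x} z" by simp
  qed
  have intY: "(\<lambda>s. h s * y s) absolutely_integrable_on {0..x}" "z x = b + integral {0..x} (\<lambda>s. h s * y s)"
    if x: "x \<ge> 0" for x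
  proof -
    define f where "f = (\<lambda>N s. h s * (\<Sum>n<N. Y n s))"
    have hYi: "(\<lambda>s. h s * Y n s) integrable_on {0..x}" for n
      using absolutely_integrable_mult_continuous(2)[OF hi contY] by (simp add: absolutely_integrable_on_def)
    have fi: "f N integrable_on {0..x}" for N
      unfolding f_def sum_distrib_left by (intro integrable_sum) (auto intro: hYi)
    \<comment> \<open>As \<open>h\<close> may be unbounded, the majorant is now the integrable
      weight times the bound on the partial sums, where a constant served before.\<close>
    have bi: "(\<lambda>s. k s * (C * exp (K x))) integrable_on {0..x}"
      using ki' by (rule integrable_on_mult_left)
    have fb: "norm (f N s) \<le> k s * (C * exp (K x))" if "s \<in> {0..x}" for N s
      using bound[of "\<lambda>n. Y n s" s x N] YZ(1)[of s] that k0[of s] unfolding f_def real_norm_def abs_mult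
      by (intro mult_mono) auto
    have lim: "(\<lambda>N. f N s) \<longlonglongrightarrow> h s * y s" if "s \<in> {0..x}" for s
      using limY[of s] that unfolding f_def by (intro tendsto_intros) auto
    note dc = dominated_convergence[OF fi bi fb lim]
    have zb: "norm (h s * y s) \<le> k s * (C * exp (K x))" if "s \<in> {0..x}" for s
      by (rule LIMSEQ_le_const2[OF tendsto_norm[OF lim[OF that]]]) (use fb that in auto)
    show "(\<lambda>s. h s * y s) absolutely_integrable_on {0..x}"
      by (rule absolutely_integrable_integrable_bound[OF zb dc(1) bi])
    have "integral {0..x} (f N) = (\<Sum>n<N. Z (Suc n) x)" for N
      unfolding f_def ZS sum_distrib_left by (intro integral_sum) (auto intro: hYi)
    also have "(\<Sum>n<N. Z (Suc n) x) = (\<Sum>n<Suc N. Z n x) - b" for N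
      by (subst sum.lessThan_Suc_shift) (simp add: Z0)
    finally have eq: "integral {0..x} (f N) = (\<Sum>n<Suc N. Z n x) - b" for N .
    have "(\<lambda>N. (\<Sum>n<Suc N. Z n x) - b) \<longlonglongrightarrow> z x - b"
      using limZ[OF x, THEN LIMSEQ_Suc] by (intro tendsto_intros)
    with dc(2) have "integral {0..x} (\<lambda>s. h s * y s) = z x - b"
      unfolding eq by (rule LIMSEQ_unique)
    then show "z x = b + integral {0..x} (\<lambda>s. h s * y s)" by simp
  qed
  have "ode_sol h {0..} y z"
    unfolding ode_sol_def using intZ intY by (auto intro: ac_deriv_indefinite_integral)
  moreover have "y 0 = a" "z 0 = b"
    using intZ(2)[of 0] intY(2)[of 0] by auto
  ultimately show ?thesis by blast
qed

section \<open>Symmetries of the equation and solutions on the whole line\<close>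

lemma ode_sol_subset: "ode_sol h S y z \<Longrightarrow> T \<subseteq> S \<Longrightarrow> ode_sol h T y z"
  unfolding ode_sol_def using ac_deriv_subset[of S _ _ T] by metis

lemma ode_sol_cong:
  assumes "ode_sol h S y z" "is_interval S"
    and "\<And>x. x \<in> S \<Longrightarrow> Y x = y x" "\<And>x. x \<in> S \<Longrightarrow> Z x = z x" "\<And>x. x \<in> S \<Longrightarrow> k x = h x"
  shows "ode_sol k S Y Z"
proof -
  have "ac_deriv S Y Z"
    by (rule ac_deriv_cong[OF _ assms(2-4)]) (use assms(1) in \<open>simp add: ode_sol_def\<close>)
  moreover have "ac_deriv S Z (\<lambda>x. k x * Y x)"
    by (rule ac_deriv_cong[OF _ assms(2,4), of _ "\<lambda>x. h x * y x"])
       (use assms in \<open>simp_all add: ode_sol_def\<close>)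
  ultimately show ?thesis by (simp add: ode_sol_def)
qed

lemma ode_sol_AE_cong:
  assumes "ode_sol h S y z" "is_interval S" "negligible N" "\<And>x. x \<in> S - N \<Longrightarrow> k x = h x"
  shows "ode_sol k S y z"
proof -
  have "ac_deriv S z (\<lambda>x. k x * y x)"
    by (rule ac_deriv_AE_cong[OF _ assms(3) _ assms(2), of _ "\<lambda>x. h x * y x"])
       (use assms in \<open>simp_all add: ode_sol_def\<close>)
  then show ?thesis using assms(1) by (simp add: ode_sol_def)
qed

lemma ode_sol_reflect:
  assumes "ode_sol h S y z"
  shows "ode_sol (\<lambda>x. h (- x)) (uminus ` S) (\<lambda>x. y (- x)) (\<lambda>x. - z (- x))"
  using assms ac_deriv_reflect[of S y z] ac_deriv_minus[OF ac_deriv_reflect[of S z "\<lambda>x. h x * y x"]]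
  unfolding ode_sol_def by simp

lemma ode_sol_shift:
  assumes "ode_sol h S y z"
  shows "ode_sol (\<lambda>x. h (x + c)) {x. x + c \<in> S} (\<lambda>x. y (x + c)) (\<lambda>x. z (x + c))"
  using assms ac_deriv_shift[of S y z c] ac_deriv_shift[of S z "\<lambda>x. h x * y x" c]
  unfolding ode_sol_def by simp

lemma ode_sol_lincomb:
  assumes "ode_sol h S y1 z1" "ode_sol h S y2 z2"
  shows "ode_sol h S (\<lambda>x. a * y1 x + b * y2 x) (\<lambda>x. a * z1 x + b * z2 x)"
proof -
  have "ac_deriv S (\<lambda>x. a * z1 x + b * z2 x) (\<lambda>x. a * (h x * y1 x) + b * (h x * y2 x))"
    using assms unfolding ode_sol_def by (intro ac_deriv_add ac_deriv_cmult) auto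
  then have "ac_deriv S (\<lambda>x. a * z1 x + b * z2 x) (\<lambda>x. h x * (a * y1 x + b * y2 x))"
    by (simp add: algebra_simps)
  then show ?thesis
    using assms unfolding ode_sol_def by (simp add: ac_deriv_add ac_deriv_cmult)
qed

lemma ode_sol_glue: "ode_sol h {..0} y z \<Longrightarrow> ode_sol h {0..} y z \<Longrightarrow> ode_sol h UNIV y z"
  unfolding ode_sol_def by (simp add: ac_deriv_glue)

lemma uminus_image_atLeast_0: "uminus ` {0..} = {..(0::real)}" "uminus ` {..0} = {(0::real)..}"
  by auto

lemma locally_integrable_reflect: "locally_integrable h \<Longrightarrow> locally_integrable (\<lambda>x. h (- x))"
  unfolding locally_integrable_def by (metis absolutely_integrable_reflect_real minus_minus)

lemma solution_exists:
  assumes h: "locally_integrable h"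
  shows "\<exists>y z. ode_sol h UNIV y z \<and> y 0 = a \<and> z 0 = b"
proof -
  obtain y1 z1 where 1: "ode_sol h {0..} y1 z1" "y1 0 = a" "z1 0 = b"
    using half_line_solution_exists[OF h] by blast
  \<comment> \<open>Reflection changes the sign of the slope, so the left half starts with
    \<open>- b\<close>.\<close>
  obtain y2 z2 where 2: "ode_sol (\<lambda>x. h (- x)) {0..} y2 z2" "y2 0 = a" "z2 0 = - b"
    using half_line_solution_exists[OF locally_integrable_reflect[OF h]] by blast
  have 3: "ode_sol h {..0} (\<lambda>x. y2 (- x)) (\<lambda>x. - z2 (- x))"
    using ode_sol_reflect[OF 2(1)] by (simp add: uminus_image_atLeast_0)
  define y where "y = (\<lambda>x. if x \<ge> 0 then y1 x else y2 (- x))"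
  define z where "z = (\<lambda>x. if x \<ge> 0 then z1 x else - z2 (- x))"
  have "ode_sol h {..0} y z"
    by (rule ode_sol_cong[OF 3]) (use 1 2 in \<open>auto simp: y_def z_def is_interval_ic\<close>)
  moreover have "ode_sol h {0..} y z"
    by (rule ode_sol_cong[OF 1(1)]) (auto simp: y_def z_def is_interval_ci)
  ultimately have "ode_sol h UNIV y z" by (rule ode_sol_glue)
  moreover have "y 0 = a" "z 0 = b" using 1 by (simp_all add: y_def z_def)
  ultimately show ?thesis by blast
qed

section \<open>Wronskians and dependence on the energy\<close>

text \<open>The terms z1 * z2 cancel even for different coefficients. Equal coefficients give
  constancy of the Wronskian; h1 = p - E and h2 = p - F give the factor E - F from which all
  dependence on the energy is derived.\<close>

lemma wronskian_deriv:
  assumes 1: "ode_sol h1 S y1 z1" and 2: "ode_sol h2 S y2 z2" and S: "is_interval S"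
  shows "ac_deriv S (\<lambda>x. y1 x * z2 x - z1 x * y2 x) (\<lambda>x. (h2 x - h1 x) * (y1 x * y2 x))"
proof -
  have a: "ac_deriv S y1 z1" "ac_deriv S z1 (\<lambda>x. h1 x * y1 x)"
    and b: "ac_deriv S y2 z2" "ac_deriv S z2 (\<lambda>x. h2 x * y2 x)"
    using 1 2 by (auto simp: ode_sol_def)
  show ?thesis
    by (rule ac_deriv_cong[OF ac_deriv_diff[OF ac_deriv_mult[OF a(1) b(2) S] ac_deriv_mult[OF a(2) b(1) S]] S])
       (auto simp: algebra_simps)
qed

lemma wronskian_const:
  assumes "ode_sol h S y1 z1" "ode_sol h S y2 z2" "is_interval S" "x \<in> S" "t \<in> S"
  shows "y1 x * z2 x - z1 x * y2 x = y1 t * z2 t - z1 t * y2 t"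
  by (rule ac_deriv_zero_imp_const[OF wronskian_deriv[OF assms(1-3)] assms(3) _ assms(4,5)]) simp

text \<open>For locally integrable \<open>h\<close> the choice is harmless: by
  \<open>ode_sol_unique\<close> the initial values determine the pair.\<close>

definition canonical_sol :: "(real \<Rightarrow> real) \<Rightarrow> real \<Rightarrow> real \<Rightarrow> (real \<Rightarrow> real) \<times> (real \<Rightarrow> real)" where
  "canonical_sol h a b = (SOME (y, z). ode_sol h UNIV y z \<and> y 0 = a \<and> z 0 = b)"

definition "cos_sol h = fst (canonical_sol h 1 0)"
definition "cos_sol' h = snd (canonical_sol h 1 0)"
definition "sin_sol h = fst (canonical_sol h 0 1)"
definition "sin_sol' h = snd (canonical_sol h 0 1)"

lemma canonical_sol:
  assumes "locally_integrable h"
  shows "ode_sol h UNIV (fst (canonical_sol h a b)) (snd (canonical_sol h a b))"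
    "fst (canonical_sol h a b) 0 = a" "snd (canonical_sol h a b) 0 = b"
proof -
  let ?P = "\<lambda>(y, z). ode_sol h UNIV y z \<and> y 0 = a \<and> z 0 = b"
  have "\<exists>w. ?P w" using solution_exists[OF assms, of a b] by auto
  then have "?P (canonical_sol h a b)" unfolding canonical_sol_def by (rule someI_ex)
  then show "ode_sol h UNIV (fst (canonical_sol h a b)) (snd (canonical_sol h a b))"
    "fst (canonical_sol h a b) 0 = a" "snd (canonical_sol h a b) 0 = b"
    by (auto simp: case_prod_beta)
qed

lemma cos_sol:
  assumes "locally_integrable h"
  shows "ode_sol h UNIV (cos_sol h) (cos_sol' h)" "cos_sol h 0 = 1" "cos_sol' h 0 = 0"
  using canonical_sol[OF assms, of 1 0] by (simp_all add: cos_sol_def cos_sol'_def)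

lemma sin_sol:
  assumes "locally_integrable h"
  shows "ode_sol h UNIV (sin_sol h) (sin_sol' h)" "sin_sol h 0 = 0" "sin_sol' h 0 = 1"
  using canonical_sol[OF assms, of 0 1] by (simp_all add: sin_sol_def sin_sol'_def)

lemma wronskian_cos_sin:
  assumes "locally_integrable h"
  shows "cos_sol h x * sin_sol' h x - cos_sol' h x * sin_sol h x = 1"
  using wronskian_const[OF cos_sol(1)[OF assms] sin_sol(1)[OF assms], of x 0] cos_sol[OF assms] sin_sol[OF assms]
  by simp

text \<open>Cramer's rule for the fundamental matrix, whose determinant is 1.\<close>

lemma basis_expansion:
  fixes c c' s s' y z :: real
  assumes "c * s' - c' * s = 1"
  shows "y = (y * s' - z * s) * c + (c * z - c' * y) * s" "z = (y * s' - z * s) * c' + (c * z - c' * y) * s'"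
proof -
  have "(y * s' - z * s) * c + (c * z - c' * y) * s = y * (c * s' - c' * s)" by (simp add: algebra_simps)
  then show "y = (y * s' - z * s) * c + (c * z - c' * y) * s" using assms by simp
  have "(y * s' - z * s) * c' + (c * z - c' * y) * s' = z * (c * s' - c' * s)" by (simp add: algebra_simps)
  then show "z = (y * s' - z * s) * c' + (c * z - c' * y) * s'" using assms by simp
qed

text \<open>The coefficients of \<open>y\<close> in the basis are its Wronskians with the sine and
  cosine solutions; these are constant and can be read off at 0. Uniqueness then follows without a
  Gronwall estimate.\<close>

lemma ode_sol_expansion:
  assumes h: "locally_integrable h" and y: "ode_sol h S y z" and S: "is_interval S" "0 \<in> S" "x \<in> S"
  shows "y x = y 0 * cos_sol h x + z 0 * sin_sol h x" "z x = y 0 * cos_sol' h x + z 0 * sin_sol' h x"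
proof -
  note c = cos_sol[OF h] and s = sin_sol[OF h]
  have "y x * sin_sol' h x - z x * sin_sol h x = y 0"
    using wronskian_const[OF y ode_sol_subset[OF s(1)] S(1) S(3,2)] s by simp
  moreover have "cos_sol h x * z x - cos_sol' h x * y x = z 0"
    using wronskian_const[OF ode_sol_subset[OF c(1)] y S(1) S(3,2)] c by simp
  ultimately show "y x = y 0 * cos_sol h x + z 0 * sin_sol h x" "z x = y 0 * cos_sol' h x + z 0 * sin_sol' h x"
    using basis_expansion[OF wronskian_cos_sin[OF h, of x], where y = "y x" and z = "z x"] by simp_all
qed

lemma ode_sol_unique:
  assumes "locally_integrable h" "ode_sol h S y1 z1" "ode_sol h S y2 z2" "is_interval S" "0 \<in> S" "x \<in> S"
    and "y1 0 = y2 0" "z1 0 = z2 0"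
  shows "y1 x = y2 x" "z1 x = z2 x"
  using ode_sol_expansion[OF assms(1,2,4-6)] ode_sol_expansion[OF assms(1,3,4-6)] assms(7,8) by simp_all

lemma ode_sol_continuous:
  assumes "ode_sol h {a..b} y z"
  shows "continuous_on {a..b} y" "continuous_on {a..b} z"
  using assms by (auto simp: ode_sol_def intro: ac_deriv_continuous_Icc)

lemma ode_sol_continuous_UNIV:
  assumes "ode_sol h UNIV y z"
  shows "continuous_on A y" "continuous_on A z"
  using assms by (auto simp: ode_sol_def intro: ac_deriv_continuous_UNIV)

text \<open>\<open>z\<close> is tied to \<open>y\<close> only through integrals: where y = 0 it is
  constant by the second equation of the system, and its integral is 0 by the first.\<close>

lemma ode_sol_vanishing:
  assumes y: "ode_sol h {0..1} y z" and 0: "\<And>x. x \<in> {0..1} \<Longrightarrow> y x = 0"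
  shows "z 0 = 0"
proof -
  have ac: "ac_deriv {0..1} y z" "ac_deriv {0..1} z (\<lambda>x. h x * y x)"
    using y by (auto simp: ode_sol_def)
  have const: "z x = z 0" if "x \<in> {0..1}" for x
    by (rule ac_deriv_zero_imp_const[OF ac(2)]) (use that 0 in \<open>auto simp: is_interval_cc\<close>)
  have "0 = integral {0..1} z" using ac_derivD(3)[OF ac(1), of 0 1] 0 by simp
  also have "\<dots> = integral {0..1::real} (\<lambda>x. z 0)" by (rule integral_cong) (rule const)
  finally show ?thesis by simp
qed

lemma integral_square_pos:
  assumes y: "ode_sol h {0..1} y z" and nz: "y 0 \<noteq> 0 \<or> z 0 \<noteq> 0"
  shows "integral {0..1} (\<lambda>x. y x * y x) > 0"
proof -
  have c: "continuous_on {0..1} (\<lambda>x. y x * y x)"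
    using ode_sol_continuous[OF y] by (intro continuous_intros)
  have "integral {0..1} (\<lambda>x. y x * y x) \<noteq> 0"
  proof
    assume "integral {0..1} (\<lambda>x. y x * y x) = 0"
    then have "\<forall>x\<in>{0..1}. y x * y x = 0"
      using integral_eq_0_iff[OF c] by simp
    then have "y x = 0" if "x \<in> {0..1}" for x using that by auto
    then show False using ode_sol_vanishing[OF y] nz by auto
  qed
  moreover have "integral {0..1} (\<lambda>x. y x * y x) \<ge> 0"
    by (rule integral_nonneg[OF integrable_continuous_real[OF c]]) auto
  ultimately show ?thesis by simp
qed

lemma locally_integrable_shift_energy:
  assumes "locally_integrable p"
  shows "locally_integrable (\<lambda>x. p x - E)"
  unfolding locally_integrable_def
proof (intro allI)
  fix a b :: real
  show "(\<lambda>x. p x - E) absolutely_integrable_on {a..b}"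
    by (rule set_integral_diff(1)) (use assms in \<open>simp_all add: locally_integrable_def\<close>)
qed

lemma wronskian_energies:
  assumes "ode_sol (\<lambda>x. p x - E) {0..1} y1 z1" "ode_sol (\<lambda>x. p x - F) {0..1} y2 z2" "x \<in> {0..1}"
  shows "y1 x * z2 x - z1 x * y2 x = y1 0 * z2 0 - z1 0 * y2 0 + (E - F) * integral {0..x} (\<lambda>t. y1 t * y2 t)"
proof -
  have "integral {0..x} (\<lambda>t. (E - F) * (y1 t * y2 t)) =
      (y1 x * z2 x - z1 x * y2 x) - (y1 0 * z2 0 - z1 0 * y2 0)"
    using ac_derivD(3)[OF wronskian_deriv[OF assms(1,2)], of 0 x] assms(3) by (simp add: is_interval_cc)
  then show ?thesis by simp
qed

lemma cos_sol_Icc: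
  assumes "locally_integrable h"
  shows "ode_sol h S (cos_sol h) (cos_sol' h)" "ode_sol h S (sin_sol h) (sin_sol' h)"
  by (rule ode_sol_subset[OF cos_sol(1)[OF assms] subset_UNIV],
      rule ode_sol_subset[OF sin_sol(1)[OF assms] subset_UNIV])

text \<open>The Wronskians of \<open>y\<close> with the basis at energy \<open>E\<close> express
  \<open>y\<close> by variation of parameters, with an error of order |F - E| times the supremum of
  |y|. For F close to E this supremum is absorbed, which leaves a bound in terms of the initial
  values. Uniformity in \<open>x\<close> is what later allows limits under integrals.\<close>

lemma solution_perturbation:
  assumes p: "locally_integrable p"
  obtains M where "\<And>F y z x. ode_sol (\<lambda>x. p x - F) {0..1} y z \<Longrightarrow> \<bar>F - E\<bar> * M \<le> 1 \<Longrightarrow> x \<in> {0..1} \<Longrightarrow>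
      \<bar>y x - (y 0 * cos_sol (\<lambda>x. p x - E) x + z 0 * sin_sol (\<lambda>x. p x - E) x)\<bar> \<le> M * (\<bar>y 0\<bar> + \<bar>z 0\<bar>) * \<bar>F - E\<bar> \<and>
      \<bar>z x - (y 0 * cos_sol' (\<lambda>x. p x - E) x + z 0 * sin_sol' (\<lambda>x. p x - E) x)\<bar> \<le> M * (\<bar>y 0\<bar> + \<bar>z 0\<bar>) * \<bar>F - E\<bar>"
    "M > 0"
proof -
  define h where "h = (\<lambda>x. p x - E)"
  have h: "locally_integrable h" unfolding h_def by (rule locally_integrable_shift_energy[OF p])
  note sol = cos_sol_Icc[OF h]
  \<comment> \<open>The summand 1 forces A >= 1, so that powers of \<open>A\<close> can be
    compared.\<close>
  define B where "B = (\<lambda>x. \<bar>cos_sol h x\<bar> + \<bar>sin_sol h x\<bar> + \<bar>cos_sol' h x\<bar> + \<bar>sin_sol' h x\<bar> + 1)"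
  have "continuous_on {0..1} B"
    unfolding B_def using ode_sol_continuous[OF sol(1), where a = 0 and b = 1] ode_sol_continuous[OF sol(2), where a = 0 and b = 1] by (intro continuous_intros)
  then have "\<exists>x0\<in>{0..1}. \<forall>x\<in>{0..1}. B x \<le> B x0"
    by (intro continuous_attains_sup) auto
  then obtain x0 where x0: "\<And>x. x \<in> {0..1} \<Longrightarrow> B x \<le> B x0"
    by blast
  define A where "A = B x0"
  have A1: "A \<ge> 1" unfolding A_def B_def by simp
  have A: "\<bar>cos_sol h x\<bar> \<le> A" "\<bar>sin_sol h x\<bar> \<le> A" "\<bar>cos_sol' h x\<bar> \<le> A" "\<bar>sin_sol' h x\<bar> \<le> A" if "x \<in> {0..1}" for x
    using x0[OF that] unfolding A_def B_def by linarith+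
  \<comment> \<open>The error is at most 2 * A^2 * b * |F - E|, and b <= 2 * A * (|y 0| + |z 0|):
    the two constants multiply to 4 * A^3.\<close>
  define M where "M = 4 * A * A * A"
  have "A * A \<ge> 1" using A1 mult_mono[of 1 A 1 A] by simp
  then have AA: "4 * (A * A) \<le> M" using A1 mult_left_mono[of 1 A "A * A"] by (simp add: M_def)
  have M0: "M > 0" using A1 by (simp add: M_def)
  show ?thesis
  proof (rule that[OF _ M0])
    fix F y z x assume y: "ode_sol (\<lambda>x. p x - F) {0..1} y z" and F: "\<bar>F - E\<bar> * M \<le> 1" and x: "x \<in> {0..1::real}"
    have cy: "continuous_on {0..1} (\<lambda>x. \<bar>y x\<bar>)" using ode_sol_continuous[OF y] by (intro continuous_intros)
    have "\<exists>x1\<in>{0..1}. \<forall>x\<in>{0..1}. \<bar>y x\<bar> \<le> \<bar>y x1\<bar>"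
      by (rule continuous_attains_sup[OF _ _ cy]) auto
    then obtain x1 where x1: "x1 \<in> {0..1}" "\<And>x. x \<in> {0..1} \<Longrightarrow> \<bar>y x\<bar> \<le> \<bar>y x1\<bar>"
      by blast
    define b where "b = \<bar>y x1\<bar>"
    have b0: "b \<ge> 0" and b: "\<And>x. x \<in> {0..1} \<Longrightarrow> \<bar>y x\<bar> \<le> b" using x1 by (auto simp: b_def)
    have intb: "\<bar>integral {0..x} (\<lambda>t. w t * y t)\<bar> \<le> A * b"
      if "continuous_on {0..1} w" "\<And>t. t \<in> {0..1} \<Longrightarrow> \<bar>w t\<bar> \<le> A" "x \<in> {0..1}" for w x
    proof -
      have c: "continuous_on {0..x} (\<lambda>t. w t * y t)"
        using that ode_sol_continuous(1)[OF y] by (intro continuous_intros) (auto elim: continuous_on_subset)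
      have "norm (integral {0..x} (\<lambda>t. w t * y t)) \<le> integral {0..x} (\<lambda>t. A * b)"
      proof (rule integral_norm_bound_integral[OF integrable_continuous_real[OF c] integrable_const_ivl])
        show "norm (w t * y t) \<le> A * b" if "t \<in> {0..x}" for t
          unfolding real_norm_def abs_mult using \<open>x \<in> {0..1}\<close> that \<open>\<And>t. t \<in> {0..1} \<Longrightarrow> \<bar>w t\<bar> \<le> A\<close>[of t] b[of t] A1
          by (intro mult_mono) auto
      qed
      also have "\<dots> = x * (A * b)" using that by simp
      also have "\<dots> \<le> 1 * (A * b)" using that A1 b0 by (intro mult_right_mono) auto
      finally show ?thesis by simp
    qed
    define \<alpha> where "\<alpha> = (\<lambda>x. integral {0..x} (\<lambda>t. cos_sol h t * y t))"
    define \<beta> where "\<beta> = (\<lambda>x. integral {0..x} (\<lambda>t. sin_sol h t * y t))"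
    have ab: "\<bar>\<alpha> x\<bar> \<le> A * b" "\<bar>\<beta> x\<bar> \<le> A * b" if "x \<in> {0..1}" for x
      unfolding \<alpha>_def \<beta>_def using A that sol by (auto intro!: intb ode_sol_continuous(1))
    have yz: "y x - (y 0 * cos_sol h x + z 0 * sin_sol h x) = (E - F) * (\<alpha> x * sin_sol h x - \<beta> x * cos_sol h x)"
      "z x - (y 0 * cos_sol' h x + z 0 * sin_sol' h x) = (E - F) * (\<alpha> x * sin_sol' h x - \<beta> x * cos_sol' h x)"
      if "x \<in> {0..1}" for x
    proof -
      have "cos_sol h x * z x - cos_sol' h x * y x = z 0 + (E - F) * \<alpha> x"
        using wronskian_energies[OF sol(1)[unfolded h_def] y that] cos_sol[OF h] unfolding \<alpha>_def h_def by simp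
      moreover have "sin_sol h x * z x - sin_sol' h x * y x = - y 0 + (E - F) * \<beta> x"
        using wronskian_energies[OF sol(2)[unfolded h_def] y that] sin_sol[OF h] unfolding \<beta>_def h_def by simp
      then have "y x * sin_sol' h x - z x * sin_sol h x = y 0 - (E - F) * \<beta> x"
        by (simp add: algebra_simps)
      ultimately have "y x = (y 0 - (E - F) * \<beta> x) * cos_sol h x + (z 0 + (E - F) * \<alpha> x) * sin_sol h x"
        "z x = (y 0 - (E - F) * \<beta> x) * cos_sol' h x + (z 0 + (E - F) * \<alpha> x) * sin_sol' h x"
        using basis_expansion[OF wronskian_cos_sin[OF h, of x], where y = "y x" and z = "z x"] by simp_all
      then show "y x - (y 0 * cos_sol h x + z 0 * sin_sol h x) = (E - F) * (\<alpha> x * sin_sol h x - \<beta> x * cos_sol h x)"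
        "z x - (y 0 * cos_sol' h x + z 0 * sin_sol' h x) = (E - F) * (\<alpha> x * sin_sol' h x - \<beta> x * cos_sol' h x)"
        by (simp_all add: algebra_simps)
    qed
    have est: "\<bar>(E - F) * (\<alpha> x * s - \<beta> x * c)\<bar> \<le> \<bar>F - E\<bar> * (2 * (A * A) * b)"
      if "x \<in> {0..1}" "\<bar>s\<bar> \<le> A" "\<bar>c\<bar> \<le> A" for x s c
    proof -
      have "\<bar>\<alpha> x * s - \<beta> x * c\<bar> \<le> \<bar>\<alpha> x\<bar> * \<bar>s\<bar> + \<bar>\<beta> x\<bar> * \<bar>c\<bar>" by (simp add: abs_mult[symmetric])
      also have "\<dots> \<le> (A * b) * A + (A * b) * A"
        using ab[OF that(1)] that A1 b0 by (intro add_mono mult_mono) auto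
      also have "\<dots> = 2 * (A * A) * b" by simp
      finally have "\<bar>E - F\<bar> * \<bar>\<alpha> x * s - \<beta> x * c\<bar> \<le> \<bar>E - F\<bar> * (2 * (A * A) * b)"
        by (rule mult_left_mono) simp
      then show ?thesis unfolding abs_mult by (simp only: abs_minus_commute)
    qed
    have b_le: "b \<le> 2 * (A * (\<bar>y 0\<bar> + \<bar>z 0\<bar>))"
    proof -
      have "\<bar>y 0 * cos_sol h x1 + z 0 * sin_sol h x1\<bar> \<le> \<bar>y 0\<bar> * A + \<bar>z 0\<bar> * A"
        using A[OF x1(1)] by (intro order_trans[OF abs_triangle_ineq] add_mono) (auto simp: abs_mult intro: mult_left_mono)
      moreover have "\<bar>y x1 - (y 0 * cos_sol h x1 + z 0 * sin_sol h x1)\<bar> \<le> \<bar>F - E\<bar> * (2 * (A * A) * b)"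
        unfolding yz(1)[OF x1(1)] using est[OF x1(1)] A[OF x1(1)] by blast
      \<comment> \<open>Since 4 * A^2 <= M and |F - E| * M <= 1, the error takes at most half of
        \<open>b\<close> and can be moved to the left side.\<close>
      moreover have "\<bar>F - E\<bar> * (2 * (A * A) * b) \<le> b / 2"
      proof -
        have "\<bar>F - E\<bar> * (4 * (A * A)) \<le> \<bar>F - E\<bar> * M" using AA by (intro mult_left_mono) auto
        then have "\<bar>F - E\<bar> * (4 * (A * A)) \<le> 1" using F by linarith
        from mult_right_mono[OF this b0] show ?thesis by (simp add: algebra_simps)
      qed
      ultimately have "b \<le> \<bar>y 0\<bar> * A + \<bar>z 0\<bar> * A + b / 2" unfolding b_def by linarith
      then show ?thesis by (simp add: algebra_simps)
    qed
    have "2 * (A * A) * b \<le> 2 * (A * A) * (2 * (A * (\<bar>y 0\<bar> + \<bar>z 0\<bar>)))"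
      using b_le A1 by (intro mult_left_mono) auto
    also have "\<dots> = M * (\<bar>y 0\<bar> + \<bar>z 0\<bar>)" by (simp add: M_def algebra_simps)
    finally have le: "\<bar>F - E\<bar> * (2 * (A * A) * b) \<le> M * (\<bar>y 0\<bar> + \<bar>z 0\<bar>) * \<bar>F - E\<bar>"
      by (simp add: mult_left_mono mult.commute)
    show "\<bar>y x - (y 0 * cos_sol (\<lambda>x. p x - E) x + z 0 * sin_sol (\<lambda>x. p x - E) x)\<bar> \<le> M * (\<bar>y 0\<bar> + \<bar>z 0\<bar>) * \<bar>F - E\<bar> \<and>
      \<bar>z x - (y 0 * cos_sol' (\<lambda>x. p x - E) x + z 0 * sin_sol' (\<lambda>x. p x - E) x)\<bar> \<le> M * (\<bar>y 0\<bar> + \<bar>z 0\<bar>) * \<bar>F - E\<bar>"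
      unfolding h_def[symmetric] yz[OF x]
      using est[OF x A(2)[OF x] A(1)[OF x]] est[OF x A(4)[OF x] A(3)[OF x]] le by linarith
  qed
qed

section \<open>The monodromy matrix\<close>

text \<open>The matrix sends value and slope at 0 to value and slope at 1: the cosine solution fills
  the first column, the sine solution the second.\<close>

definition "m11 p E = cos_sol (\<lambda>x. p x - E) 1"
definition "m12 p E = sin_sol (\<lambda>x. p x - E) 1"
definition "m21 p E = cos_sol' (\<lambda>x. p x - E) 1"
definition "m22 p E = sin_sol' (\<lambda>x. p x - E) 1"

lemma uniform_limit_fundamental:
  assumes p: "locally_integrable p"
  shows "uniform_limit {0..1} (\<lambda>F. cos_sol (\<lambda>x. p x - F)) (cos_sol (\<lambda>x. p x - E)) (at E)"
    and "uniform_limit {0..1} (\<lambda>F. sin_sol (\<lambda>x. p x - F)) (sin_sol (\<lambda>x. p x - E)) (at E)"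
    and "uniform_limit {0..1} (\<lambda>F. cos_sol' (\<lambda>x. p x - F)) (cos_sol' (\<lambda>x. p x - E)) (at E)"
    and "uniform_limit {0..1} (\<lambda>F. sin_sol' (\<lambda>x. p x - F)) (sin_sol' (\<lambda>x. p x - E)) (at E)"
proof -
  obtain M where M: "\<And>F y z x. ode_sol (\<lambda>x. p x - F) {0..1} y z \<Longrightarrow> \<bar>F - E\<bar> * M \<le> 1 \<Longrightarrow> x \<in> {0..1} \<Longrightarrow>
      \<bar>y x - (y 0 * cos_sol (\<lambda>x. p x - E) x + z 0 * sin_sol (\<lambda>x. p x - E) x)\<bar> \<le> M * (\<bar>y 0\<bar> + \<bar>z 0\<bar>) * \<bar>F - E\<bar> \<and>
      \<bar>z x - (y 0 * cos_sol' (\<lambda>x. p x - E) x + z 0 * sin_sol' (\<lambda>x. p x - E) x)\<bar> \<le> M * (\<bar>y 0\<bar> + \<bar>z 0\<bar>) * \<bar>F - E\<bar>"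
    "M > 0"
    using solution_perturbation[OF p, of E] by blast
  have ul: "uniform_limit {0..1} f (f E) (at E)"
    if f: "\<And>F x. \<bar>F - E\<bar> * M \<le> 1 \<Longrightarrow> x \<in> {0..1} \<Longrightarrow> \<bar>f F x - f E x\<bar> \<le> M * \<bar>F - E\<bar>" for f :: "real \<Rightarrow> real \<Rightarrow> real"
  proof (rule uniform_limitI)
    fix e :: real assume e: "e > 0"
    show "\<forall>\<^sub>F F in at E. \<forall>x\<in>{0..1}. dist (f F x) (f E x) < e"
      unfolding eventually_at
    proof (intro exI[of _ "min (1 / M) (e / M)"] conjI ballI impI)
      show "0 < min (1 / M) (e / M)" using M(2) e by simp
      fix F x assume F: "F \<noteq> E \<and> dist F E < min (1 / M) (e / M)" and x: "x \<in> {0..1::real}"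
      then have "\<bar>F - E\<bar> < 1 / M" "\<bar>F - E\<bar> < e / M" by (auto simp: dist_real_def)
      then have "\<bar>F - E\<bar> * M < 1" "\<bar>F - E\<bar> * M < e" using M(2) by (simp_all add: pos_less_divide_eq)
      then show "dist (f F x) (f E x) < e" using f[of F x] x by (simp add: dist_real_def mult.commute)
    qed
  qed
  have loc: "locally_integrable (\<lambda>x. p x - F)" for F by (rule locally_integrable_shift_energy[OF p])
  show "uniform_limit {0..1} (\<lambda>F. cos_sol (\<lambda>x. p x - F)) (cos_sol (\<lambda>x. p x - E)) (at E)"
    using M(1)[OF cos_sol_Icc(1)[OF loc]] cos_sol[OF loc] by (intro ul) simp
  show "uniform_limit {0..1} (\<lambda>F. sin_sol (\<lambda>x. p x - F)) (sin_sol (\<lambda>x. p x - E)) (at E)"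
    using M(1)[OF cos_sol_Icc(2)[OF loc]] sin_sol[OF loc] by (intro ul) simp
  show "uniform_limit {0..1} (\<lambda>F. cos_sol' (\<lambda>x. p x - F)) (cos_sol' (\<lambda>x. p x - E)) (at E)"
    using M(1)[OF cos_sol_Icc(1)[OF loc]] cos_sol[OF loc] by (intro ul) simp
  show "uniform_limit {0..1} (\<lambda>F. sin_sol' (\<lambda>x. p x - F)) (sin_sol' (\<lambda>x. p x - E)) (at E)"
    using M(1)[OF cos_sol_Icc(2)[OF loc]] sin_sol[OF loc] by (intro ul) simp
qed

lemma isCont_monodromy:
  assumes p: "locally_integrable p"
  shows "isCont (m11 p) E" "isCont (m12 p) E" "isCont (m21 p) E" "isCont (m22 p) E"
proof -
  have 1: "(1::real) \<in> {0..1}" by simp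
  note u = uniform_limit_fundamental[OF p, THEN tendsto_uniform_limitI, OF 1]
  show "isCont (m11 p) E" "isCont (m12 p) E" "isCont (m21 p) E" "isCont (m22 p) E"
    using u unfolding isCont_def m11_def m12_def m21_def m22_def by auto
qed

lemma m_det:
  assumes p: "locally_integrable p"
  shows "m11 p E * m22 p E - m21 p E * m12 p E = 1"
  unfolding m11_def m12_def m21_def m22_def
  by (rule wronskian_cos_sin[OF locally_integrable_shift_energy[OF p]])

lemma tendsto_integral_product:
  fixes f :: "real \<Rightarrow> real \<Rightarrow> real"
  assumes "uniform_limit {0..1} f (f E) (at E)" "\<And>F. continuous_on {0..1} (f F)"
  shows "((\<lambda>F. integral {0..1} (\<lambda>x. f E x * f F x)) \<longlongrightarrow> integral {0..1} (\<lambda>x. f E x * f E x)) (at E)"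
proof -
  have bd: "bounded (f E ` {0..1})"
    using assms(2)[of E] by (intro compact_imp_bounded compact_continuous_image) auto
  have "uniform_limit {0..1} (\<lambda>F x. f E x * f F x) (\<lambda>x. f E x * f E x) (at E)"
    by (rule uniform_lim_mult[OF uniform_limit_const assms(1) bd bd])
  then obtain I J where IJ: "\<And>F. ((\<lambda>x. f E x * f F x) has_integral I F) {0..1}"
    "((\<lambda>x. f E x * f E x) has_integral J) {0..1}" "(I \<longlongrightarrow> J) (at E)"
    by (rule uniform_limit_integral[OF _ continuous_on_mult[OF assms(2) assms(2)] at_neq_bot]) (rule that; assumption)
  have "I = (\<lambda>F. integral {0..1} (\<lambda>x. f E x * f F x))" "J = integral {0..1} (\<lambda>x. f E x * f E x)"
    by (rule ext, rule integral_unique[OF IJ(1), symmetric], rule integral_unique[OF IJ(2), symmetric])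
  then show ?thesis using IJ(3) by simp
qed

text \<open>The cross difference makes the difference quotient of n / d equal to I F / (d F * d E),
  so a derivative of \<open>n\<close> or \<open>d\<close> itself is never asked for.\<close>

lemma DERIV_quotient_of_cross_difference:
  fixes n d I :: "real \<Rightarrow> real"
  assumes d: "isCont d E" "d E \<noteq> 0" and I: "(I \<longlongrightarrow> L) (at E)"
    and cross: "\<And>F. n F * d E - n E * d F = (F - E) * I F"
  shows "((\<lambda>F. n F / d F) has_field_derivative L / (d E)\<^sup>2) (at E)"
  unfolding has_field_derivative_iff
proof (rule Lim_transform_eventually)
  have dl: "(d \<longlongrightarrow> d E) (at E)" using d(1) by (simp add: isCont_def)
  show "((\<lambda>F. I F / (d F * d E)) \<longlongrightarrow> L / (d E)\<^sup>2) (at E)"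
    unfolding power2_eq_square using d by (intro tendsto_intros I dl) auto
  have "\<forall>\<^sub>F F in at E. d F \<noteq> 0" by (rule tendsto_imp_eventually_ne[OF dl d(2)])
  moreover have "\<forall>\<^sub>F F in at E. F \<noteq> E" by (simp add: eventually_at_filter)
  ultimately show "\<forall>\<^sub>F F in at E. I F / (d F * d E) = (n F / d F - n E / d E) / (F - E)"
  proof eventually_elim
    case (elim F)
    have "n F / d F - n E / d E = (n F * d E - n E * d F) / (d F * d E)"
      using elim d(2) by (simp add: diff_frac_eq)
    then show ?case using elim cross[of F] by simp
  qed
qed

text \<open>The cross differences are, up to sign, Wronskians at 1 of two sine or two cosine
  solutions at energies \<open>E\<close> and \<open>F\<close>. The derivatives are the integral of
  the squared sine solution over m22^2, and minus that of the squared cosine solution over m11^2;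
  the sign flips because value and slope exchange places in the quotient.\<close>

lemma DERIV_monodromy_ratio:
  assumes p: "locally_integrable p"
  shows "m22 p E \<noteq> 0 \<Longrightarrow> \<exists>D>0. ((\<lambda>E. m12 p E / m22 p E) has_field_derivative D) (at E)"
    and "m11 p E \<noteq> 0 \<Longrightarrow> \<exists>D<0. ((\<lambda>E. m21 p E / m11 p E) has_field_derivative D) (at E)"
proof -
  have loc: "locally_integrable (\<lambda>x. p x - F)" for F by (rule locally_integrable_shift_energy[OF p])
  note c = cos_sol_Icc(1)[OF loc, where S = "{0..1}"] and s = cos_sol_Icc(2)[OF loc, where S = "{0..1}"]
  note ul = uniform_limit_fundamental[OF p, of E]
  show "\<exists>D>0. ((\<lambda>E. m12 p E / m22 p E) has_field_derivative D) (at E)" if nz: "m22 p E \<noteq> 0"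
  proof -
    define I where "I F = integral {0..1} (\<lambda>x. sin_sol (\<lambda>x. p x - E) x * sin_sol (\<lambda>x. p x - F) x)" for F
    have I: "(I \<longlongrightarrow> I E) (at E)"
      unfolding I_def by (rule tendsto_integral_product[OF ul(2) ode_sol_continuous(1)[OF s]])
    have "m12 p F * m22 p E - m12 p E * m22 p F = (F - E) * I F" for F
      using wronskian_energies[OF s s, of 1 E F] sin_sol(2,3)[OF loc]
      unfolding I_def m12_def m22_def by (simp add: algebra_simps)
    note D = DERIV_quotient_of_cross_difference[OF isCont_monodromy(4)[OF p] nz I this]
    have "I E > 0"
      unfolding I_def by (rule integral_square_pos[OF s]) (simp add: sin_sol[OF loc])
    then have "I E / (m22 p E)\<^sup>2 > 0" using nz by simp
    then show ?thesis using D by blast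
  qed
  show "\<exists>D<0. ((\<lambda>E. m21 p E / m11 p E) has_field_derivative D) (at E)" if nz: "m11 p E \<noteq> 0"
  proof -
    define I where "I F = integral {0..1} (\<lambda>x. cos_sol (\<lambda>x. p x - E) x * cos_sol (\<lambda>x. p x - F) x)" for F
    have I: "((\<lambda>F. - I F) \<longlongrightarrow> - I E) (at E)"
      unfolding I_def by (rule tendsto_minus[OF tendsto_integral_product[OF ul(1) ode_sol_continuous(1)[OF c]]])
    have "m21 p F * m11 p E - m21 p E * m11 p F = (F - E) * - I F" for F
      using wronskian_energies[OF c c, of 1 E F] cos_sol(2,3)[OF loc]
      unfolding I_def m11_def m21_def by (simp add: algebra_simps)
    note D = DERIV_quotient_of_cross_difference[OF isCont_monodromy(1)[OF p] nz I this]
    have "I E > 0"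
      unfolding I_def by (rule integral_square_pos[OF c]) (simp add: cos_sol[OF loc])
    then have "- I E / (m11 p E)\<^sup>2 < 0" using nz by simp
    then show ?thesis using D by blast
  qed
qed

lemma monodromy_ratio_strict_mono:
  assumes p: "locally_integrable p" and "a < b"
  shows "(\<And>E. a \<le> E \<Longrightarrow> E \<le> b \<Longrightarrow> m22 p E \<noteq> 0) \<Longrightarrow> m12 p a / m22 p a < m12 p b / m22 p b"
    and "(\<And>E. a \<le> E \<Longrightarrow> E \<le> b \<Longrightarrow> m11 p E \<noteq> 0) \<Longrightarrow> m21 p b / m11 p b < m21 p a / m11 p a"
proof -
  show "m12 p a / m22 p a < m12 p b / m22 p b" if "\<And>E. a \<le> E \<Longrightarrow> E \<le> b \<Longrightarrow> m22 p E \<noteq> 0"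
    using DERIV_pos_imp_increasing[OF assms(2), of "\<lambda>E. m12 p E / m22 p E"] DERIV_monodromy_ratio(1)[OF p] that
    by blast
  show "m21 p b / m11 p b < m21 p a / m11 p a" if "\<And>E. a \<le> E \<Longrightarrow> E \<le> b \<Longrightarrow> m11 p E \<noteq> 0"
    using DERIV_neg_imp_decreasing[OF assms(2), of "\<lambda>E. m21 p E / m11 p E"] DERIV_monodromy_ratio(2)[OF p] that
    by blast
qed

text \<open>Integrating (y y')' for the sine solution gives y 1 * y' 1 as the integral of y'^2 + (p
  - E) * y^2. The possibly unbounded \<open>p\<close> is controlled by the supremum of y^2, which in
  turn is bounded by the integrals of y^2 and y'^2; what is left is positive once - E is
  large.\<close>

lemma m12_m22_pos_at_low_energy:
  assumes p: "locally_integrable p"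
  shows "\<exists>E0. \<forall>E<E0. m12 p E * m22 p E > 0"
proof -
  \<comment> \<open>The summand 1 makes division by \<open>P\<close> safe and saves one copy of
    \<open>B\<close> when (P - 1) * B is subtracted below.\<close>
  define P where "P = integral {0..1} (\<lambda>x. \<bar>p x\<bar>) + 1"
  have pa: "p absolutely_integrable_on {0..1}" using p by (simp add: locally_integrable_def)
  then have api: "(\<lambda>x. \<bar>p x\<bar>) integrable_on {0..1}" by (simp add: absolutely_integrable_on_def)
  have P1: "P \<ge> 1" unfolding P_def using integral_nonneg[OF api] by simp
  have "m12 p E * m22 p E > 0" if E: "E < - (P * P)" for E
  proof -
    have loc: "locally_integrable (\<lambda>x. p x - E)" by (rule locally_integrable_shift_energy[OF p])
    define y where "y = sin_sol (\<lambda>x. p x - E)"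
    define z where "z = sin_sol' (\<lambda>x. p x - E)"
    have sol: "ode_sol (\<lambda>x. p x - E) {0..1} y z" unfolding y_def z_def by (rule cos_sol_Icc(2)[OF loc])
    have y0: "y 0 = 0" "z 0 = 1" unfolding y_def z_def by (rule sin_sol[OF loc])+
    have ac: "ac_deriv {0..1} y z" "ac_deriv {0..1} z (\<lambda>x. (p x - E) * y x)"
      using sol by (auto simp: ode_sol_def)
    note cy = ode_sol_continuous(1)[OF sol] and cz = ode_sol_continuous(2)[OF sol]
    have yi: "(\<lambda>x. y x * y x) integrable_on {0..x}" and zi: "(\<lambda>x. z x * z x) integrable_on {0..x}" if "x \<le> 1" for x
      using that continuous_on_subset[OF cy, of "{0..x}"] continuous_on_subset[OF cz, of "{0..x}"]
      by (auto intro!: integrable_continuous_real continuous_intros)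
    define Y where "Y = integral {0..1} (\<lambda>x. y x * y x)"
    define Z where "Z = integral {0..1} (\<lambda>x. z x * z x)"
    have Y0: "Y > 0" unfolding Y_def by (rule integral_square_pos[OF sol]) (simp add: y0)
    \<comment> \<open>Bound for y^2 obtained from 2 * y * z <= z^2 / P + P * y^2. The weight is
      chosen so that P * B = Z + P^2 * Y: subtracting (P - 1) * B from Z - E * Y leaves B + (- E -
      P^2) * Y, hence the threshold - P^2 for \<open>E\<close>.\<close>
    define B where "B = Z / P + P * Y"
    have Bint: "((\<lambda>x. z x * z x / P + P * (y x * y x)) has_integral B) {0..1}"
      unfolding B_def Y_def Z_def using yi[of 1] zi[of 1]
      by (intro has_integral_add has_integral_divide has_integral_mult_right) (auto simp: has_integral_iff)
    have sq: "y x * y x \<le> B" if x: "x \<in> {0..1}" for x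
    proof -
      have "((\<lambda>t. z t * y t + y t * z t) has_integral (y x * y x - y 0 * y 0)) {0..x}"
        by (rule ac_derivD(4)[OF ac_deriv_mult[OF ac(1) ac(1)]]) (use x in \<open>auto simp: is_interval_cc\<close>)
      then have sqi: "((\<lambda>t. z t * y t + y t * z t) has_integral (y x * y x)) {0..x}"
        by (simp only: y0) simp
      have "((\<lambda>x. z x * z x / P + P * (y x * y x)) has_integral integral {0..x} (\<lambda>x. z x * z x / P + P * (y x * y x))) {0..x}"
        using x by (intro integrable_integral integrable_on_subinterval[OF has_integral_integrable[OF Bint]]) auto
      with sqi have "y x * y x \<le> integral {0..x} (\<lambda>x. z x * z x / P + P * (y x * y x))"
      proof (rule has_integral_le)
        fix t
        have "0 \<le> (z t - P * y t)\<^sup>2 / P" using P1 by simp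
        also have "(z t - P * y t)\<^sup>2 / P = z t * z t / P + P * (y t * y t) - (z t * y t + y t * z t)"
          using P1 by (simp add: power2_eq_square field_simps)
        finally show "z t * y t + y t * z t \<le> z t * z t / P + P * (y t * y t)" by simp
      qed
      also have "\<dots> \<le> integral {0..1} (\<lambda>x. z x * z x / P + P * (y x * y x))"
        using x P1 by (intro integral_subset_le has_integral_integrable[OF Bint]
            integrable_on_subinterval[OF has_integral_integrable[OF Bint]]) auto
      also have "\<dots> = B" using Bint by (rule integral_unique)
      finally show ?thesis .
    qed
    have "((\<lambda>t. z t * z t + y t * ((p t - E) * y t)) has_integral (y 1 * z 1 - y 0 * z 0)) {0..1}"
      by (rule ac_derivD(4)[OF ac_deriv_mult[OF ac]]) (auto simp: is_interval_cc)
    then have up: "((\<lambda>t. z t * z t + y t * ((p t - E) * y t)) has_integral (y 1 * z 1)) {0..1}"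
      by (simp only: y0) simp
    have B0: "B \<ge> 0" using sq[of 0] y0 by simp
    have low: "((\<lambda>t. z t * z t + (- E) * (y t * y t) - \<bar>p t\<bar> * B) has_integral (Z + (- E) * Y - (P - 1) * B)) {0..1}"
      unfolding Z_def Y_def P_def using yi[of 1] zi[of 1] api
      by (intro has_integral_add has_integral_diff has_integral_mult_left has_integral_mult_right)
         (auto simp: has_integral_iff)
    have "Z + (- E) * Y - (P - 1) * B \<le> y 1 * z 1"
    proof (rule has_integral_le[OF low up])
      fix t :: real assume t: "t \<in> {0..1}"
      have "- (p t * (y t * y t)) \<le> \<bar>p t\<bar> * (y t * y t)"
        using mult_right_mono[of "- p t" "\<bar>p t\<bar>" "y t * y t"] by simp
      also have "\<dots> \<le> \<bar>p t\<bar> * B" using sq[OF t] by (intro mult_left_mono) auto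
      finally show "z t * z t + (- E) * (y t * y t) - \<bar>p t\<bar> * B \<le> z t * z t + y t * ((p t - E) * y t)"
        by (simp add: algebra_simps)
    qed
    moreover have "Z + (- E) * Y - (P - 1) * B = (- E - P * P) * Y + B"
      unfolding B_def using P1 by (simp add: field_simps)
    moreover have "(- E - P * P) * Y > 0" using E Y0 by simp
    ultimately have "y 1 * z 1 > 0" using B0 by linarith
    then show ?thesis by (simp add: y_def z_def m12_def m22_def)
  qed
  then show ?thesis by (intro exI[of _ "- (P * P)"]) auto
qed

section \<open>Periodic and even potentials\<close>

lemma L1_evenD:
  assumes "p \<in> L1_even"
  shows "p (x + 1) = p x" "p absolutely_integrable_on {0..1}"
    "\<exists>N. negligible N \<and> (\<forall>x. x \<notin> N \<longrightarrow> 0 < x \<longrightarrow> x < 1 \<longrightarrow> p x = p (1 - x))"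
proof -
  show "p (x + 1) = p x" "p absolutely_integrable_on {0..1}"
    using assms by (auto simp: L1_even_def)
  have "AE x in lebesgue. 0 < x \<and> x < 1 \<longrightarrow> p x = p (1 - x)"
    using assms by (auto simp: L1_even_def)
  then obtain N where "negligible N" "{x. \<not> (0 < x \<and> x < 1 \<longrightarrow> p x = p (1 - x))} \<subseteq> N"
    unfolding eventually_ae_filter_negligible by blast
  then show "\<exists>N. negligible N \<and> (\<forall>x. x \<notin> N \<longrightarrow> 0 < x \<longrightarrow> x < 1 \<longrightarrow> p x = p (1 - x))"
    by blast
qed

lemma periodic_int_shift:
  fixes p :: "real \<Rightarrow> 'a"
  assumes "\<And>x. p (x + 1) = p x"
  shows "p (x + of_int k) = p x"
proof -
  have nat_shift: "p (x + real n) = p x" for n x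
  proof (induction n)
    case (Suc n)
    then show ?case using assms[of "x + real n"] by (simp add: add.commute add.left_commute)
  qed simp
  show ?thesis
  proof (cases "k \<ge> 0")
    case True then show ?thesis using nat_shift[of x "nat k"] by simp
  next
    case False then show ?thesis using nat_shift[of "x + of_int k" "nat (- k)"] by simp
  qed
qed

lemma L1_even_locally_integrable:
  assumes "p \<in> L1_even"
  shows "locally_integrable p"
proof -
  have unit: "p absolutely_integrable_on {of_int k..of_int k + 1}" for k
  proof -
    have "(\<lambda>x. p (x + of_int k)) absolutely_integrable_on {of_int k - of_int k..of_int k + 1 - of_int k}"
      using L1_evenD(2)[OF assms] periodic_int_shift[of p, OF L1_evenD(1)[OF assms]] by simp
    then show ?thesis by (subst (asm) absolutely_integrable_shift_Icc)
  qed
  have sym: "p absolutely_integrable_on {- real n..real n}" for n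
  proof (induction n)
    case 0
    show ?case by (rule absolutely_integrable_negligible) simp
  next
    case (Suc n)
    have "p absolutely_integrable_on {- real n..real n + 1}"
      by (rule absolutely_integrable_on_combine[OF Suc]) (use unit[of "int n"] in auto)
    then have "p absolutely_integrable_on {- real n - 1..real n + 1}"
      by (rule absolutely_integrable_on_combine[where c = "- real n", rotated]) (use unit[of "- int n - 1"] in auto)
    moreover have "- real (Suc n) = - real n - 1" "real (Suc n) = real n + 1" by simp_all
    ultimately show ?case by (simp only:)
  qed
  show ?thesis unfolding locally_integrable_def
  proof (intro allI)
    fix a b :: real
    obtain n where "real n \<ge> max \<bar>a\<bar> \<bar>b\<bar>" using real_arch_simple by blast
    then show "p absolutely_integrable_on {a..b}"
      by (intro absolutely_integrable_on_subinterval[OF sym[of n]]) auto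
  qed
qed

text \<open>Symmetry about 1/2 and periodicity combine to symmetry about 0. The null set has to be
  spread over all integer translates, and the integers join it because the symmetry is given on the
  open unit interval.\<close>

lemma L1_even_reflect:
  assumes "p \<in> L1_even"
  shows "\<exists>N. negligible N \<and> (\<forall>x. x \<notin> N \<longrightarrow> p (- x) = p x)"
proof -
  obtain N where N: "negligible N" "\<And>x. x \<notin> N \<Longrightarrow> 0 < x \<Longrightarrow> x < 1 \<Longrightarrow> p x = p (1 - x)"
    using L1_evenD(3)[OF assms] by blast
  define N' where "N' = \<int> \<union> (\<Union>k\<in>\<int>. (+) k ` N)"
  have "negligible (\<Union>k\<in>\<int>. (+) k ` N)"
    by (rule negligible_countable_Union) (auto intro: negligible_translation[OF N(1)] countable_int)
  then have "negligible N'"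
    unfolding N'_def by (intro negligible_Un) (simp add: negligible_iff_null_sets countable_imp_null_set_lborel null_sets_completionI countable_int)
  moreover have "p (- x) = p x" if "x \<notin> N'" for x
  proof -
    define t where "t = frac x"
    have x: "x = of_int \<lfloor>x\<rfloor> + t" by (simp add: t_def frac_def)
    have "x \<notin> \<int>" using that by (simp add: N'_def)
    then have t: "0 < t" "t < 1" by (simp_all add: t_def frac_lt_1 frac_gt_0_iff)
    have "t \<notin> N"
    proof
      assume "t \<in> N"
      then have "x \<in> (+) (of_int \<lfloor>x\<rfloor>) ` N" using x by blast
      then show False using that by (auto simp: N'_def)
    qed
    then have "p t = p (1 - t)" using N t by blast
    moreover have "p x = p t"
      using periodic_int_shift[of p, OF L1_evenD(1)[OF assms], of t "\<lfloor>x\<rfloor>"] x by (simp add: add.commute)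
    moreover have "p (- x) = p (1 - t)"
    proof -
      have "1 - t = - x + of_int (\<lfloor>x\<rfloor> + 1)" using x by simp
      then show ?thesis by (simp only: periodic_int_shift[of p, OF L1_evenD(1)[OF assms]])
    qed
    ultimately show ?thesis by simp
  qed
  ultimately show ?thesis by blast
qed

text \<open>Reflection about 1/2 turns the cosine solution into the one starting with value m11 and
  slope - m21, which arrives at 1 with value 1 and slope 0. Together with determinant 1 this
  annihilates m11 - m22 times the first column of the matrix, and that column is not zero.\<close>

lemma L1_even_m11_eq_m22:
  assumes p: "p \<in> L1_even"
  shows "m11 p E = m22 p E"
proof -
  have loc: "locally_integrable (\<lambda>x. p x - E)"
    using locally_integrable_shift_energy L1_even_locally_integrable[OF p] .
  obtain N where N: "negligible N" "\<And>x. x \<notin> N \<Longrightarrow> 0 < x \<Longrightarrow> x < 1 \<Longrightarrow> p x = p (1 - x)"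
    using L1_evenD(3)[OF p] by blast
  define y where "y = cos_sol (\<lambda>x. p x - E)"
  define z where "z = cos_sol' (\<lambda>x. p x - E)"
  have "ode_sol (\<lambda>x. p (- x) - E) UNIV (\<lambda>x. y (- x)) (\<lambda>x. - z (- x))"
    using ode_sol_reflect[OF cos_sol(1)[OF loc]] by (simp add: y_def z_def)
  from ode_sol_shift[OF this, of "- 1"]
  have "ode_sol (\<lambda>x. p (1 - x) - E) UNIV (\<lambda>x. y (1 - x)) (\<lambda>x. - z (1 - x))" by simp
  then have "ode_sol (\<lambda>x. p (1 - x) - E) {0..1} (\<lambda>x. y (1 - x)) (\<lambda>x. - z (1 - x))"
    by (rule ode_sol_subset) simp
  then have "ode_sol (\<lambda>x. p x - E) {0..1} (\<lambda>x. y (1 - x)) (\<lambda>x. - z (1 - x))"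
  proof (rule ode_sol_AE_cong)
    show "negligible (N \<union> {0, 1})" using N(1) by (intro negligible_Un) auto
    show "p x - E = p (1 - x) - E" if "x \<in> {0..1} - (N \<union> {0, 1})" for x
      using N(2)[of x] that by auto
  qed (simp add: is_interval_cc)
  from ode_sol_expansion[OF loc this, of 1]
  have 1: "1 = m11 p E * m11 p E - m21 p E * m12 p E" and 2: "0 = m11 p E * m21 p E - m21 p E * m22 p E"
    using cos_sol[OF loc] by (simp_all add: y_def z_def m11_def m12_def m21_def m22_def is_interval_cc)
  have 3: "m11 p E * m22 p E - m21 p E * m12 p E = 1"
    by (rule m_det[OF L1_even_locally_integrable[OF p]])
  have "m11 p E * (m11 p E - m22 p E) = 0" using 1 3 unfolding right_diff_distrib by linarith
  moreover have "m21 p E * (m11 p E - m22 p E) = 0" using 2 unfolding right_diff_distrib by (simp add: mult.commute)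
  moreover have "m11 p E \<noteq> 0 \<or> m21 p E \<noteq> 0" using 3 by auto
  ultimately show ?thesis by (metis mult_eq_0_iff right_minus_eq)
qed

section \<open>Square integrability on a half line\<close>

lemma ode_sol_shift_periodic:
  assumes y: "ode_sol h {0..} y z" and h: "\<And>x. h (x + 1) = h x"
  shows "ode_sol h {0..} (\<lambda>x. y (x + 1)) (\<lambda>x. z (x + 1))"
proof -
  have "ode_sol (\<lambda>x. h (x + 1)) {0..} (\<lambda>x. y (x + 1)) (\<lambda>x. z (x + 1))"
    by (rule ode_sol_subset[OF ode_sol_shift[OF y, of 1]]) auto
  then show ?thesis by (simp add: h)
qed

text \<open>The shifted solution and \<open>r\<close> times the solution have the same data at 0, so
  uniqueness makes them agree on the half line.\<close>

lemma floquet_multiplier: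
  assumes loc: "locally_integrable h" and h: "\<And>x. h (x + 1) = h x" and y: "ode_sol h {0..} y z"
    and 1: "y 1 = r * y 0" "z 1 = r * z 0" and x: "x \<ge> 0"
  shows "y (x + 1) = r * y x" "z (x + 1) = r * z x"
proof -
  have "ode_sol h {0..} (\<lambda>x. r * y x) (\<lambda>x. r * z x)"
    using ode_sol_lincomb[OF y y, of r 0] by simp
  from ode_sol_unique[OF loc ode_sol_shift_periodic[OF y h] this is_interval_ci, of x] 1 x
  show "y (x + 1) = r * y x" "z (x + 1) = r * z x" by simp_all
qed

lemma integral_multiplicative_recursion:
  fixes w :: "real \<Rightarrow> real"
  assumes w: "continuous_on {0..} w" and c: "\<And>x. x \<ge> 0 \<Longrightarrow> w (x + 1) = c * w x"
  shows "integral {0..real (Suc n)} w = integral {0..1} w + c * integral {0..real n} w"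
proof -
  have i: "w integrable_on {0..real n + 1}"
    by (rule integrable_continuous_real[OF continuous_on_subset[OF w]]) auto
  have "integral {0..1} w + integral {1..real n + 1} w = integral {0..real n + 1} w"
    using i by (intro Henstock_Kurzweil_Integration.integral_combine) auto
  moreover have "integral {1..real n + 1} w = integral {0..real n} (\<lambda>x. w (x + 1))"
    using integral_shift_real_ivl[where a = 1 and b = "real n + 1" and c = 1 and f = w] by simp
  moreover have "\<dots> = integral {0..real n} (\<lambda>x. c * w x)"
    by (rule integral_cong) (simp add: c)
  ultimately show ?thesis by (simp add: add.commute)
qed

text \<open>The bound is the sum of a geometric series, the fixed point of I = J + c * I with
  \<open>J\<close> the modulus of the first integral.\<close>

lemma bounded_integral_of_contraction:
  fixes w :: "real \<Rightarrow> real"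
  assumes w: "continuous_on {0..} w" and c: "\<And>x. x \<ge> 0 \<Longrightarrow> w (x + 1) = c * w x" "0 \<le> c" "c < 1"
  shows "integral {0..real n} w \<le> \<bar>integral {0..1} w\<bar> / (1 - c)"
proof (induction n)
  case 0
  then show ?case using c by simp
next
  case (Suc n)
  have rec: "integral {0..real (Suc n)} w = integral {0..1} w + c * integral {0..real n} w"
    by (rule integral_multiplicative_recursion[OF w]) (rule c(1))
  define J where "J = \<bar>integral {0..1} w\<bar>"
  have "integral {0..real (Suc n)} w \<le> J + c * (J / (1 - c))"
    unfolding rec J_def
    using Suc c(2) by (intro add_mono mult_left_mono) auto
  also have "\<dots> = J / (1 - c)" using c(3) by (simp add: field_simps)
  finally show ?case by (simp add: J_def)
qed

text \<open>Each period contributes at least as much as the first one, so a bounded total leaves no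
  room for a positive contribution.\<close>

lemma integral_zero_of_expansion:
  fixes w :: "real \<Rightarrow> real"
  assumes w: "continuous_on {0..} w" "\<And>x. x \<ge> 0 \<Longrightarrow> w x \<ge> 0"
    and c: "\<And>x. x \<ge> 0 \<Longrightarrow> w (x + 1) = c * w x" "1 \<le> c"
    and B: "\<And>n. integral {0..real n} w \<le> B"
  shows "integral {0..1} w = 0"
proof -
  define J where "J = integral {0..1} w"
  have "w integrable_on {0..1}"
    by (rule integrable_continuous_real[OF continuous_on_subset[OF w(1)]]) auto
  then have J0: "J \<ge> 0" unfolding J_def using w(2) by (intro integral_nonneg) auto
  have ge: "real n * J \<le> integral {0..real n} w" for n
  proof (induction n)
    case (Suc n)
    have rec: "integral {0..real (Suc n)} w = integral {0..1} w + c * integral {0..real n} w"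
      by (rule integral_multiplicative_recursion[OF w(1)]) (rule c(1))
    have "0 \<le> real n * J" using J0 by simp
    then have I0: "0 \<le> integral {0..real n} w" using Suc by linarith
    have "real (Suc n) * J \<le> J + 1 * integral {0..real n} w" using Suc by (simp add: algebra_simps)
    also have "\<dots> \<le> J + c * integral {0..real n} w" using c(2) I0 by (intro add_left_mono mult_right_mono)
    finally show ?case unfolding rec J_def .
  qed simp
  have "J \<le> 0"
  proof (rule ccontr)
    assume "\<not> J \<le> 0"
    then obtain n where "B < real n * J" using reals_Archimedean3[of J] by auto
    then show False using ge[of n] B[of n] by linarith
  qed
  then show ?thesis using J0 by (simp add: J_def)
qed

text \<open>Composition with the absolute value turns 0 into an interior point, so that continuity
  on compact intervals can be localised.\<close>

lemma ode_sol_continuous_half_line: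
  assumes y: "ode_sol h {0..} y z"
  shows "continuous_on {0..} y"
proof -
  have "continuous_on {0..} (\<lambda>x. y \<bar>x\<bar>)"
  proof -
    have "isCont (\<lambda>x. y \<bar>x\<bar>) x" for x
    proof -
      have "continuous_on {0..\<bar>x\<bar> + 1} y"
        by (rule ode_sol_continuous(1)[OF ode_sol_subset[OF y]]) auto
      then have "continuous_on {x - 1..x + 1} (\<lambda>x. y \<bar>x\<bar>)"
        by (rule continuous_on_compose2) (auto intro!: continuous_intros)
      then show ?thesis by (rule continuous_on_interior) auto
    qed
    then show ?thesis by (simp add: continuous_at_imp_continuous_on)
  qed
  then show ?thesis by (rule continuous_on_eq) auto
qed

text \<open>The multipliers are \<open>d - k\<close> and \<open>d + k\<close>, of modulus below and above 1; the component of a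
  solution along the second one is \<open>y (x + 1) - (d - k) * y x\<close>.\<close>

lemma square_integrable_half_line_iff:
  assumes loc: "locally_integrable p" and per: "\<And>x. p (x + 1) = p x"
    and y: "ode_sol (\<lambda>x. p x - E) {0..} y z"
    and d: "m11 p E = d" "m22 p E = d" "\<bar>d\<bar> > 1" and k: "k = sgn d * sqrt (d\<^sup>2 - 1)"
  shows "(\<exists>B. \<forall>n. integral {0..real n} (\<lambda>x. y x * y x) \<le> B) \<longleftrightarrow>
    m12 p E * z 0 = - k * y 0 \<and> m21 p E * y 0 = - k * z 0" (is "?L \<longleftrightarrow> ?R")
proof -
  define h where "h = (\<lambda>x. p x - E)"
  have h: "locally_integrable h" "\<And>x. h (x + 1) = h x"
    unfolding h_def by (rule locally_integrable_shift_energy[OF loc]) (simp add: per)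
  note y = y[folded h_def]
  have d1: "d\<^sup>2 > 1" using d(3) by (metis abs_le_square_iff abs_one linorder_not_le one_power2)
  have kk: "k * k = d\<^sup>2 - 1" using d1 unfolding k by (auto simp: sgn_if)
  have mm: "m12 p E * m21 p E = k * k"
    using m_det[OF loc, of E] d kk by (simp add: power2_eq_square algebra_simps)
  \<comment> \<open>The factor \<open>sgn d\<close> in \<open>k\<close> makes d + k the larger
    multiplier in modulus for either sign of \<open>d\<close>; the other one is its
    reciprocal.\<close>
  have dk: "\<bar>d + k\<bar> > 1"
  proof (cases "d > 0")
    case True
    moreover have "sqrt (d\<^sup>2 - 1) \<ge> 0" using d1 by simp
    moreover have "k = sqrt (d\<^sup>2 - 1)" using True by (simp add: k)
    ultimately show ?thesis using d(3) by linarith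
  next
    case False
    then have "d < 0" using d(3) by auto
    moreover have "sqrt (d\<^sup>2 - 1) \<ge> 0" using d1 by simp
    moreover have "k = - sqrt (d\<^sup>2 - 1)" using \<open>d < 0\<close> by (simp add: k)
    ultimately show ?thesis using d(3) by linarith
  qed
  have "(d - k) * (d + k) = 1" using kk by (simp add: algebra_simps power2_eq_square)
  then have "\<bar>d - k\<bar> * \<bar>d + k\<bar> = 1" by (simp add: abs_mult[symmetric])
  then have dk': "\<bar>d - k\<bar> < 1"
    using dk mult_mono[of 1 "\<bar>d - k\<bar>" "\<bar>d + k\<bar>" "\<bar>d + k\<bar>"] by (smt (verit) mult_left_le_one_le)
  have step: "f 1 = d * f 0 + m12 p E * g 0" "g 1 = m21 p E * f 0 + d * g 0" if "ode_sol h {0..} f g" for f g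
    using ode_sol_expansion[OF h(1) that is_interval_ci, of 1] d
    by (simp_all add: h_def m11_def m12_def m21_def m22_def)
  have cont: "continuous_on {0..} (\<lambda>x. f x * f x)" if "ode_sol h {0..} f g" for f g
    using ode_sol_continuous_half_line[OF that] by (intro continuous_intros)
  show ?thesis
  proof
    assume ?R
    \<comment> \<open>The right side of the equivalence says that the initial vector is an
      eigenvector for d - k.\<close>
    then have "y 1 = (d - k) * y 0" "z 1 = (d - k) * z 0"
      using step[OF y] by (simp_all add: algebra_simps)
    from floquet_multiplier[OF h y this]
    have "y (x + 1) * y (x + 1) = (d - k)\<^sup>2 * (y x * y x)" if "x \<ge> 0" for x
      using that by (simp add: power2_eq_square)
    moreover have "(d - k)\<^sup>2 < 1" using dk' by (simp add: abs_square_less_1)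
    ultimately show ?L
      using bounded_integral_of_contraction[OF cont[OF y], of "(d - k)\<^sup>2"] by auto
  next
    assume ?L
    then obtain B where B: "\<And>n. integral {0..real n} (\<lambda>x. y x * y x) \<le> B" by blast
    define f where "f = (\<lambda>x. y (x + 1) - (d - k) * y x)"
    define g where "g = (\<lambda>x. z (x + 1) - (d - k) * z x)"
    have fg: "ode_sol h {0..} f g"
      unfolding f_def g_def using ode_sol_lincomb[OF ode_sol_shift_periodic[OF y h(2)] y, of 1 "- (d - k)"]
      by (simp only: mult_1_left mult_minus_left add_uminus_conv_diff)
    have fg0: "f 0 = k * y 0 + m12 p E * z 0" "g 0 = m21 p E * y 0 + k * z 0"
      using step[OF y] by (simp_all add: f_def g_def algebra_simps)
    \<comment> \<open>Because m12 * m21 = k^2, the initial vector of \<open>f\<close> is an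
      eigenvector for d + k (or zero), whatever \<open>y\<close> is.\<close>
    have "m12 p E * g 0 = k * f 0" "m21 p E * f 0 = k * g 0"
      unfolding fg0 distrib_left using mm by (simp_all add: algebra_simps)
    then have "f 1 = (d + k) * f 0" "g 1 = (d + k) * g 0"
      using step[OF fg] by (simp_all add: algebra_simps)
    from floquet_multiplier[OF h fg this]
    have ff: "f (x + 1) * f (x + 1) = (d + k)\<^sup>2 * (f x * f x)" if "x \<ge> 0" for x
      using that by (simp add: power2_eq_square)
    have ge: "1 \<le> (d + k)\<^sup>2" using dk abs_square_less_1[of "d + k"] by linarith
    \<comment> \<open>From (a - b)^2 <= 2 * a^2 + 2 * b^2 and |d - k| < 1: two integrals of y^2, the
      shifted one over part of [0, n + 1], each at most \<open>B\<close>.\<close>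
    have bd: "integral {0..real n} (\<lambda>x. f x * f x) \<le> 4 * \<bar>B\<bar>" for n
    proof -
      have int: "(\<lambda>x. f x * f x) integrable_on {0..t}" if "ode_sol h {0..} f g" for f g t
        by (rule integrable_continuous_real[OF continuous_on_subset[OF cont[OF that]]]) auto
      note iy = int[OF y] and iy1 = int[OF ode_sol_shift_periodic[OF y h(2)]]
      have "((\<lambda>x. 2 * (y (x + 1) * y (x + 1)) + 2 * (y x * y x)) has_integral
          2 * integral {0..real n} (\<lambda>x. y (x + 1) * y (x + 1)) + 2 * integral {0..real n} (\<lambda>x. y x * y x)) {0..real n}"
        using iy iy1 by (intro has_integral_add has_integral_mult_right) (auto simp: has_integral_iff)
      with integrable_integral[OF int[OF fg, of "real n"]]
      have "integral {0..real n} (\<lambda>x. f x * f x) \<le>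
          2 * integral {0..real n} (\<lambda>x. y (x + 1) * y (x + 1)) + 2 * integral {0..real n} (\<lambda>x. y x * y x)"
      proof (rule has_integral_le)
        fix x
        have "((d - k) * y x)\<^sup>2 \<le> 1 * (y x)\<^sup>2"
          unfolding power_mult_distrib using dk' by (intro mult_right_mono) (auto simp: abs_square_le_1)
        moreover have "(y (x + 1) - (d - k) * y x)\<^sup>2 + (y (x + 1) + (d - k) * y x)\<^sup>2
            = 2 * (y (x + 1))\<^sup>2 + 2 * ((d - k) * y x)\<^sup>2" by (simp add: power2_eq_square algebra_simps)
        ultimately have "(y (x + 1) - (d - k) * y x)\<^sup>2 \<le> 2 * (y (x + 1))\<^sup>2 + 2 * (y x)\<^sup>2"
          by (smt (verit) zero_le_power2)
        then show "f x * f x \<le> 2 * (y (x + 1) * y (x + 1)) + 2 * (y x * y x)"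
          by (simp add: f_def power2_eq_square)
      qed
      moreover have "integral {0..real n} (\<lambda>x. y (x + 1) * y (x + 1)) = integral {1..real n + 1} (\<lambda>x. y x * y x)"
        using integral_shift_real_ivl[where a = 1 and b = "real n + 1" and c = 1 and f = "\<lambda>x. y x * y x"] by simp
      moreover have "\<dots> \<le> integral {0..real (Suc n)} (\<lambda>x. y x * y x)"
        by (intro integral_subset_le integrable_on_subinterval[OF iy[of "real (Suc n)"]]) auto
      ultimately show ?thesis using B[of n] B[of "Suc n"] by linarith
    qed
    \<comment> \<open>A square integrable solution that grows by |d + k| > 1 in each period must
      vanish, and f 0 = g 0 = 0 is the claimed relation.\<close>
    have 0: "integral {0..1} (\<lambda>x. f x * f x) = 0"
      using integral_zero_of_expansion[OF cont[OF fg] _ ff ge bd] by simp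
    have "ode_sol h {0..1} f g" by (rule ode_sol_subset[OF fg]) auto
    from integral_square_pos[OF this] 0 have "f 0 = 0" "g 0 = 0" by auto
    then show ?R using fg0 by simp
  qed
qed

section \<open>Eigenvalues of the junction\<close>

lemma integrable_UNIV_iff_bounded_integrals:
  fixes w :: "real \<Rightarrow> real"
  assumes "continuous_on UNIV w" "\<And>x. w x \<ge> 0"
  shows "integrable lebesgue w \<longleftrightarrow> (\<exists>B. \<forall>n. integral {- real n..real n} w \<le> B)"
proof
  have int: "w integrable_on {a..b}" for a b
    by (rule integrable_continuous_real[OF continuous_on_subset[OF assms(1)]]) simp
  {
    assume "integrable lebesgue w"
    then have "w integrable_on UNIV" by (rule integrable_on_lebesgue)
    then have "integral {- real n..real n} w \<le> integral UNIV w" for n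
      using int assms(2) by (intro integral_subset_le) auto
    then show "\<exists>B. \<forall>n. integral {- real n..real n} w \<le> B" by blast
  next
    assume "\<exists>B. \<forall>n. integral {- real n..real n} w \<le> B"
    then obtain B where B: "\<And>n. integral {- real n..real n} w \<le> B" by blast
    define f where "f = (\<lambda>n x. if x \<in> {- real n..real n} then w x else 0)"
    have fi: "f n integrable_on UNIV" and fI: "integral UNIV (f n) = integral {- real n..real n} w" for n
      unfolding f_def using int by (simp_all only: integrable_restrict_UNIV integral_restrict_UNIV)
    have "w integrable_on UNIV \<and> (\<lambda>n. integral UNIV (f n)) \<longlonglongrightarrow> integral UNIV w"
    proof (rule monotone_convergence_increasing[OF fi])
      show "f n x \<le> f (Suc n) x" for n x using assms(2)[of x] by (auto simp: f_def)
      show "(\<lambda>n. f n x) \<longlonglongrightarrow> w x" for x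
      proof (rule tendsto_eventually)
        obtain N where "real N \<ge> \<bar>x\<bar>" using real_arch_simple by blast
        then show "\<forall>\<^sub>F n in sequentially. f n x = w x"
          unfolding eventually_sequentially f_def by (intro exI[of _ N]) auto
      qed
      have "0 \<le> integral {- real n..real n} w" for n using int assms(2) by (intro integral_nonneg) auto
      then have "\<bar>integral {- real n..real n} w\<bar> \<le> B" for n using B[of n] by simp
      then show "bounded (range (\<lambda>n. integral UNIV (f n)))"
        unfolding fI by (intro boundedI[of _ B]) auto
    qed
    then have "w absolutely_integrable_on UNIV"
      using assms(2) by (intro nonnegative_absolutely_integrable_1) auto
    then show "integrable lebesgue w" by (simp add: set_integrable_def)
  }
qed

lemma ode_sol_nontrivial:
  assumes "ode_sol h UNIV y z" "y 0 \<noteq> 0 \<or> z 0 \<noteq> 0"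
  shows "\<exists>x. y x \<noteq> 0"
  using ode_sol_vanishing[OF ode_sol_subset[OF assms(1)]] assms(2) by (metis subset_UNIV)

lemma continuous_AE_zero:
  fixes y :: "real \<Rightarrow> 'a::real_normed_vector"
  assumes "continuous_on UNIV y" "AE x in lebesgue. y x = 0"
  shows "y x = 0"
proof (rule ccontr)
  assume "y x \<noteq> 0"
  obtain N where N: "negligible N" "{x. y x \<noteq> 0} \<subseteq> N"
    using assms(2) unfolding eventually_ae_filter_negligible by blast
  have "open {x. y x \<noteq> 0}"
    using assms(1) by (intro open_Collect_neq) auto
  then show False
    using open_not_negligible[of "{x. y x \<noteq> 0}"] negligible_subset[OF N] \<open>y x \<noteq> 0\<close> by blast
qed

lemma continuous_imp_borel_lebesgue:
  fixes f :: "real \<Rightarrow> 'a::real_normed_vector"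
  shows "continuous_on UNIV f \<Longrightarrow> f \<in> borel_measurable lebesgue"
  by (intro measurable_completion) (simp add: borel_measurable_continuous_onI)

lemma L2_continuous_iff:
  assumes "continuous_on UNIV f"
  shows "f \<in> L2 \<longleftrightarrow> (\<exists>B. \<forall>n. integral {- real n..real n} (\<lambda>x. (cmod (f x))\<^sup>2) \<le> B)"
proof -
  have "continuous_on UNIV (\<lambda>x. (cmod (f x))\<^sup>2)" using assms by (intro continuous_intros)
  from integrable_UNIV_iff_bounded_integrals[OF this] show ?thesis
    using continuous_imp_borel_lebesgue[OF assms] by (simp add: L2_def)
qed

lemma schrodinger_op_of_solution:
  assumes 1: "ode_sol (\<lambda>x. q x - E) UNIV y z" and L2: "(\<lambda>x. complex_of_real (y x)) \<in> L2"
  shows "schrodinger_op q (\<lambda>x. complex_of_real (y x)) (\<lambda>x. complex_of_real E * complex_of_real (y x))"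
  unfolding schrodinger_op_def
proof (intro conjI exI)
  let ?y = "\<lambda>x. complex_of_real (y x)"
  show "?y \<in> L2" by (rule L2)
  show "(\<lambda>x. complex_of_real E * ?y x) \<in> L2"
    using L2 by (auto simp: L2_def norm_mult power_mult_distrib)
  have ac: "ac_deriv UNIV y z" "ac_deriv UNIV z (\<lambda>x. (q x - E) * y x)" using 1 by (auto simp: ode_sol_def)
  show "AC_deriv_on UNIV ?y (\<lambda>x. complex_of_real (z x))"
    unfolding AC_deriv_on_iff by (rule ac_deriv_linear[OF ac(1) bounded_linear_of_real])
  show "AC_deriv_on UNIV (\<lambda>x. complex_of_real (z x)) (\<lambda>x. complex_of_real ((q x - E) * y x))"
    unfolding AC_deriv_on_iff by (rule ac_deriv_linear[OF ac(2) bounded_linear_of_real])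
  show "AE x in lebesgue. complex_of_real E * ?y x = - complex_of_real ((q x - E) * y x) + complex_of_real (q x) * ?y x"
    by (simp add: algebra_simps)
qed

text \<open>A real-linear functional commutes with the real coefficient \<open>h\<close>, so a
  complex solution yields real ones; \<open>L\<close> will be \<open>Re\<close> or
  \<open>Im\<close>.\<close>

lemma ode_sol_of_complex:
  fixes f :: "real \<Rightarrow> complex" and L :: "complex \<Rightarrow> real"
  assumes f: "ac_deriv S f f'" "ac_deriv S f' f''" and S: "is_interval S" and N: "negligible N"
    and eq: "\<And>x. x \<in> S - N \<Longrightarrow> f'' x = complex_of_real (h x) * f x" and L: "bounded_linear L"
  shows "ode_sol h S (\<lambda>x. L (f x)) (\<lambda>x. L (f' x))"
  unfolding ode_sol_def
proof
  show "ac_deriv S (\<lambda>x. L (f x)) (\<lambda>x. L (f' x))" by (rule ac_deriv_linear[OF f(1) L])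
  have "L (complex_of_real r * w) = r * L w" for r w
    using linear_scale[OF bounded_linear.linear[OF L], of r w] by (simp add: scaleR_conv_of_real)
  then show "ac_deriv S (\<lambda>x. L (f' x)) (\<lambda>x. h x * L (f x))"
    by (intro ac_deriv_AE_cong[OF ac_deriv_linear[OF f(2) L] N _ S]) (simp add: eq)
qed

text \<open>Translates the operator notion into a real solution and integrals over integer windows,
  the form in which the recursion over periods delivers its bounds.\<close>

lemma eigenvalue_iff:
  assumes q: "locally_integrable q"
  shows "eigenvalue q E \<longleftrightarrow> (\<exists>y z. ode_sol (\<lambda>x. q x - E) UNIV y z \<and> (y 0 \<noteq> 0 \<or> z 0 \<noteq> 0) \<and>
    (\<exists>B. \<forall>n. integral {- real n..real n} (\<lambda>x. y x * y x) \<le> B))" (is "_ \<longleftrightarrow> ?R")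
proof
  assume ?R
  then obtain y z where yz: "ode_sol (\<lambda>x. q x - E) UNIV y z" "y 0 \<noteq> 0 \<or> z 0 \<noteq> 0"
    and B: "\<exists>B. \<forall>n. integral {- real n..real n} (\<lambda>x. y x * y x) \<le> B" by blast
  let ?y = "\<lambda>x. complex_of_real (y x)"
  have c: "continuous_on UNIV ?y" using ode_sol_continuous_UNIV[OF yz(1)] by (intro continuous_intros)
  have "?y \<in> L2" unfolding L2_continuous_iff[OF c] using B by (simp add: power2_eq_square)
  note op = schrodinger_op_of_solution[OF yz(1) this]
  have "\<not> (AE x in lebesgue. ?y x = 0)"
    using continuous_AE_zero[OF c] ode_sol_nontrivial[OF yz] by (metis of_real_eq_0_iff)
  then show "eigenvalue q E" unfolding eigenvalue_def using op by (intro exI conjI) auto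
next
  assume "eigenvalue q E"
  then obtain f g where fg: "schrodinger_op q f g" and nz: "\<not> (AE x in lebesgue. f x = 0)"
    and ev: "AE x in lebesgue. g x = complex_of_real E * f x"
    unfolding eigenvalue_def by blast
  then obtain f' f'' where ac: "ac_deriv UNIV f f'" "ac_deriv UNIV f' f''"
    and g: "AE x in lebesgue. g x = - f'' x + complex_of_real (q x) * f x" and L2: "f \<in> L2"
    unfolding schrodinger_op_def AC_deriv_on_iff by blast
  have "AE x in lebesgue. f'' x = complex_of_real (q x - E) * f x"
    using ev g by eventually_elim (simp add: algebra_simps)
  then obtain N where N: "negligible N" "{x. f'' x \<noteq> complex_of_real (q x - E) * f x} \<subseteq> N"
    unfolding eventually_ae_filter_negligible by blast
  have sol: "ode_sol (\<lambda>x. q x - E) UNIV (\<lambda>x. L (f x)) (\<lambda>x. L (f' x))" if "bounded_linear L" for L :: "complex \<Rightarrow> real"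
    by (rule ode_sol_of_complex[OF ac is_interval_univ N(1) _ that]) (use N(2) in auto)
  obtain x where "f x \<noteq> 0" using nz by fastforce
  then have "Re (f x) \<noteq> 0 \<or> Im (f x) \<noteq> 0" by (simp add: complex_eq_iff)
  \<comment> \<open>Whichever of \<open>Re\<close> and \<open>Im\<close> does not vanish at this
    point; the bound by \<open>cmod\<close> preserves square integrability.\<close>
  then obtain L where L: "bounded_linear L" "L (f x) \<noteq> 0" "\<And>w. \<bar>L w\<bar> \<le> cmod w"
    using bounded_linear_Re bounded_linear_Im abs_Re_le_cmod abs_Im_le_cmod by metis
  note y = sol[OF L(1)]
  have "L (f 0) \<noteq> 0 \<or> L (f' 0) \<noteq> 0"
    using ode_sol_expansion[OF locally_integrable_shift_energy[OF q] y is_interval_univ, of x] L(2) by auto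
  moreover have "\<exists>B. \<forall>n. integral {- real n..real n} (\<lambda>x. L (f x) * L (f x)) \<le> B"
  proof -
    have c: "continuous_on A f" for A by (rule ac_deriv_continuous_UNIV[OF ac(1)])
    obtain B where B: "\<And>n. integral {- real n..real n} (\<lambda>x. (cmod (f x))\<^sup>2) \<le> B"
      using L2 unfolding L2_continuous_iff[OF c] by blast
    have "integral {- real n..real n} (\<lambda>x. L (f x) * L (f x)) \<le> integral {- real n..real n} (\<lambda>x. (cmod (f x))\<^sup>2)" for n
    proof (rule integral_le)
      show "(\<lambda>x. L (f x) * L (f x)) integrable_on {- real n..real n}"
        using ode_sol_continuous_UNIV[OF y] by (intro integrable_continuous_real continuous_intros)
      show "(\<lambda>x. (cmod (f x))\<^sup>2) integrable_on {- real n..real n}"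
        using c by (intro integrable_continuous_real continuous_intros)
      show "L (f x) * L (f x) \<le> (cmod (f x))\<^sup>2" for x
        using power_mono[OF L(3)[of "f x"], of 2] by (simp add: power2_eq_square)
    qed
    then show ?thesis using B by (meson order_trans)
  qed
  ultimately show ?R using y by blast
qed

text \<open>The functions u and v of the overview. Numerator and denominator come from the same
  column, so each quotient involves a single solution and its Wronskian at two energies; for even
  \<open>p\<close> the two denominators agree.\<close>

definition "ratio12 p E = m12 p E / m22 p E"
definition "ratio21 p E = m21 p E / m11 p E"

lemma ratio_product:
  assumes p: "p \<in> L1_even" and d: "m11 p E \<noteq> 0"
  shows "ratio12 p E * ratio21 p E = 1 - 1 / (m11 p E)\<^sup>2"
proof -
  have "m12 p E * m21 p E = (m11 p E)\<^sup>2 - 1"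
    using m_det[OF L1_even_locally_integrable[OF p], of E] L1_even_m11_eq_m22[OF p, of E]
    by (simp add: power2_eq_square algebra_simps)
  then have "ratio12 p E * ratio21 p E = ((m11 p E)\<^sup>2 - 1) / (m11 p E)\<^sup>2"
    using L1_even_m11_eq_m22[OF p, of E] by (simp add: ratio12_def ratio21_def power2_eq_square)
  then show ?thesis using d by (simp add: diff_divide_distrib)
qed

text \<open>Dividing the eigenvector relations by the discriminant d turns k into k / d = sqrt (u
  v), positive for either sign of d.\<close>

lemma half_line_condition:
  assumes p: "p \<in> L1_even" and d: "\<bar>m11 p E\<bar> > 1" and y: "ode_sol (\<lambda>x. p x - E) {0..} y z"
  shows "(\<exists>B. \<forall>n. integral {0..real n} (\<lambda>x. y x * y x) \<le> B) \<longleftrightarrow>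
    ratio12 p E * z 0 = - sqrt (ratio12 p E * ratio21 p E) * y 0 \<and>
    ratio21 p E * y 0 = - sqrt (ratio12 p E * ratio21 p E) * z 0"
proof -
  define d where "d = m11 p E"
  have dd: "m11 p E = d" "m22 p E = d" "\<bar>d\<bar> > 1" using d L1_even_m11_eq_m22[OF p] by (simp_all add: d_def)
  then have d0: "d \<noteq> 0" by auto
  define k where "k = sgn d * sqrt (d\<^sup>2 - 1)"
  have "sqrt (ratio12 p E * ratio21 p E) = sqrt ((d\<^sup>2 - 1) / d\<^sup>2)"
    using ratio_product[OF p, of E] d0 dd by (simp add: diff_divide_distrib)
  also have "\<dots> = k / d" unfolding k_def by (simp add: real_sqrt_divide sgn_if)
  finally have s: "sqrt (ratio12 p E * ratio21 p E) = k / d" .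
  show ?thesis
    unfolding square_integrable_half_line_iff[OF L1_even_locally_integrable[OF p] L1_evenD(1)[OF p] y dd k_def] s
    unfolding ratio12_def ratio21_def dd using d0 by (simp add: field_simps)
qed

lemma junction_locally_integrable:
  assumes "locally_integrable p1" "locally_integrable p2"
  shows "locally_integrable (junction p1 p2)"
  unfolding locally_integrable_def
proof (intro allI)
  fix a b :: real
  define R where "R = max \<bar>a\<bar> \<bar>b\<bar>"
  have "junction p1 p2 absolutely_integrable_on {- R..0}"
    by (rule absolutely_integrable_spike[where f = p1 and S = "{0}"])
       (use assms(1) in \<open>auto simp: locally_integrable_def junction_def\<close>)
  moreover have "junction p1 p2 absolutely_integrable_on {0..R}"
    by (rule absolutely_integrable_spike[where f = p2 and S = "{0}"])
       (use assms(2) in \<open>auto simp: locally_integrable_def junction_def\<close>)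
  ultimately have "junction p1 p2 absolutely_integrable_on {- R..R}"
    by (rule absolutely_integrable_on_combine) (auto simp: R_def)
  then show "junction p1 p2 absolutely_integrable_on {a..b}"
    by (rule absolutely_integrable_on_subinterval) (auto simp: R_def)
qed

text \<open>Evenness makes the reflected left half a solution for the same \<open>p1\<close> on the
  right half line, with the sign of the slope reversed. Both sides then fall under
  \<open>half_line_condition\<close>.\<close>

lemma junction_solution_halves:
  assumes p1: "p1 \<in> L1_even" and y: "ode_sol (\<lambda>x. junction p1 p2 x - E) UNIV y z"
  shows "ode_sol (\<lambda>x. p2 x - E) {0..} y z" "ode_sol (\<lambda>x. p1 x - E) {0..} (\<lambda>x. y (- x)) (\<lambda>x. - z (- x))"
proof -
  show "ode_sol (\<lambda>x. p2 x - E) {0..} y z"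
    by (rule ode_sol_cong[OF ode_sol_subset[OF y subset_UNIV]]) (auto simp: junction_def is_interval_ci)
  obtain N where N: "negligible N" "\<And>x. x \<notin> N \<Longrightarrow> p1 (- x) = p1 x" using L1_even_reflect[OF p1] by blast
  have "ode_sol (\<lambda>x. junction p1 p2 (- x) - E) {0..} (\<lambda>x. y (- x)) (\<lambda>x. - z (- x))"
    by (rule ode_sol_subset[OF ode_sol_reflect[OF y]]) auto
  then show "ode_sol (\<lambda>x. p1 x - E) {0..} (\<lambda>x. y (- x)) (\<lambda>x. - z (- x))"
  proof (rule ode_sol_AE_cong[OF _ is_interval_ci])
    \<comment> \<open>At 0 the junction takes the value of \<open>p2\<close>, so this point joins
      the null set.\<close>
    show "negligible (N \<union> {0})" using N(1) by (intro negligible_Un) auto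
  qed (use N(2) in \<open>auto simp: junction_def\<close>)
qed

lemma bounded_integrals_halves:
  fixes w :: "real \<Rightarrow> real"
  assumes "continuous_on UNIV w" "\<And>x. w x \<ge> 0"
  shows "(\<exists>B. \<forall>n. integral {- real n..real n} w \<le> B) \<longleftrightarrow>
    (\<exists>B. \<forall>n. integral {0..real n} w \<le> B) \<and> (\<exists>B. \<forall>n. integral {0..real n} (\<lambda>x. w (- x)) \<le> B)"
proof -
  have int: "w integrable_on {a..b}" for a b
    by (rule integrable_continuous_real[OF continuous_on_subset[OF assms(1)]]) simp
  have eq: "integral {- real n..real n} w = integral {0..real n} w + integral {0..real n} (\<lambda>x. w (- x))" for n
  proof -
    have "integral {- real n..0} w + integral {0..real n} w = integral {- real n..real n} w"
      using int by (intro Henstock_Kurzweil_Integration.integral_combine) auto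
    moreover have "integral {0..real n} (\<lambda>x. w (- x)) = integral {- real n..0} w"
      using Henstock_Kurzweil_Integration.integral_reflect_real[where f = w and a = "- real n" and b = 0] by simp
    ultimately show ?thesis by simp
  qed
  have pos: "integral {0..real n} w \<ge> 0" for n using int assms(2) by (intro integral_nonneg) auto
  have cn: "continuous_on UNIV (\<lambda>x. w (- x))"
    by (rule continuous_on_compose2[OF assms(1)]) (auto intro: continuous_intros)
  have "(\<lambda>x. w (- x)) integrable_on {0..real n}" for n
    by (rule integrable_continuous_real[OF continuous_on_subset[OF cn]]) simp
  then have pos': "integral {0..real n} (\<lambda>x. w (- x)) \<ge> 0" for n
    using assms(2) by (intro integral_nonneg) auto
  show ?thesis
  proof (intro iffI conjI)
    assume "\<exists>B. \<forall>n. integral {- real n..real n} w \<le> B"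
    then obtain B where B: "\<And>n. integral {0..real n} w + integral {0..real n} (\<lambda>x. w (- x)) \<le> B"
      unfolding eq by blast
    show "\<exists>B. \<forall>n. integral {0..real n} w \<le> B"
      using B pos' by (intro exI[of _ B] allI) (smt (verit))
    show "\<exists>B. \<forall>n. integral {0..real n} (\<lambda>x. w (- x)) \<le> B"
      using B pos by (intro exI[of _ B] allI) (smt (verit))
  next
    assume "(\<exists>B. \<forall>n. integral {0..real n} w \<le> B) \<and> (\<exists>B. \<forall>n. integral {0..real n} (\<lambda>x. w (- x)) \<le> B)"
    then obtain B C where "\<And>n. integral {0..real n} w \<le> B" "\<And>n. integral {0..real n} (\<lambda>x. w (- x)) \<le> C" by blast
    then show "\<exists>B. \<forall>n. integral {- real n..real n} w \<le> B"
      unfolding eq by (intro exI[of _ "B + C"] allI add_mono)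
  qed
qed

text \<open>Write k for sqrt (u v). Decay to the right means z 0 / y 0 = - k2 / u2, decay to the
  left z 0 / y 0 = k1 / u1. One nonzero vector satisfies both iff k1 / u1 = - k2 / u2; as k^2 = u v,
  this splits into the sign condition and v1 / u1 = v2 / u2.\<close>

lemma junction_eigenvalue_iff:
  assumes p: "p1 \<in> L1_even" "p2 \<in> L1_even" and d: "\<bar>m11 p1 E\<bar> > 1" "\<bar>m11 p2 E\<bar> > 1"
  shows "eigenvalue (junction p1 p2) E \<longleftrightarrow>
    ratio12 p1 E * ratio12 p2 E < 0 \<and> ratio21 p1 E * ratio12 p2 E = ratio21 p2 E * ratio12 p1 E"
proof -
  define u1 u2 v1 v2 where uv: "u1 = ratio12 p1 E" "u2 = ratio12 p2 E" "v1 = ratio21 p1 E" "v2 = ratio21 p2 E"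
  define k1 k2 where k: "k1 = sqrt (u1 * v1)" "k2 = sqrt (u2 * v2)"
  have pos: "u1 * v1 > 0" "u2 * v2 > 0"
  proof -
    have "1 - 1 / x\<^sup>2 > 0" if "\<bar>x\<bar> > 1" for x :: real
      using that by (simp add: abs_square_less_1 flip: ) (metis abs_ge_zero abs_one abs_square_le_1 linorder_not_le)
    then show "u1 * v1 > 0" "u2 * v2 > 0"
      unfolding uv using ratio_product[OF p(1), of E] ratio_product[OF p(2), of E] d by force+
  qed
  have k0: "k1 > 0" "k2 > 0" "k1 * k1 = u1 * v1" "k2 * k2 = u2 * v2" using pos by (auto simp: k)
  have loc: "locally_integrable (junction p1 p2)"
    using p by (intro junction_locally_integrable L1_even_locally_integrable)
  have bd: "(\<exists>B. \<forall>n. integral {- real n..real n} (\<lambda>x. y x * y x) \<le> B) \<longleftrightarrow>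
      (u2 * z 0 = - k2 * y 0 \<and> v2 * y 0 = - k2 * z 0) \<and> (u1 * z 0 = k1 * y 0 \<and> v1 * y 0 = k1 * z 0)"
    if y: "ode_sol (\<lambda>x. junction p1 p2 x - E) UNIV y z" for y z
  proof -
    have "continuous_on UNIV (\<lambda>x. y x * y x)" using ode_sol_continuous_UNIV[OF y] by (intro continuous_intros)
    from bounded_integrals_halves[OF this] show ?thesis
      using half_line_condition[OF p(2) d(2) junction_solution_halves(1)[OF p(1) y]]
        half_line_condition[OF p(1) d(1) junction_solution_halves(2)[OF p(1) y]]
      unfolding uv[symmetric] k[symmetric] by simp
  qed
  show ?thesis unfolding uv[symmetric]
  proof
    assume "eigenvalue (junction p1 p2) E"
    then obtain y z where yz: "ode_sol (\<lambda>x. junction p1 p2 x - E) UNIV y z" "y 0 \<noteq> 0 \<or> z 0 \<noteq> 0"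
      and B: "\<exists>B. \<forall>n. integral {- real n..real n} (\<lambda>x. y x * y x) \<le> B"
      unfolding eigenvalue_iff[OF loc] by blast
    define a b where ab: "a = y 0" "b = z 0"
    have eqs: "u2 * b = - k2 * a" "v2 * a = - k2 * b" "u1 * b = k1 * a" "v1 * a = k1 * b"
      using B unfolding bd[OF yz(1)] ab by auto
    have a: "a \<noteq> 0" and b: "b \<noteq> 0" using eqs yz(2) k0 ab by auto
    have s: "u2 = - k2 * a / b" "v2 = - k2 * b / a" "u1 = k1 * a / b" "v1 = k1 * b / a"
      using eqs a b by (simp_all add: field_simps)
    have "u1 * u2 = - (k1 * k2 * (a / b)\<^sup>2)" unfolding s by (simp add: power2_eq_square)
    moreover have "k1 * k2 * (a / b)\<^sup>2 > 0" using k0 a b by simp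
    moreover have "v1 * u2 = v2 * u1" unfolding s using a b by (simp add: field_simps)
    ultimately show "u1 * u2 < 0 \<and> v1 * u2 = v2 * u1" by simp
  next
    assume *: "u1 * u2 < 0 \<and> v1 * u2 = v2 * u1"
    then have u: "u1 \<noteq> 0" "u2 \<noteq> 0" by auto
    \<comment> \<open>Slope of the solution with value 1 at 0 that decays to the left; it remains to
      see that it decays to the right as well.\<close>
    define b where "b = k1 / u1"
    have eq1: "u1 * b = k1 * 1" "v1 * 1 = k1 * b" using u k0 by (simp_all add: b_def field_simps)
    have "v1 / u1 = v2 / u2" using * u by (simp add: field_simps)
    moreover have "v1 / u1 = (k1 / u1)\<^sup>2" "v2 / u2 = (k2 / u2)\<^sup>2"
      using k0 u by (simp_all add: power2_eq_square field_simps)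
    ultimately have "(k1 / u1)\<^sup>2 = (k2 / u2)\<^sup>2" by simp
    \<comment> \<open>Equal squares leave a sign open, which the opposite signs of \<open>u1\<close>
      and \<open>u2\<close> settle.\<close>
    then have "k1 / u1 = k2 / u2 \<or> k1 / u1 = - (k2 / u2)" by (simp add: power2_eq_iff)
    moreover have "(k1 / u1) * (k2 / u2) < 0"
      using * k0 by (simp add: mult_less_0_iff zero_less_mult_iff divide_less_0_iff zero_less_divide_iff)
    then have "k1 / u1 \<noteq> k2 / u2" by (metis not_square_less_zero)
    ultimately have b2: "b = - k2 / u2" by (simp add: b_def)
    have eq2: "u2 * b = - k2 * 1" "v2 * 1 = - k2 * b" using u k0 by (simp_all add: b2 field_simps)
    obtain y z where yz: "ode_sol (\<lambda>x. junction p1 p2 x - E) UNIV y z" "y 0 = 1" "z 0 = b"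
      using solution_exists[OF locally_integrable_shift_energy[OF loc]] by metis
    have "\<exists>B. \<forall>n. integral {- real n..real n} (\<lambda>x. y x * y x) \<le> B"
      unfolding bd[OF yz(1)] using eq1 eq2 yz by simp
    then show "eigenvalue (junction p1 p2) E"
      unfolding eigenvalue_iff[OF loc] using yz by (intro exI[of _ y] exI[of _ z]) auto
  qed
qed

section \<open>Energies in the Hill spectrum\<close>

text \<open>A cubic step is smooth enough: it is continuously differentiable with a bounded second
  derivative off two points, and the domain only asks f' to be locally absolutely
  continuous.\<close>

definition smooth_step :: "real \<Rightarrow> real" where
  "smooth_step x = (let t = max 0 (min 1 x) in 3 * t\<^sup>2 - 2 * t ^ 3)"

text \<open>Clamping the argument gives the correct derivative outside [0, 1] because 6 * t - 6 *
  t^2 vanishes at both ends.\<close>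

definition smooth_step' :: "real \<Rightarrow> real" where
  "smooth_step' x = (let t = max 0 (min 1 x) in 6 * t - 6 * t\<^sup>2)"

definition smooth_step'' :: "real \<Rightarrow> real" where
  "smooth_step'' x = (if 0 < x \<and> x < 1 then 6 - 12 * x else 0)"

lemma ac_deriv_of_has_derivative:
  fixes f f' :: "real \<Rightarrow> real"
  assumes "finite S" "continuous_on UNIV f" "\<And>x. x \<notin> S \<Longrightarrow> (f has_real_derivative f' x) (at x)"
    and "\<And>x. \<bar>f' x\<bar> \<le> B"
  shows "ac_deriv UNIV f f'"
proof -
  have hi: "(f' has_integral (f b - f a)) {a..b}" if "a \<le> b" for a b
  proof (rule fundamental_theorem_of_calculus_interior_strong[OF assms(1) that])
    show "(f has_vector_derivative f' x) (at x)" if "x \<in> {a<..<b} - S" for x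
      using assms(3)[of x] that by (simp add: has_real_derivative_iff_has_vector_derivative)
    show "continuous_on {a..b} f" using assms(2) by (rule continuous_on_subset) simp
  qed
  have "f' absolutely_integrable_on {a..b}" if "a \<le> b" for a b
    by (rule absolutely_integrable_integrable_bound[where g = "\<lambda>x. B"])
       (use assms(4) hi[OF that] in auto)
  then show ?thesis by (intro ac_derivI) (simp_all add: integral_unique[OF hi])
qed

lemma smooth_step_cases: "x \<le> 0 \<Longrightarrow> smooth_step x = 0" "x \<ge> 1 \<Longrightarrow> smooth_step x = 1"
  "0 \<le> x \<Longrightarrow> x \<le> 1 \<Longrightarrow> smooth_step x = 3 * x\<^sup>2 - 2 * x ^ 3"
  by (simp_all add: smooth_step_def)

lemma smooth_step'_cases: "x \<le> 0 \<Longrightarrow> smooth_step' x = 0" "x \<ge> 1 \<Longrightarrow> smooth_step' x = 0"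
  "0 \<le> x \<Longrightarrow> x \<le> 1 \<Longrightarrow> smooth_step' x = 6 * x - 6 * x\<^sup>2"
  by (simp_all add: smooth_step'_def)

lemma smooth_step''_bound: "\<bar>smooth_step'' x\<bar> \<le> 6"
  by (auto simp: smooth_step''_def)

lemma smooth_step'_bound: "\<bar>smooth_step' x\<bar> \<le> 6"
proof -
  have "\<bar>6 * t - 6 * t\<^sup>2\<bar> \<le> 6" if "0 \<le> t" "t \<le> 1" for t :: real
  proof -
    have "t\<^sup>2 \<le> t" using that by (simp add: power2_eq_square mult_left_le_one_le)
    then show ?thesis using that by (simp add: abs_if) (smt (verit) zero_le_power2)
  qed
  then show ?thesis by (simp add: smooth_step'_def Let_def)
qed

lemma ac_deriv_smooth_step: "ac_deriv UNIV smooth_step smooth_step'"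
proof (rule ac_deriv_of_has_derivative[of "{0, 1}"])
  show "continuous_on UNIV smooth_step"
    unfolding smooth_step_def Let_def by (intro continuous_intros)
  show "\<bar>smooth_step' x\<bar> \<le> 6" for x by (rule smooth_step'_bound)
  show "(smooth_step has_real_derivative smooth_step' x) (at x)" if "x \<notin> {0, 1}" for x
  proof -
    have "x \<noteq> 0" "x \<noteq> 1" using that by auto
    then consider "x < 0" | "x > 1" | "0 < x" "x < 1" by linarith
    then show ?thesis
    proof cases
      case 1
      have "((\<lambda>x. 0) has_real_derivative smooth_step' x) (at x)"
        using 1 by (simp add: smooth_step'_cases)
      then show ?thesis
        by (rule has_field_derivative_transform_within_open[of _ _ _ "{..<0}"]) (use 1 in \<open>auto simp: smooth_step_cases\<close>)
    next
      case 2
      have "((\<lambda>x. 1) has_real_derivative smooth_step' x) (at x)"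
        using 2 by (simp add: smooth_step'_cases)
      then show ?thesis
        by (rule has_field_derivative_transform_within_open[of _ _ _ "{1<..}"]) (use 2 in \<open>auto simp: smooth_step_cases\<close>)
    next
      case 3
      have "((\<lambda>x. 3 * x\<^sup>2 - 2 * x ^ 3) has_real_derivative smooth_step' x) (at x)"
        using 3 by (auto intro!: derivative_eq_intros simp: smooth_step'_cases)
      then show ?thesis
        by (rule has_field_derivative_transform_within_open[of _ _ _ "{0<..<1}"]) (use 3 in \<open>auto simp: smooth_step_cases\<close>)
    qed
  qed
qed simp

lemma ac_deriv_smooth_step': "ac_deriv UNIV smooth_step' smooth_step''"
proof (rule ac_deriv_of_has_derivative[of "{0, 1}"])
  show "continuous_on UNIV smooth_step'"
    unfolding smooth_step'_def Let_def by (intro continuous_intros)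
  show "\<bar>smooth_step'' x\<bar> \<le> 6" for x by (rule smooth_step''_bound)
  show "(smooth_step' has_real_derivative smooth_step'' x) (at x)" if "x \<notin> {0, 1}" for x
  proof -
    have "x \<noteq> 0" "x \<noteq> 1" using that by auto
    then consider "x < 0" | "x > 1" | "0 < x" "x < 1" by linarith
    then show ?thesis
    proof cases
      case 1
      have "((\<lambda>x. 0) has_real_derivative smooth_step'' x) (at x)"
        using 1 by (simp add: smooth_step''_def)
      then show ?thesis
        by (rule has_field_derivative_transform_within_open[of _ _ _ "{..<0}"]) (use 1 in \<open>auto simp: smooth_step'_cases\<close>)
    next
      case 2
      have "((\<lambda>x. 0) has_real_derivative smooth_step'' x) (at x)"
        using 2 by (simp add: smooth_step''_def)
      then show ?thesis
        by (rule has_field_derivative_transform_within_open[of _ _ _ "{1<..}"]) (use 2 in \<open>auto simp: smooth_step'_cases\<close>)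
    next
      case 3
      have "((\<lambda>x. 6 * x - 6 * x\<^sup>2) has_real_derivative smooth_step'' x) (at x)"
        using 3 by (auto intro!: derivative_eq_intros simp: smooth_step''_def)
      then show ?thesis
        by (rule has_field_derivative_transform_within_open[of _ _ _ "{0<..<1}"]) (use 3 in \<open>auto simp: smooth_step'_cases\<close>)
    qed
  qed
qed simp

section \<open>Bounded Bloch solutions\<close>

lemma fundamental_shift:
  fixes p :: "real \<Rightarrow> real" and E :: real
  assumes p: "locally_integrable p" and per: "\<And>x. p (x + 1) = p x"
  defines "h \<equiv> \<lambda>x. p x - E"
  shows "cos_sol h (x + 1) = m11 p E * cos_sol h x + m21 p E * sin_sol h x"
    "sin_sol h (x + 1) = m12 p E * cos_sol h x + m22 p E * sin_sol h x"
    "cos_sol' h (x + 1) = m11 p E * cos_sol' h x + m21 p E * sin_sol' h x"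
    "sin_sol' h (x + 1) = m12 p E * cos_sol' h x + m22 p E * sin_sol' h x"
proof -
  have loc: "locally_integrable h" unfolding h_def by (rule locally_integrable_shift_energy[OF p])
  have hp: "h (x + 1) = h x" for x by (simp add: h_def per)
  have "ode_sol h UNIV (\<lambda>x. cos_sol h (x + 1)) (\<lambda>x. cos_sol' h (x + 1))"
    "ode_sol h UNIV (\<lambda>x. sin_sol h (x + 1)) (\<lambda>x. sin_sol' h (x + 1))"
    using ode_sol_shift[OF cos_sol(1)[OF loc], of 1] ode_sol_shift[OF sin_sol(1)[OF loc], of 1] by (simp_all add: hp)
  from ode_sol_expansion[OF loc this(1) is_interval_univ] ode_sol_expansion[OF loc this(2) is_interval_univ]
  show "cos_sol h (x + 1) = m11 p E * cos_sol h x + m21 p E * sin_sol h x"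
    "sin_sol h (x + 1) = m12 p E * cos_sol h x + m22 p E * sin_sol h x"
    "cos_sol' h (x + 1) = m11 p E * cos_sol' h x + m21 p E * sin_sol' h x"
    "sin_sol' h (x + 1) = m12 p E * cos_sol' h x + m22 p E * sin_sol' h x"
    by (simp_all add: m11_def m12_def m21_def m22_def h_def)
qed

lemma periodic_bounded:
  fixes f :: "real \<Rightarrow> real"
  assumes "continuous_on {0..1} f" "\<And>x. f (x + 1) = f x"
  obtains B where "\<And>x. f x \<le> B"
proof -
  have "\<exists>b\<in>{0..1}. \<forall>x\<in>{0..1}. f x \<le> f b"
    by (rule continuous_attains_sup[OF _ _ assms(1)]) auto
  then obtain B where B: "\<And>x. x \<in> {0..1} \<Longrightarrow> f x \<le> B" by blast
  have "f x \<le> B" for x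
  proof -
    have "f x = f (frac x)"
      using periodic_int_shift[of f, OF assms(2), of "frac x" "\<lfloor>x\<rfloor>"] by (simp add: frac_def)
    then show ?thesis using B[of "frac x"] frac_lt_1[of x] frac_ge_0[of x] by simp
  qed
  then show ?thesis by (rule that)
qed

text \<open>A discriminant of modulus at most 1 gives the monodromy matrix an eigenvector with
  multiplier of modulus 1. Along it |y| and |z| are 1-periodic, hence bounded, and every period
  carries the same mass \<open>c\<close>. The multiplier may be non-real, hence the complex
  coefficients.\<close>

lemma bloch_solution:
  assumes p: "p \<in> L1_even" and d: "\<bar>m11 p E\<bar> \<le> 1"
  obtains y z :: "real \<Rightarrow> complex" and B c
  where "ac_deriv UNIV y z" "ac_deriv UNIV z (\<lambda>x. complex_of_real (p x - E) * y x)"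
    "\<And>x. cmod (y x) \<le> B" "\<And>x. cmod (z x) \<le> B" "c > 0"
    "\<And>n. integral {0..real n} (\<lambda>x. (cmod (y x))\<^sup>2) = real n * c"
proof -
  have loc: "locally_integrable p" by (rule L1_even_locally_integrable[OF p])
  define h where "h = (\<lambda>x. p x - E)"
  have hloc: "locally_integrable h" unfolding h_def by (rule locally_integrable_shift_energy[OF loc])
  define \<Delta> where "\<Delta> = m11 p E"
  have m: "m11 p E = \<Delta>" "m22 p E = \<Delta>" using L1_even_m11_eq_m22[OF p] by (simp_all add: \<Delta>_def)
  have det: "m12 p E * m21 p E = \<Delta>\<^sup>2 - 1" using m_det[OF loc, of E] m by (simp add: power2_eq_square algebra_simps)
  have \<Delta>1: "\<Delta>\<^sup>2 \<le> 1" using d by (simp add: \<Delta>_def abs_square_le_1)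
  have "\<exists>a b \<rho>. cmod \<rho> = 1 \<and> (a \<noteq> 0 \<or> b \<noteq> 0) \<and>
      complex_of_real \<Delta> * a + complex_of_real (m12 p E) * b = \<rho> * a \<and>
      complex_of_real (m21 p E) * a + complex_of_real \<Delta> * b = \<rho> * b"
  proof (cases "m12 p E = 0")
    case True
    \<comment> \<open>The matrix is then triangular, and the second basis vector is an eigenvector
      with multiplier \<Delta> = 1 or \<Delta> = -1.\<close>
    then have "\<Delta>\<^sup>2 = 1" using det by simp
    then have "\<bar>\<Delta>\<bar> = 1" by (auto simp: power2_eq_1_iff)
    then show ?thesis using True
      by (intro exI[of _ 0] exI[of _ 1] exI[of _ "complex_of_real \<Delta>"]) simp
  next
    case False
    \<comment> \<open>With w = i * s the multiplier is \<Delta> + w and the eigenvector (m12, w):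
      the second component fits because w^2 = m12 * m21 by the determinant.\<close>
    define s where "s = sqrt (1 - \<Delta>\<^sup>2)"
    have ss: "s * s = 1 - \<Delta>\<^sup>2" using \<Delta>1 by (simp add: s_def)
    define w where "w = \<i> * complex_of_real s"
    have "w * w = \<i> * \<i> * complex_of_real (s * s)" unfolding w_def of_real_mult by (simp only: mult_ac)
    also have "\<dots> = - complex_of_real (s * s)" by simp
    also have "\<dots> = complex_of_real (- (s * s))" by (simp only: of_real_minus)
    also have "- (s * s) = m21 p E * m12 p E" using ss det by (simp add: mult.commute)
    finally have ww: "w * w = complex_of_real (m21 p E * m12 p E)" .
    have "cmod (complex_of_real \<Delta> + w) = 1" using ss by (simp add: w_def cmod_def power2_eq_square)
    then show ?thesis
      using False ww by (intro exI[of _ "complex_of_real (m12 p E)"] exI[of _ w] exI[of _ "complex_of_real \<Delta> + w"])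
        (simp add: algebra_simps)
  qed
  then obtain a b \<rho> where \<rho>: "cmod \<rho> = 1" and ab: "a \<noteq> 0 \<or> b \<noteq> 0"
    and eig: "complex_of_real \<Delta> * a + complex_of_real (m12 p E) * b = \<rho> * a"
      "complex_of_real (m21 p E) * a + complex_of_real \<Delta> * b = \<rho> * b" by blast
  define y where "y = (\<lambda>x. a * complex_of_real (cos_sol h x) + b * complex_of_real (sin_sol h x))"
  define z where "z = (\<lambda>x. a * complex_of_real (cos_sol' h x) + b * complex_of_real (sin_sol' h x))"
  note cs = cos_sol[OF hloc] sin_sol[OF hloc]
  have ac: "ac_deriv UNIV y z" unfolding y_def z_def
    using cs unfolding ode_sol_def by (intro ac_deriv_add ac_deriv_cmult ac_deriv_linear[OF _ bounded_linear_of_real]) auto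
  have "ac_deriv UNIV z (\<lambda>x. a * complex_of_real (h x * cos_sol h x) + b * complex_of_real (h x * sin_sol h x))"
    unfolding z_def
    using cs unfolding ode_sol_def by (intro ac_deriv_add ac_deriv_cmult ac_deriv_linear[OF _ bounded_linear_of_real]) auto
  then have ac': "ac_deriv UNIV z (\<lambda>x. complex_of_real (p x - E) * y x)"
    by (simp add: y_def h_def algebra_simps)
  note sh = fundamental_shift[OF loc L1_evenD(1)[OF p], of E, folded h_def, unfolded m]
  \<comment> \<open>Arbitrary \<open>C\<close> and \<open>S\<close> let one identity serve values
    and slopes alike.\<close>
  have step: "a * complex_of_real (\<Delta> * C + m21 p E * S) + b * complex_of_real (m12 p E * C + \<Delta> * S)
      = \<rho> * (a * complex_of_real C + b * complex_of_real S)" for C S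
  proof -
    have "a * complex_of_real (\<Delta> * C + m21 p E * S) + b * complex_of_real (m12 p E * C + \<Delta> * S)
      = (complex_of_real \<Delta> * a + complex_of_real (m12 p E) * b) * complex_of_real C +
        (complex_of_real (m21 p E) * a + complex_of_real \<Delta> * b) * complex_of_real S"
      by (simp add: algebra_simps)
    then show ?thesis unfolding eig by (simp add: algebra_simps)
  qed
  have yper: "cmod (y (x + 1)) = cmod (y x)" and zper: "cmod (z (x + 1)) = cmod (z x)" for x
    unfolding y_def z_def sh step by (simp_all add: norm_mult \<rho>)
  have cy: "continuous_on A y" and cz: "continuous_on A z" for A
    using ac_deriv_continuous_UNIV[OF ac] ac_deriv_continuous_UNIV[OF ac'] by auto
  obtain B1 where B1: "\<And>x. cmod (y x) \<le> B1"
    by (rule periodic_bounded[of "\<lambda>x. cmod (y x)"]) (auto intro!: continuous_intros cy yper)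
  obtain B2 where B2: "\<And>x. cmod (z x) \<le> B2"
    by (rule periodic_bounded[of "\<lambda>x. cmod (z x)"]) (auto intro!: continuous_intros cz zper)
  define w where "w = (\<lambda>x. (cmod (y x))\<^sup>2)"
  have cw: "continuous_on A w" for A unfolding w_def by (intro continuous_intros cy)
  define c where "c = integral {0..1} w"
  have Ic: "integral {0..real n} w = real n * c" for n
  proof (induction n)
    case (Suc n)
    have "integral {0..real (Suc n)} w = integral {0..1} w + 1 * integral {0..real n} w"
      by (rule integral_multiplicative_recursion[OF cw]) (simp add: w_def yper)
    then show ?case using Suc by (simp add: c_def algebra_simps)
  qed simp
  have "c > 0"
  proof -
    have "c \<noteq> 0"
    proof
      assume "c = 0"
      then have "\<forall>x\<in>{0..1}. w x = 0"
        unfolding c_def using integral_eq_0_iff[OF cw, of 0 1] by (simp add: w_def)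
      then have y0: "y x = 0" if "x \<in> {0..1}" for x using that by (simp add: w_def)
      have ode: "ode_sol h {0..1} (\<lambda>x. L (y x)) (\<lambda>x. L (z x))" if "bounded_linear L" for L :: "complex \<Rightarrow> real"
        by (rule ode_sol_of_complex[OF ac_deriv_subset[OF ac subset_UNIV] ac_deriv_subset[OF ac' subset_UNIV]
              is_interval_cc negligible_empty _ that]) (simp add: h_def)
      have "Re (z 0) = 0" "Im (z 0) = 0"
        using ode_sol_vanishing[OF ode[OF bounded_linear_Re]] ode_sol_vanishing[OF ode[OF bounded_linear_Im]] y0 by auto
      then have "z 0 = 0" by (simp add: complex_eq_iff)
      moreover have "y 0 = 0" using y0[of 0] by simp
      ultimately show False using ab cs by (simp add: y_def z_def)
    qed
    moreover have "c \<ge> 0" unfolding c_def by (rule integral_nonneg[OF integrable_continuous_real[OF cw]]) (simp add: w_def)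
    ultimately show ?thesis by simp
  qed
  show ?thesis
  proof (rule that[OF ac ac' _ _ \<open>c > 0\<close> Ic[unfolded w_def]])
    show "cmod (y x) \<le> max B1 B2" "cmod (z x) \<le> max B1 B2" for x
      using B1[of x] B2[of x] by auto
  qed
qed

section \<open>Weyl sequences\<close>

lemma bounded_support_L2:
  assumes f: "f \<in> borel_measurable borel" and S: "S \<in> sets borel" "emeasure lborel S < \<infinity>"
    and bound: "\<And>x. cmod (f x) \<le> K * indicator S x"
  shows "f \<in> L2" "integral\<^sup>L lebesgue (\<lambda>x. (cmod (f x))\<^sup>2) \<le> K\<^sup>2 * measure lborel S"
proof -
  have meas: "f \<in> borel_measurable lebesgue" using f by (intro measurable_completion) simp
  have iS: "integrable lebesgue (\<lambda>x. K\<^sup>2 * indicator S x :: real)"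
    using S by (intro integrable_mult_right) (simp add: integrable_indicator_iff)
  have le: "(cmod (f x))\<^sup>2 \<le> K\<^sup>2 * indicator S x" for x
  proof (cases "x \<in> S")
    case True
    then show ?thesis using power_mono[OF bound[of x], of 2] by simp
  next
    case False
    then show ?thesis using bound[of x] by simp
  qed
  have int: "integrable lebesgue (\<lambda>x. (cmod (f x))\<^sup>2)"
    by (rule Bochner_Integration.integrable_bound[OF iS])
       (use meas le in \<open>auto intro!: always_eventually\<close>)
  show "f \<in> L2" using meas int by (simp add: L2_def)
  have "integral\<^sup>L lebesgue (\<lambda>x. (cmod (f x))\<^sup>2) \<le> integral\<^sup>L lebesgue (\<lambda>x. K\<^sup>2 * indicator S x)"
    by (rule integral_mono[OF int iS]) (rule le)
  also have "\<dots> = K\<^sup>2 * measure lborel S" using S by simp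
  finally show "integral\<^sup>L lebesgue (\<lambda>x. (cmod (f x))\<^sup>2) \<le> K\<^sup>2 * measure lborel S" .
qed

lemma smooth_step''_measurable [measurable]: "smooth_step'' \<in> borel_measurable borel"
  unfolding smooth_step''_def by measurable

text \<open>Weyl sequence: the bounded Bloch solution cut off to \<open>[0, n + 1]\<close>. The residual lives on two
  unit intervals, whereas the norm grows with \<open>n\<close>.\<close>

lemma weyl_sequence:
  assumes p: "p \<in> L1_even" and d: "\<bar>m11 p E\<bar> \<le> 1"
  obtains c K where "c > 0" "\<And>n. n \<ge> 1 \<Longrightarrow> \<exists>f g. schrodinger_op p f g \<and>
     (L2_nrm f)\<^sup>2 \<ge> (real n - 1) * c \<and> (L2_nrm (\<lambda>x. g x - complex_of_real E * f x))\<^sup>2 \<le> K"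
proof -
  obtain y z :: "real \<Rightarrow> complex" and B c where y: "ac_deriv UNIV y z" "ac_deriv UNIV z (\<lambda>x. complex_of_real (p x - E) * y x)"
    and B: "\<And>x. cmod (y x) \<le> B" "\<And>x. cmod (z x) \<le> B" and c: "c > 0"
    and I: "\<And>n. integral {0..real n} (\<lambda>x. (cmod (y x))\<^sup>2) = real n * c"
    by (rule bloch_solution[OF p d]) (rule that; assumption)
  have cy: "continuous_on A y" and cz: "continuous_on A z" for A
    using ac_deriv_continuous_UNIV[OF y(1)] ac_deriv_continuous_UNIV[OF y(2)] by auto
  have [measurable]: "y \<in> borel_measurable borel" "z \<in> borel_measurable borel"
    using cy cz by (auto intro: borel_measurable_continuous_onI)
  have cs: "continuous_on A smooth_step" and cs': "continuous_on A smooth_step'" for A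
    by (rule ac_deriv_continuous_UNIV[OF ac_deriv_smooth_step], rule ac_deriv_continuous_UNIV[OF ac_deriv_smooth_step'])
  have [measurable]: "smooth_step \<in> borel_measurable borel" "smooth_step' \<in> borel_measurable borel"
    using cs cs' by (auto intro: borel_measurable_continuous_onI)
  have B0: "B \<ge> 0" using B(1)[of 0] norm_ge_zero order_trans by blast
  \<comment> \<open>The residual has modulus at most 12 * B + 2 * 12 * B, since a difference of two
    steps has derivatives of modulus at most 12, and it lives on a set of measure at most 2.\<close>
  define K where "K = (36 * B)\<^sup>2 * 2"
  have "\<exists>f g. schrodinger_op p f g \<and> (L2_nrm f)\<^sup>2 \<ge> (real n - 1) * c \<and>
      (L2_nrm (\<lambda>x. g x - complex_of_real E * f x))\<^sup>2 \<le> K" if n: "n \<ge> 1" for n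
  proof -
    \<comment> \<open>The cut-off rises on [0, 1], equals 1 on [1, n] and falls on
      [n, n + 1].\<close>
    define \<eta> where "\<eta> = (\<lambda>x. smooth_step x - smooth_step (x - real n))"
    define \<eta>' where "\<eta>' = (\<lambda>x. smooth_step' x - smooth_step' (x - real n))"
    define \<eta>'' where "\<eta>'' = (\<lambda>x. smooth_step'' x - smooth_step'' (x - real n))"
    have [measurable]: "\<eta> \<in> borel_measurable borel" "\<eta>' \<in> borel_measurable borel" "\<eta>'' \<in> borel_measurable borel"
      unfolding \<eta>_def \<eta>'_def \<eta>''_def by measurable
    have "ac_deriv UNIV \<eta> \<eta>'" "ac_deriv UNIV \<eta>' \<eta>''"
      unfolding \<eta>_def \<eta>'_def \<eta>''_def
      using ac_deriv_diff[OF ac_deriv_smooth_step] ac_deriv_shift[OF ac_deriv_smooth_step, of "- real n"]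
        ac_deriv_diff[OF ac_deriv_smooth_step'] ac_deriv_shift[OF ac_deriv_smooth_step', of "- real n"] by simp_all
    then have X: "ac_deriv UNIV (\<lambda>x. complex_of_real (\<eta> x)) (\<lambda>x. complex_of_real (\<eta>' x))"
      "ac_deriv UNIV (\<lambda>x. complex_of_real (\<eta>' x)) (\<lambda>x. complex_of_real (\<eta>'' x))"
      by (auto intro: ac_deriv_linear[OF _ bounded_linear_of_real])
    define f where "f = (\<lambda>x. complex_of_real (\<eta> x) * y x)"
    define f' where "f' = (\<lambda>x. complex_of_real (\<eta>' x) * y x + complex_of_real (\<eta> x) * z x)"
    \<comment> \<open>What is left of (\<eta> y)'' after the equation for \<open>y\<close> has been
      used: terms with a derivative of the cut-off, which vanish where it is constant.\<close>
    define r where "r = (\<lambda>x. complex_of_real (\<eta>'' x) * y x + 2 * complex_of_real (\<eta>' x) * z x)"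
    define f'' where "f'' = (\<lambda>x. r x + complex_of_real (p x - E) * f x)"
    have 1: "ac_deriv UNIV f f'"
      unfolding f_def f'_def by (rule ac_deriv_mult[OF X(1) y(1) is_interval_univ])
    have 2: "ac_deriv UNIV f' f''"
      unfolding f'_def
      by (rule ac_deriv_cong[OF ac_deriv_add[OF ac_deriv_mult[OF X(2) y(1) is_interval_univ] ac_deriv_mult[OF X(1) y(2) is_interval_univ]]])
         (auto simp: f''_def r_def f_def algebra_simps)
    define g where "g = (\<lambda>x. complex_of_real E * f x - r x)"
    have \<eta>1: "\<bar>\<eta> x\<bar> \<le> 2" for x
    proof -
      have "\<bar>smooth_step x\<bar> \<le> 1" for x
      proof -
        define t where "t = max 0 (min 1 x)"
        have t: "0 \<le> t" "t \<le> 1" by (auto simp: t_def)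
        have "3 * t\<^sup>2 - 2 * t ^ 3 = t\<^sup>2 * (3 - 2 * t)" "1 - (3 * t\<^sup>2 - 2 * t ^ 3) = (1 - t)\<^sup>2 * (1 + 2 * t)"
          by (simp_all add: power2_eq_square power3_eq_cube algebra_simps)
        moreover have "0 \<le> t\<^sup>2 * (3 - 2 * t)" "0 \<le> (1 - t)\<^sup>2 * (1 + 2 * t)" using t by auto
        ultimately have "\<bar>3 * t\<^sup>2 - 2 * t ^ 3\<bar> \<le> 1" by linarith
        then show ?thesis by (simp add: smooth_step_def Let_def t_def)
      qed
      from this[of x] this[of "x - real n"] show ?thesis unfolding \<eta>_def by linarith
    qed
    have fb: "cmod (f x) \<le> 2 * B * indicator {0..real n + 1} x" for x
    proof (cases "x \<in> {0..real n + 1}")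
      case True
      then show ?thesis unfolding f_def norm_mult using \<eta>1[of x] B(1)[of x] B0 by (simp add: mult_mono)
    next
      case False
      then have "\<eta> x = 0" using n by (auto simp: \<eta>_def smooth_step_cases)
      then show ?thesis using False by (simp add: f_def)
    qed
    have rb: "cmod (r x) \<le> 36 * B * indicator ({0..1} \<union> {real n..real n + 1}) x" for x
    proof (cases "x \<in> {0..1} \<union> {real n..real n + 1}")
      case True
      have "cmod (r x) \<le> \<bar>\<eta>'' x\<bar> * cmod (y x) + 2 * \<bar>\<eta>' x\<bar> * cmod (z x)"
        unfolding r_def by (rule order_trans[OF norm_triangle_ineq]) (simp add: norm_mult)
      also have "\<bar>\<eta>'' x\<bar> \<le> 12" "\<bar>\<eta>' x\<bar> \<le> 12" for x
        using smooth_step''_bound[of x] smooth_step''_bound[of "x - real n"]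
          smooth_step'_bound[of x] smooth_step'_bound[of "x - real n"] unfolding \<eta>'_def \<eta>''_def by linarith+
      then have "\<bar>\<eta>'' x\<bar> * cmod (y x) + 2 * \<bar>\<eta>' x\<bar> * cmod (z x) \<le> 12 * B + 2 * 12 * B"
        using B[of x] B0 by (intro add_mono mult_mono) auto
      finally show ?thesis using True by simp
    next
      case False
      then have "\<eta>'' x = 0" "\<eta>' x = 0" using n by (auto simp: \<eta>'_def \<eta>''_def smooth_step'_cases smooth_step''_def)
      then show ?thesis using False by (simp add: r_def)
    qed
    have fL2: "f \<in> L2"
      by (rule bounded_support_L2(1)[OF _ _ _ fb]) (auto simp: f_def)
    have gb: "cmod (g x) \<le> (\<bar>E\<bar> * (2 * B) + 36 * B) * indicator {0..real n + 1} x" for x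
    proof -
      have "cmod (g x) \<le> \<bar>E\<bar> * cmod (f x) + cmod (r x)"
        unfolding g_def by (rule order_trans[OF norm_triangle_ineq4]) (simp add: norm_mult)
      also have "\<dots> \<le> \<bar>E\<bar> * (2 * B * indicator {0..real n + 1} x) + 36 * B * indicator ({0..1} \<union> {real n..real n + 1}) x"
        using fb[of x] rb[of x] by (intro add_mono mult_left_mono) auto
      also have "\<dots> \<le> \<bar>E\<bar> * (2 * B * indicator {0..real n + 1} x) + 36 * B * indicator {0..real n + 1} x"
        using B0 by (intro add_left_mono mult_left_mono) (auto simp: indicator_def)
      finally show ?thesis by (simp add: algebra_simps)
    qed
    have gL2: "g \<in> L2"
      by (rule bounded_support_L2(1)[OF _ _ _ gb]) (auto simp: g_def r_def f_def)
    have op: "schrodinger_op p f g"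
      unfolding schrodinger_op_def AC_deriv_on_iff
    proof (intro conjI exI)
      show "AE x in lebesgue. g x = - f'' x + complex_of_real (p x) * f x"
        by (simp add: g_def f''_def algebra_simps)
    qed (use fL2 gL2 1 2 in auto)
    \<comment> \<open>The truncation leaves \<open>y\<close> unchanged on [1, n], which holds n - 1
      full periods.\<close>
    have ge: "(real n - 1) * c \<le> (L2_nrm f)\<^sup>2"
    proof -
      have int: "integrable lebesgue (\<lambda>x. (cmod (f x))\<^sup>2)" using fL2 by (simp add: L2_def)
      have hi: "((\<lambda>x. (cmod (f x))\<^sup>2) has_integral integral\<^sup>L lebesgue (\<lambda>x. (cmod (f x))\<^sup>2)) UNIV"
        by (rule has_integral_integral_lebesgue[OF int])
      have cyi: "(\<lambda>x. (cmod (y x))\<^sup>2) integrable_on {a..b}" for a b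
        by (intro integrable_continuous_real continuous_intros cy)
      have "integral {0..1} (\<lambda>x. (cmod (y x))\<^sup>2) + integral {1..real n} (\<lambda>x. (cmod (y x))\<^sup>2)
          = integral {0..real n} (\<lambda>x. (cmod (y x))\<^sup>2)"
        using n by (intro Henstock_Kurzweil_Integration.integral_combine cyi) auto
      then have "(real n - 1) * c = integral {1..real n} (\<lambda>x. (cmod (y x))\<^sup>2)"
        using I[of n] I[of 1] by (simp add: algebra_simps)
      also have "\<dots> = integral {1..real n} (\<lambda>x. (cmod (f x))\<^sup>2)"
        by (rule integral_cong) (auto simp: f_def \<eta>_def smooth_step_cases)
      also have "\<dots> \<le> integral UNIV (\<lambda>x. (cmod (f x))\<^sup>2)"
        by (rule integral_subset_le) (auto intro!: integrable_on_subinterval[OF has_integral_integrable[OF hi]] has_integral_integrable[OF hi])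
      also have "\<dots> = integral\<^sup>L lebesgue (\<lambda>x. (cmod (f x))\<^sup>2)" using hi by (rule integral_unique)
      also have "\<dots> = (L2_nrm f)\<^sup>2" by (simp add: L2_nrm_def)
      finally show ?thesis .
    qed
    have "(L2_nrm (\<lambda>x. g x - complex_of_real E * f x))\<^sup>2 = integral\<^sup>L lebesgue (\<lambda>x. (cmod (r x))\<^sup>2)"
      by (simp add: L2_nrm_def g_def norm_minus_commute)
    also have "\<dots> \<le> (36 * B)\<^sup>2 * measure lborel ({0..1} \<union> {real n..real n + 1})"
    proof (rule bounded_support_L2(2)[OF _ _ _ rb])
      show "emeasure lborel ({0..1} \<union> {real n..real n + 1}) < \<infinity>"
        by (rule order_le_less_trans[OF emeasure_subadditive]) auto
    qed (auto simp: r_def)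
    also have "\<dots> \<le> (36 * B)\<^sup>2 * 2"
    proof (rule mult_left_mono)
      have "measure lborel ({0..1} \<union> {real n..real n + 1}) \<le> measure lborel {0..1::real} + measure lborel {real n..real n + 1}"
        by (rule measure_Un_le) auto
      then show "measure lborel ({0..1} \<union> {real n..real n + 1}) \<le> 2" by simp
    qed simp
    finally show ?thesis using op ge unfolding K_def by blast
  qed
  then show ?thesis using that[OF c] by blast
qed

text \<open>The bounded-below clause of \<open>resolvent_set\<close> fails: a constant
  \<open>C\<close> would give (n - 1) * c <= C^2 * K for all n >= 1.\<close>

lemma in_spectrum:
  assumes p: "p \<in> L1_even" and d: "\<bar>m11 p E\<bar> \<le> 1"
  shows "complex_of_real E \<in> op_spectrum p"
proof -
  have False if res: "complex_of_real E \<in> resolvent_set p"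
  proof -
    obtain c K where c: "c > 0" and W: "\<And>n. n \<ge> 1 \<Longrightarrow> \<exists>f g. schrodinger_op p f g \<and>
     (L2_nrm f)\<^sup>2 \<ge> (real n - 1) * c \<and> (L2_nrm (\<lambda>x. g x - complex_of_real E * f x))\<^sup>2 \<le> K"
      using weyl_sequence[OF p d] by metis
    obtain C where C: "\<And>f g. schrodinger_op p f g \<Longrightarrow> L2_nrm f \<le> C * L2_nrm (\<lambda>x. g x - complex_of_real E * f x)"
      using res unfolding resolvent_set_def by blast
    have nn: "L2_nrm f \<ge> 0" for f unfolding L2_nrm_def by (intro real_sqrt_ge_zero Bochner_Integration.integral_nonneg) auto
    have bd: "(real n - 1) * c \<le> C\<^sup>2 * K" if n: "n \<ge> 1" for n
    proof -
      obtain f g where fg: "schrodinger_op p f g" "(L2_nrm f)\<^sup>2 \<ge> (real n - 1) * c"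
        "(L2_nrm (\<lambda>x. g x - complex_of_real E * f x))\<^sup>2 \<le> K" using W[OF n] by blast
      have "(L2_nrm f)\<^sup>2 \<le> (C * L2_nrm (\<lambda>x. g x - complex_of_real E * f x))\<^sup>2"
        by (rule power_mono[OF C[OF fg(1)] nn])
      also have "\<dots> \<le> C\<^sup>2 * K" unfolding power_mult_distrib using fg(3) by (intro mult_left_mono) auto
      finally show ?thesis using fg(2) by linarith
    qed
    obtain n where "real n * c > C\<^sup>2 * K" using reals_Archimedean3[OF c] by blast
    then show False using bd[of "Suc n"] by simp
  qed
  then show ?thesis by (auto simp: op_spectrum_def)
qed

section \<open>Counting eigenvalues in a gap\<close>

lemma discriminant_outside_spectrum:
  assumes "p \<in> L1_even" "\<gamma> \<in> hill_gaps p" "E \<in> \<gamma>"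
  shows "\<bar>m11 p E\<bar> > 1"
  using in_components_subset[of \<gamma>] assms in_spectrum[OF assms(1), of E] unfolding hill_gaps_def
  by (meson linorder_not_le mem_Collect_eq subsetD)

section \<open>Dirichlet and Neumann eigenvalues as zeros of monodromy entries\<close>

lemma real_part_of_period_solution:
  assumes "solution_on_period p E y y'"
  obtains L :: "complex \<Rightarrow> real" where "bounded_linear L" "ode_sol (\<lambda>x. p x - E) {0..1} (\<lambda>x. L (y x)) (\<lambda>x. L (y' x))"
    "\<exists>x\<in>{0..1}. L (y x) \<noteq> 0"
proof -
  obtain y'' x where ac: "ac_deriv {0..1} y y'" "ac_deriv {0..1} y' y''" and x: "x \<in> {0..1}" "y x \<noteq> 0"
    and ae: "AE x in lebesgue_on {0..1}. - y'' x + complex_of_real (p x) * y x = complex_of_real E * y x"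
    using assms unfolding solution_on_period_def AC_deriv_on_iff by blast
  have "AE x in lebesgue. x \<in> {0..1} \<longrightarrow> - y'' x + complex_of_real (p x) * y x = complex_of_real E * y x"
    using ae by (subst (asm) AE_restrict_space_iff) auto
  then obtain N where N: "negligible N"
    "{x. \<not> (x \<in> {0..1} \<longrightarrow> - y'' x + complex_of_real (p x) * y x = complex_of_real E * y x)} \<subseteq> N"
    unfolding eventually_ae_filter_negligible by blast
  have eq: "y'' x = complex_of_real (p x - E) * y x" if "x \<in> {0..1} - N" for x
  proof -
    have "- y'' x + complex_of_real (p x) * y x = complex_of_real E * y x" using N(2) that by blast
    then have "y'' x = complex_of_real (p x) * y x - complex_of_real E * y x" by (metis add_uminus_conv_diff diff_diff_eq2 diff_eq_eq minus_diff_eq add.commute)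
    then show ?thesis by (simp add: algebra_simps)
  qed
  have "Re (y x) \<noteq> 0 \<or> Im (y x) \<noteq> 0" using x(2) by (simp add: complex_eq_iff)
  then have "\<exists>L :: complex \<Rightarrow> real. bounded_linear L \<and> L (y x) \<noteq> 0"
    by (elim disjE) (rule exI[of _ Re] exI[of _ Im]; simp add: bounded_linear_Re bounded_linear_Im)+
  then obtain L :: "complex \<Rightarrow> real" where L: "bounded_linear L" "L (y x) \<noteq> 0" by blast
  show ?thesis
    by (rule that[OF L(1) ode_sol_of_complex[OF ac is_interval_cc N(1) eq L(1)]]) (use x(1) L(2) in blast)+
qed

text \<open>With y 0 = 0 the solution is a multiple of the sine solution, and nontriviality makes
  the factor nonzero, so the sine solution itself vanishes at 1.\<close>

lemma dirichlet_eigenvalue_imp: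
  assumes p: "p \<in> L1_even" and "dirichlet_eigenvalue p \<mu>"
  shows "m12 p \<mu> = 0"
proof -
  have loc: "locally_integrable (\<lambda>x. p x - \<mu>)"
    by (rule locally_integrable_shift_energy[OF L1_even_locally_integrable[OF p]])
  obtain y y' where y: "solution_on_period p \<mu> y y'" "y 0 = 0" "y 1 = 0"
    using assms(2) unfolding dirichlet_eigenvalue_def by blast
  obtain L :: "complex \<Rightarrow> real" where L: "bounded_linear L" and s: "ode_sol (\<lambda>x. p x - \<mu>) {0..1} (\<lambda>x. L (y x)) (\<lambda>x. L (y' x))"
    and nz: "\<exists>x\<in>{0..1}. L (y x) \<noteq> 0"
    by (rule real_part_of_period_solution[OF y(1)])
  have L0: "L 0 = 0" by (rule linear_0[OF bounded_linear.linear[OF L]])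
  have e: "L (y x) = L (y' 0) * sin_sol (\<lambda>x. p x - \<mu>) x" if "x \<in> {0..1}" for x
    using ode_sol_expansion(1)[OF loc s is_interval_cc _ that] y(2) L0 by simp
  have "L (y' 0) \<noteq> 0" using nz e by force
  then show ?thesis using e[of 1] y(3) L0 by (simp add: m12_def)
qed

lemma neumann_eigenvalue_imp:
  assumes p: "p \<in> L1_even" and "neumann_eigenvalue p \<nu>"
  shows "m21 p \<nu> = 0"
proof -
  have loc: "locally_integrable (\<lambda>x. p x - \<nu>)"
    by (rule locally_integrable_shift_energy[OF L1_even_locally_integrable[OF p]])
  obtain y y' where y: "solution_on_period p \<nu> y y'" "y' 0 = 0" "y' 1 = 0"
    using assms(2) unfolding neumann_eigenvalue_def by blast
  obtain L :: "complex \<Rightarrow> real" where L: "bounded_linear L" and s: "ode_sol (\<lambda>x. p x - \<nu>) {0..1} (\<lambda>x. L (y x)) (\<lambda>x. L (y' x))"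
    and nz: "\<exists>x\<in>{0..1}. L (y x) \<noteq> 0"
    by (rule real_part_of_period_solution[OF y(1)])
  have L0: "L 0 = 0" by (rule linear_0[OF bounded_linear.linear[OF L]])
  have e: "L (y x) = L (y 0) * cos_sol (\<lambda>x. p x - \<nu>) x" "L (y' x) = L (y 0) * cos_sol' (\<lambda>x. p x - \<nu>) x"
    if "x \<in> {0..1}" for x
    using ode_sol_expansion[OF loc s is_interval_cc _ that] y(2) L0 by simp_all
  have "L (y 0) \<noteq> 0" using nz e(1) by force
  then show ?thesis using e(2)[of 1] y(3) L0 by (simp add: m21_def)
qed

text \<open>A point of \<gamma> beyond \<open>a\<close> or \<open>b\<close> would, together with
  points near the other end, enclose a point that \<gamma> omits; points strictly between are
  enclosed by points near both ends.\<close>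

lemma connected_eq_open_interval:
  fixes \<gamma> :: "real set"
  assumes c: "connected \<gamma>" and ab: "a < b" "a \<in> closure \<gamma>" "b \<in> closure \<gamma>" "a \<notin> \<gamma>" "b \<notin> \<gamma>"
  shows "\<gamma> = {a<..<b}"
proof -
  have near: "\<exists>y\<in>\<gamma>. \<bar>y - t\<bar> < e" if "t \<in> closure \<gamma>" "e > 0" for t e
    using that unfolding closure_approachable by (auto simp: dist_real_def)
  have between: "x \<in> \<gamma>" if "y \<in> \<gamma>" "w \<in> \<gamma>" "y \<le> x" "x \<le> w" for x y w
    using c that unfolding connected_iff_interval by blast
  \<comment> \<open>The radius b - a keeps \<open>ya\<close> below \<open>b\<close> and
    \<open>yb\<close> above \<open>a\<close>.\<close>
  obtain ya yb where y: "ya \<in> \<gamma>" "\<bar>ya - a\<bar> < b - a" "yb \<in> \<gamma>" "\<bar>yb - b\<bar> < b - a"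
    using near[OF ab(2), of "b - a"] near[OF ab(3), of "b - a"] ab(1) by auto
  have y': "ya \<le> b" "a \<le> yb" using y(2,4) by linarith+
  show ?thesis
  proof
    show "\<gamma> \<subseteq> {a<..<b}"
    proof
      fix x assume x: "x \<in> \<gamma>"
      have "\<not> x < a" using between[OF x y(3), of a] y' ab by auto
      moreover have "\<not> x > b" using between[OF y(1) x, of b] y' ab by auto
      moreover have "x \<noteq> a" "x \<noteq> b" using x ab by auto
      ultimately show "x \<in> {a<..<b}" by auto
    qed
    show "{a<..<b} \<subseteq> \<gamma>"
    proof
      fix x assume "x \<in> {a<..<b}"
      then have x: "x - a > 0" "b - x > 0" by auto
      obtain l r where "l \<in> \<gamma>" "\<bar>l - a\<bar> < x - a" "r \<in> \<gamma>" "\<bar>r - b\<bar> < b - x"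
        using near[OF ab(2) x(1)] near[OF ab(3) x(2)] by blast
      then show "x \<in> \<gamma>" using between[of l r x] by auto
    qed
  qed
qed

lemma ratio_strict_mono:
  assumes p: "p \<in> L1_even" and "a < b" and nz: "\<And>E. E \<in> {a..b} \<Longrightarrow> m11 p E \<noteq> 0"
  shows "ratio12 p a < ratio12 p b" "ratio21 p b < ratio21 p a"
  using monodromy_ratio_strict_mono[OF L1_even_locally_integrable[OF p] assms(2)] nz L1_even_m11_eq_m22[OF p]
  by (auto simp: ratio12_def ratio21_def)

lemma continuous_on_ratio:
  assumes p: "p \<in> L1_even" and nz: "\<And>E. E \<in> {a..b} \<Longrightarrow> m11 p E \<noteq> 0"
  shows "continuous_on {a..b} (ratio12 p)" "continuous_on {a..b} (ratio21 p)"
proof -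
  have c: "continuous_on {a..b} (m11 p)" "continuous_on {a..b} (m12 p)" "continuous_on {a..b} (m21 p)" "continuous_on {a..b} (m22 p)"
    using isCont_monodromy[OF L1_even_locally_integrable[OF p]] by (auto intro: continuous_at_imp_continuous_on)
  show "continuous_on {a..b} (ratio12 p)" "continuous_on {a..b} (ratio21 p)"
    unfolding ratio12_def ratio21_def using c nz L1_even_m11_eq_m22[OF p] by (auto intro!: continuous_on_divide)
qed

text \<open>By continuity the discriminant still has modulus at least 1 at the end points, so the
  ratios and their monotonicity extend to the closed gap.\<close>

lemma m11_nonzero_on_closure:
  assumes p: "p \<in> L1_even" and "a < b" and gap: "\<And>E. E \<in> {a<..<b} \<Longrightarrow> \<bar>m11 p E\<bar> > 1" and E: "E \<in> {a..b}"
  shows "m11 p E \<noteq> 0"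
proof -
  have "continuous_on (closure {a<..<b}) (\<lambda>E. \<bar>m11 p E\<bar>)"
    using isCont_monodromy(1)[OF L1_even_locally_integrable[OF p]]
    by (intro continuous_intros continuous_at_imp_continuous_on) auto
  then have "\<bar>m11 p E\<bar> \<ge> 1"
    by (rule continuous_ge_on_closure) (use assms(2) gap E in \<open>auto intro: less_imp_le\<close>)
  then show ?thesis by auto
qed

lemma ratio_product_pos:
  assumes "p \<in> L1_even" "\<bar>m11 p E\<bar> > 1"
  shows "ratio12 p E * ratio21 p E > 0"
proof -
  have "(m11 p E)\<^sup>2 > 1" using assms(2) by (metis abs_one abs_le_square_iff linorder_not_le one_power2)
  then show ?thesis using ratio_product[OF assms(1), of E] assms(2) by fastforce
qed

text \<open>In the gap u v = 1 - 1 / m11^2 is positive, whereas u vanishes at \<mu> and v at \<nu>.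
  So both points lie outside \<gamma> but in its closure and must be its ends when they differ; the
  sign of u follows by monotonicity from its zero at \<mu>.\<close>

lemma gap_endpoint_data:
  assumes p: "p \<in> L1_even" and g: "\<gamma> \<in> hill_gaps p" "gap_eigenvalues p \<gamma> \<mu> \<nu>"
  shows "ratio12 p \<mu> = 0" "ratio21 p \<nu> = 0"
    "\<mu> < \<nu> \<Longrightarrow> \<gamma> = {\<mu><..<\<nu>}" "\<mu> < \<nu> \<Longrightarrow> E \<in> \<gamma> \<Longrightarrow> ratio12 p E > 0"
    "\<nu> < \<mu> \<Longrightarrow> \<gamma> = {\<nu><..<\<mu>}" "\<nu> < \<mu> \<Longrightarrow> E \<in> \<gamma> \<Longrightarrow> ratio12 p E < 0"
proof -
  have gap: "\<bar>m11 p E\<bar> > 1" if "E \<in> \<gamma>" for E by (rule discriminant_outside_spectrum[OF p g(1) that])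
  have mu: "m12 p \<mu> = 0" and nu: "m21 p \<nu> = 0"
    using g(2) dirichlet_eigenvalue_imp[OF p] neumann_eigenvalue_imp[OF p] by (auto simp: gap_eigenvalues_def)
  show 0: "ratio12 p \<mu> = 0" "ratio21 p \<nu> = 0" using mu nu by (simp_all add: ratio12_def ratio21_def)
  have cl: "\<mu> \<in> closure \<gamma>" "\<nu> \<in> closure \<gamma>" using g(2) by (auto simp: gap_eigenvalues_def)
  have out: "\<mu> \<notin> \<gamma>" "\<nu> \<notin> \<gamma>"
    using ratio_product_pos[OF p gap] 0 by (metis less_irrefl mult_zero_left mult_zero_right)+
  have con: "connected \<gamma>" using g(1) unfolding hill_gaps_def by (rule in_components_connected)
  show eq: "\<mu> < \<nu> \<Longrightarrow> \<gamma> = {\<mu><..<\<nu>}" and eq': "\<nu> < \<mu> \<Longrightarrow> \<gamma> = {\<nu><..<\<mu>}"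
    using connected_eq_open_interval[OF con] cl out by auto
  show "ratio12 p E > 0" if "\<mu> < \<nu>" "E \<in> \<gamma>"
  proof -
    have "ratio12 p \<mu> < ratio12 p E"
      using that eq[OF that(1)] gap
      by (intro ratio_strict_mono[OF p] m11_nonzero_on_closure[OF p that(1)]) auto
    then show ?thesis by (simp add: 0)
  qed
  show "ratio12 p E < 0" if "\<nu> < \<mu>" "E \<in> \<gamma>"
  proof -
    have "ratio12 p E < ratio12 p \<mu>"
      using that eq'[OF that(1)] gap
      by (intro ratio_strict_mono[OF p] m11_nonzero_on_closure[OF p that(1)]) auto
    then show ?thesis by (simp add: 0)
  qed
qed

text \<open>\<open>ratio12\<close> increases along the whole half line, as the discriminant does not
  vanish there, and it is positive at very negative energies.\<close>

lemma unbounded_gap_ratio_pos: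
  assumes p: "p \<in> L1_even" and gap: "\<And>E. E < c \<Longrightarrow> \<bar>m11 p E\<bar> > 1" and E: "E < c"
  shows "ratio12 p E > 0"
proof -
  obtain E0 where E0: "\<And>E. E < E0 \<Longrightarrow> m12 p E * m22 p E > 0"
    using m12_m22_pos_at_low_energy[OF L1_even_locally_integrable[OF p]] by blast
  have low: "ratio12 p E > 0" if "E < E0" for E
    using E0[OF that] by (simp add: ratio12_def zero_less_divide_iff zero_less_mult_iff)
  show ?thesis
  proof (cases "E < E0")
    case False
    define E1 where "E1 = E0 - 1"
    have "ratio12 p E1 < ratio12 p E"
    proof (rule ratio_strict_mono(1)[OF p])
      show "E1 < E" using False by (simp add: E1_def)
      show "m11 p F \<noteq> 0" if "F \<in> {E1..E}" for F using gap[of F] that E by auto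
    qed
    then show ?thesis using low[of E1] by (simp add: E1_def)
  qed (rule low)
qed

section \<open>Counting solutions of the matching condition\<close>

lemma no_junction_eigenvalue:
  assumes "p1 \<in> L1_even" "p2 \<in> L1_even"
    and "\<And>E. E \<in> \<omega> \<Longrightarrow> \<bar>m11 p1 E\<bar> > 1" "\<And>E. E \<in> \<omega> \<Longrightarrow> \<bar>m11 p2 E\<bar> > 1"
    and "\<And>E. E \<in> \<omega> \<Longrightarrow> ratio12 p1 E * ratio12 p2 E > 0"
  shows "num_eigenvalues (junction p1 p2) \<omega> = 0"
proof -
  have "\<not> eigenvalue (junction p1 p2) E" if "E \<in> \<omega>" for E
    using junction_eigenvalue_iff[OF assms(1,2) assms(3,4)[OF that]] assms(5)[OF that] by simp
  then have "{E \<in> \<omega>. eigenvalue (junction p1 p2) E} = {}" by blast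
  then show ?thesis by (simp only: num_eigenvalues_def finite.emptyI card.empty if_True zero_enat_def)
qed

text \<open>The end point conditions are disjunctions because each end of an intersection may come
  from either gap. In any case one of the products in v1 * u2 - v2 * u1 vanishes there and the other
  fixes the sign. Both orders of the half lines are covered since the matching condition is
  symmetric.\<close>

lemma unique_junction_eigenvalue:
  assumes p: "p1 \<in> L1_even" "p2 \<in> L1_even" and ab: "a < b"
    and gap: "\<And>E. E \<in> {a<..<b} \<Longrightarrow> \<bar>m11 p1 E\<bar> > 1" "\<And>E. E \<in> {a<..<b} \<Longrightarrow> \<bar>m11 p2 E\<bar> > 1"
    and sign: "\<And>E. E \<in> {a<..<b} \<Longrightarrow> ratio12 p1 E > 0" "\<And>E. E \<in> {a<..<b} \<Longrightarrow> ratio12 p2 E < 0"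
    and left: "ratio12 p1 a = 0 \<or> ratio21 p2 a = 0" and right: "ratio21 p1 b = 0 \<or> ratio12 p2 b = 0"
  shows "num_eigenvalues (junction p1 p2) {a<..<b} = 1" "num_eigenvalues (junction p2 p1) {a<..<b} = 1"
proof -
  define u1 v1 u2 v2 where uv: "u1 = ratio12 p1" "v1 = ratio21 p1" "u2 = ratio12 p2" "v2 = ratio21 p2"
  have nz: "m11 p1 E \<noteq> 0" "m11 p2 E \<noteq> 0" if "E \<in> {a..b}" for E
    by (rule m11_nonzero_on_closure[OF p(1) ab gap(1) that] m11_nonzero_on_closure[OF p(2) ab gap(2) that]; assumption)+
  have mono: "u1 E < u1 F" "v1 F < v1 E" "u2 E < u2 F" "v2 F < v2 E" if "a \<le> E" "E < F" "F \<le> b" for E F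
    unfolding uv using that nz
    by (auto intro!: ratio_strict_mono[OF p(1)] ratio_strict_mono[OF p(2)])
  have su: "u1 E > 0" "v1 E > 0" "u2 E < 0" "v2 E < 0" if "E \<in> {a<..<b}" for E
    using sign[OF that] ratio_product_pos[OF p(1) gap(1)[OF that]] ratio_product_pos[OF p(2) gap(2)[OF that]]
    unfolding uv by (auto simp: zero_less_mult_iff)
  define G where "G = (\<lambda>E. v1 E * u2 E - v2 E * u1 E)"
  \<comment> \<open>Both - v2 * u1 and v1 * u2 increase: the first is a product of positive
    increasing factors, the second is minus a product of positive decreasing ones.\<close>
  have inc: "G E < G F" if "E \<in> {a<..<b}" "F \<in> {a<..<b}" "E < F" for E F
  proof -
    note m = mono[of E F] and s = su[OF that(1)] su[OF that(2)]
    have "(- v2 E) * u1 E < (- v2 F) * u1 F"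
      using m s that by (intro mult_strict_mono) auto
    moreover have "v1 F * (- u2 F) < v1 E * (- u2 E)"
      using m s that by (intro mult_strict_mono) auto
    ultimately show ?thesis by (simp add: G_def)
  qed
  define c where "c = (a + b) / 2"
  have c: "c \<in> {a<..<b}" "a < c" "c < b" using ab by (auto simp: c_def)
  \<comment> \<open>The sign hypotheses concern the open interval; strict monotonicity carries them
    from the midpoint to the ends.\<close>
  have "v1 a > 0" "u2 a < 0" using mono[of a c] su[OF c(1)] c by auto
  then have "v1 a * u2 a < 0" by (rule mult_pos_neg)
  moreover have "v2 a * u1 a = 0" using left by (auto simp: uv)
  ultimately have Ga: "G a < 0" by (simp only: G_def)
  have "u1 b > 0" "v2 b < 0" using mono[of c b] su[OF c(1)] c by auto
  then have "v2 b * u1 b < 0" by (intro mult_neg_pos)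
  moreover have "v1 b * u2 b = 0" using right by (auto simp: uv)
  ultimately have Gb: "G b > 0" by (simp only: G_def)
  have "continuous_on {a..b} G"
    unfolding G_def uv
    by (intro continuous_intros continuous_on_ratio[OF p(1)] continuous_on_ratio[OF p(2)] nz)
  then obtain E where E: "a \<le> E" "E \<le> b" "G E = 0"
    using IVT'[of G a 0 b] Ga Gb ab by auto
  then have Ein: "E \<in> {a<..<b}" using Ga Gb by (metis greaterThanLessThan_iff less_irrefl order_le_less)
  have uniq: "F \<in> {a<..<b} \<Longrightarrow> G F = 0 \<longleftrightarrow> F = E" for F
    using inc[OF Ein, of F] inc[of F E] Ein E(3) by (metis less_irrefl linorder_neqE)
  have prod: "u1 F * u2 F < 0" if "F \<in> {a<..<b}" for F using su[OF that] by (simp add: mult_pos_neg)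
  have S: "{F \<in> {a<..<b}. eigenvalue (junction p1 p2) F} = {E}"
    using junction_eigenvalue_iff[OF p gap] prod uniq Ein unfolding G_def uv by auto
  then show "num_eigenvalues (junction p1 p2) {a<..<b} = 1" by (simp only: num_eigenvalues_def) (simp add: one_enat_def)
  have "eigenvalue (junction p2 p1) F \<longleftrightarrow> eigenvalue (junction p1 p2) F" if "F \<in> {a<..<b}" for F
    unfolding junction_eigenvalue_iff[OF p(2,1) gap(2,1)[OF that]] junction_eigenvalue_iff[OF p gap[OF that]]
    by (metis mult.commute)
  then have "{F \<in> {a<..<b}. eigenvalue (junction p2 p1) F} = {E}" using S by blast
  then show "num_eigenvalues (junction p2 p1) {a<..<b} = 1" by (simp only: num_eigenvalues_def) (simp add: one_enat_def)
qed

lemma unique_junction_eigenvalue_bounded_gaps: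
  assumes p: "p1 \<in> L1_even" "p2 \<in> L1_even"
    and g1: "\<gamma>1 \<in> hill_gaps p1" "gap_eigenvalues p1 \<gamma>1 \<mu>1 \<nu>1" "\<mu>1 < \<nu>1"
    and g2: "\<gamma>2 \<in> hill_gaps p2" "gap_eigenvalues p2 \<gamma>2 \<mu>2 \<nu>2" "\<nu>2 < \<mu>2"
    and ne: "\<gamma>1 \<inter> \<gamma>2 \<noteq> {}"
  shows "num_eigenvalues (junction p1 p2) (\<gamma>1 \<inter> \<gamma>2) = 1" "num_eigenvalues (junction p2 p1) (\<gamma>1 \<inter> \<gamma>2) = 1"
proof -
  note d1 = gap_endpoint_data[OF p(1) g1(1,2)] and d2 = gap_endpoint_data[OF p(2) g2(1,2)]
  \<comment> \<open>Each end is a zero of some ratio: on the left \<open>ratio12 p1\<close> at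
    \<mu>1 or \<open>ratio21 p2\<close> at \<nu>2, on the right \<open>ratio21 p1\<close> at \<nu>1
    or \<open>ratio12 p2\<close> at \<mu>2.\<close>
  define a b where "a = max \<mu>1 \<nu>2" and "b = min \<nu>1 \<mu>2"
  have eq: "\<gamma>1 \<inter> \<gamma>2 = {a<..<b}"
    unfolding d1(3)[OF g1(3)] d2(5)[OF g2(3)] a_def b_def by auto
  have ab: "a < b" using ne unfolding eq by auto
  have sub: "E \<in> \<gamma>1" "E \<in> \<gamma>2" if "E \<in> {a<..<b}" for E
    using that unfolding eq[symmetric] by simp_all
  have left: "ratio12 p1 a = 0 \<or> ratio21 p2 a = 0"
    using d1(1) d2(2) by (auto simp: a_def max_def)
  have right: "ratio21 p1 b = 0 \<or> ratio12 p2 b = 0"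
    using d1(2) d2(1) by (auto simp: b_def min_def)
  show "num_eigenvalues (junction p1 p2) (\<gamma>1 \<inter> \<gamma>2) = 1" "num_eigenvalues (junction p2 p1) (\<gamma>1 \<inter> \<gamma>2) = 1"
    unfolding eq
    by (rule unique_junction_eigenvalue[OF p ab discriminant_outside_spectrum[OF p(1) g1(1) sub(1)]
        discriminant_outside_spectrum[OF p(2) g2(1) sub(2)] d1(4)[OF g1(3) sub(1)] d2(6)[OF g2(3) sub(2)] left right]; assumption)+
qed

theorem theorem2p2:
  fixes p\<^sub>1 p\<^sub>2 :: "real \<Rightarrow> real" and \<gamma>\<^sub>1 \<gamma>\<^sub>2 \<gamma>\<^sub>T :: "real set"
  assumes "p\<^sub>1 \<in> L1_even" and "p\<^sub>2 \<in> L1_even"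
    and "\<gamma>\<^sub>1 \<in> hill_gaps p\<^sub>1" and "\<gamma>\<^sub>2 \<in> hill_gaps p\<^sub>2"
    and "\<gamma>\<^sub>T \<in> junction_gaps p\<^sub>1 p\<^sub>2" and "\<gamma>\<^sub>T = \<gamma>\<^sub>1 \<inter> \<gamma>\<^sub>2" and "\<gamma>\<^sub>T \<noteq> {}"
  shows
    "(\<forall>\<mu>\<^sub>1 \<nu>\<^sub>1 \<mu>\<^sub>2 \<nu>\<^sub>2. bounded \<gamma>\<^sub>1 \<and> bounded \<gamma>\<^sub>2 \<and>
        gap_eigenvalues p\<^sub>1 \<gamma>\<^sub>1 \<mu>\<^sub>1 \<nu>\<^sub>1 \<and> gap_eigenvalues p\<^sub>2 \<gamma>\<^sub>2 \<mu>\<^sub>2 \<nu>\<^sub>2 \<longrightarrow>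
          ((\<mu>\<^sub>1 - \<nu>\<^sub>1) * (\<mu>\<^sub>2 - \<nu>\<^sub>2) > 0 \<longrightarrow> num_eigenvalues (junction p\<^sub>1 p\<^sub>2) \<gamma>\<^sub>T = 0) \<and>
          ((\<mu>\<^sub>1 - \<nu>\<^sub>1) * (\<mu>\<^sub>2 - \<nu>\<^sub>2) < 0 \<longrightarrow> num_eigenvalues (junction p\<^sub>1 p\<^sub>2) \<gamma>\<^sub>T = 1)) \<and>
     (\<forall>\<mu>\<^sub>2 \<nu>\<^sub>2. bounded \<gamma>\<^sub>2 \<and> \<gamma>\<^sub>1 = {..<0} \<and> gap_eigenvalues p\<^sub>2 \<gamma>\<^sub>2 \<mu>\<^sub>2 \<nu>\<^sub>2 \<longrightarrow>
          (\<mu>\<^sub>2 < \<nu>\<^sub>2 \<longrightarrow> num_eigenvalues (junction p\<^sub>1 p\<^sub>2) \<gamma>\<^sub>T = 0) \<and>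
          (\<nu>\<^sub>2 < \<mu>\<^sub>2 \<and> \<mu>\<^sub>2 \<le> 0 \<longrightarrow> num_eigenvalues (junction p\<^sub>1 p\<^sub>2) \<gamma>\<^sub>T = 1)) \<and>
     (\<not> bounded \<gamma>\<^sub>1 \<and> \<not> bounded \<gamma>\<^sub>2 \<and> \<gamma>\<^sub>T = {..<0} \<longrightarrow>
          num_eigenvalues (junction p\<^sub>1 p\<^sub>2) \<gamma>\<^sub>T = 0)"
proof -
  note p = assms(1,2) and T = assms(6)
  have gap1: "\<bar>m11 p\<^sub>1 E\<bar> > 1" if "E \<in> \<gamma>\<^sub>1" for E by (rule discriminant_outside_spectrum[OF p(1) assms(3) that])
  have gap2: "\<bar>m11 p\<^sub>2 E\<bar> > 1" if "E \<in> \<gamma>\<^sub>2" for E by (rule discriminant_outside_spectrum[OF p(2) assms(4) that])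
  have ne: "\<gamma>\<^sub>1 \<inter> \<gamma>\<^sub>2 \<noteq> {}" "\<gamma>\<^sub>2 \<inter> \<gamma>\<^sub>1 \<noteq> {}" using T assms(7) by auto
  have none: "num_eigenvalues (junction p\<^sub>1 p\<^sub>2) \<gamma>\<^sub>T = 0"
    if "\<And>E. E \<in> \<gamma>\<^sub>T \<Longrightarrow> ratio12 p\<^sub>1 E * ratio12 p\<^sub>2 E > 0"
    by (rule no_junction_eigenvalue[OF p]) (use gap1 gap2 T that in auto)
  have a: "((\<mu>\<^sub>1 - \<nu>\<^sub>1) * (\<mu>\<^sub>2 - \<nu>\<^sub>2) > 0 \<longrightarrow> num_eigenvalues (junction p\<^sub>1 p\<^sub>2) \<gamma>\<^sub>T = 0) \<and>
          ((\<mu>\<^sub>1 - \<nu>\<^sub>1) * (\<mu>\<^sub>2 - \<nu>\<^sub>2) < 0 \<longrightarrow> num_eigenvalues (junction p\<^sub>1 p\<^sub>2) \<gamma>\<^sub>T = 1)"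
    if g: "gap_eigenvalues p\<^sub>1 \<gamma>\<^sub>1 \<mu>\<^sub>1 \<nu>\<^sub>1" "gap_eigenvalues p\<^sub>2 \<gamma>\<^sub>2 \<mu>\<^sub>2 \<nu>\<^sub>2" for \<mu>\<^sub>1 \<nu>\<^sub>1 \<mu>\<^sub>2 \<nu>\<^sub>2
  proof (intro conjI impI)
    note d1 = gap_endpoint_data[OF p(1) assms(3) g(1)] and d2 = gap_endpoint_data[OF p(2) assms(4) g(2)]
    assume "(\<mu>\<^sub>1 - \<nu>\<^sub>1) * (\<mu>\<^sub>2 - \<nu>\<^sub>2) > 0"
    then consider "\<mu>\<^sub>1 < \<nu>\<^sub>1" "\<mu>\<^sub>2 < \<nu>\<^sub>2" | "\<nu>\<^sub>1 < \<mu>\<^sub>1" "\<nu>\<^sub>2 < \<mu>\<^sub>2" by (auto simp: zero_less_mult_iff)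
    then show "num_eigenvalues (junction p\<^sub>1 p\<^sub>2) \<gamma>\<^sub>T = 0"
    proof cases
      case 1
      then show ?thesis using d1(4) d2(4) T by (intro none mult_pos_pos) auto
    next
      case 2
      then show ?thesis using d1(6) d2(6) T by (intro none mult_neg_neg) auto
    qed
  next
    assume "(\<mu>\<^sub>1 - \<nu>\<^sub>1) * (\<mu>\<^sub>2 - \<nu>\<^sub>2) < 0"
    then consider "\<mu>\<^sub>1 < \<nu>\<^sub>1" "\<nu>\<^sub>2 < \<mu>\<^sub>2" | "\<nu>\<^sub>1 < \<mu>\<^sub>1" "\<mu>\<^sub>2 < \<nu>\<^sub>2" by (auto simp: mult_less_0_iff)
    then show "num_eigenvalues (junction p\<^sub>1 p\<^sub>2) \<gamma>\<^sub>T = 1"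
    proof cases
      case 1
      then show ?thesis
        using unique_junction_eigenvalue_bounded_gaps(1)[OF p assms(3) g(1) _ assms(4) g(2) _ ne(1)] T by simp
    next
      \<comment> \<open>The positive ratio now belongs to the right half line, so the count is
        applied with the potentials exchanged, in its reversed form.\<close>
      case 2
      then show ?thesis
        using unique_junction_eigenvalue_bounded_gaps(2)[OF p(2,1) assms(4) g(2) _ assms(3) g(1) _ ne(2)] T
        by (simp add: Int_commute)
    qed
  qed
  have b: "(\<mu>\<^sub>2 < \<nu>\<^sub>2 \<longrightarrow> num_eigenvalues (junction p\<^sub>1 p\<^sub>2) \<gamma>\<^sub>T = 0) \<and>
          (\<nu>\<^sub>2 < \<mu>\<^sub>2 \<and> \<mu>\<^sub>2 \<le> 0 \<longrightarrow> num_eigenvalues (junction p\<^sub>1 p\<^sub>2) \<gamma>\<^sub>T = 1)"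
    if g: "\<gamma>\<^sub>1 = {..<0}" "gap_eigenvalues p\<^sub>2 \<gamma>\<^sub>2 \<mu>\<^sub>2 \<nu>\<^sub>2" for \<mu>\<^sub>2 \<nu>\<^sub>2
  proof (intro conjI impI)
    note d = gap_endpoint_data[OF p(2) assms(4) g(2)]
    have pos: "ratio12 p\<^sub>1 E > 0" if "E < 0" for E
      by (rule unbounded_gap_ratio_pos[OF p(1) _ that]) (use gap1 g(1) in auto)
    show "num_eigenvalues (junction p\<^sub>1 p\<^sub>2) \<gamma>\<^sub>T = 0" if "\<mu>\<^sub>2 < \<nu>\<^sub>2"
      using d(4)[OF that] pos T g(1) by (intro none mult_pos_pos) auto
    assume l: "\<nu>\<^sub>2 < \<mu>\<^sub>2 \<and> \<mu>\<^sub>2 \<le> 0"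
    \<comment> \<open>\<mu>2 <= 0 puts the whole second gap below 0, so it is the intersection. The
      end point conditions are met through \<open>p\<^sub>2\<close>: \<open>ratio21\<close> vanishes
      at the left end, \<open>ratio12\<close> at the right one.\<close>
    then have eq: "\<gamma>\<^sub>2 = {\<nu>\<^sub>2<..<\<mu>\<^sub>2}" "\<gamma>\<^sub>T = {\<nu>\<^sub>2<..<\<mu>\<^sub>2}" using d(5) T g(1) by auto
    show "num_eigenvalues (junction p\<^sub>1 p\<^sub>2) \<gamma>\<^sub>T = 1"
      unfolding eq(2) by (rule unique_junction_eigenvalue[OF p]) (use l eq(1) d gap1 gap2 pos g(1) in auto)
  qed
  \<comment> \<open>The half line below 0 then lies in both gaps, so both ratios are positive on it
    and the sign condition for an eigenvalue fails.\<close>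
  have c: "num_eigenvalues (junction p\<^sub>1 p\<^sub>2) \<gamma>\<^sub>T = 0" if "\<gamma>\<^sub>T = {..<0}"
  proof (rule none, rule mult_pos_pos)
    fix E assume "E \<in> \<gamma>\<^sub>T"
    then have E: "E < 0" using that by simp
    show "ratio12 p\<^sub>1 E > 0"
      by (rule unbounded_gap_ratio_pos[OF p(1) _ E]) (use gap1 T that in auto)
    show "ratio12 p\<^sub>2 E > 0"
      by (rule unbounded_gap_ratio_pos[OF p(2) _ E]) (use gap2 T that in auto)
  qed
  show ?thesis using a b c by blast
qed

end
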